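(* Let $0<\alpha<1$ and $0<q<1$ be constants and let $p$ be a prime. For each $n$, let $G=G(n,\alpha,q)$ be the random bipartite graph described in the context, and let $X_n$ denote the $p$-rank of its sandpile group $\Gamma(G)$. Then as $n\to\infty$: \begin{enumerate} \item if $\alpha<\frac{1}{p}$, then $\mathbb{E}(X_n)=\left(\frac{1}{p}-\alpha\right)n+O(1)$; \item if $\alpha>\frac{1}{p}$, then $\mathbb{E}(X_n)=O(1)$; \item if $\alpha=\frac{1}{p}$, then $\mathbb{E}(X_n)=\sqrt{\frac{\frac{1}{p}\left(1-\frac{1}{p}\right)n}{2\pi}}+O(1)$. \end{enumerate}
   Context: Random bipartite graph $G(n,\alpha,q)$: take two disjoint vertex sets $L$ and $R$ with $|L|=n$ and $|R|=\lfloor \alpha n\rfloor$, and for each pair $v\in L$, $u\in R$ include the edge $\{v,u\}$ independently with probability $q$; there are no other edges. For a connected graph $G$ on vertices $1,\dots,N$, the Laplacian is $\Delta=D-A$ where $A$ is the adjacency matrix and $D$ the diagonal degree matrix; the reduced Laplacian $\Delta'$ is obtained by deleting the row and column of one chosen vertex, and the sandpile group is $\Gamma(G)=\mathbb{Z}^{N-1}/\Delta'(\mathbb{Z}^{N-1})$ (independent of the choice of vertex up to isomorphism). If $G$ is disconnected, $\Gamma(G)$ is the direct sum of the sandpile groups of its connected components. The $p$-rank of a finite abelian group $\Gamma$ is $\dim_{\mathbb{F}_p}(\Gamma/p\Gamma)$. *)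

theory Defs
  imports
    "HOL-Algebra.Product_Groups"
    "HOL-Number_Theory.Residues"
    "HOL-Probability.Probability"
    "HOL-Probability.Product_PMF"
    "HOL-Library.Landau_Symbols"
    "Jordan_Normal_Form.Missing_VectorSpace"
begin

text \<open>
  A finite simple graph is given by a finite vertex set and a set of edges, each edge being
  a two-element set of vertices.
\<close>

type_synonym 'a sgraph = "'a set \<times> 'a set set"

definition induced_subgraph :: "'a sgraph \<Rightarrow> 'a set \<Rightarrow> 'a sgraph" where
  "induced_subgraph G C = (C, {e \<in> snd G. e \<subseteq> C})"

definition adjacency_rel :: "'a sgraph \<Rightarrow> 'a rel" where
  "adjacency_rel G = {(u, v). u \<in> fst G \<and> v \<in> fst G \<and> {u, v} \<in> snd G}"

definition component_sets :: "'a sgraph \<Rightarrow> 'a set set" where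
  "component_sets G = fst G // ((adjacency_rel G)\<^sup>* \<inter> fst G \<times> fst G)"

definition adjacency_mat :: "'a sgraph \<Rightarrow> 'a \<Rightarrow> 'a \<Rightarrow> int" where
  "adjacency_mat G u v = (if {u, v} \<in> snd G then 1 else 0)"

definition degree_mat :: "'a sgraph \<Rightarrow> 'a \<Rightarrow> 'a \<Rightarrow> int" where
  "degree_mat G u v = (if u = v then int (card {e \<in> snd G. u \<in> e}) else 0)"

definition laplacian :: "'a sgraph \<Rightarrow> 'a \<Rightarrow> 'a \<Rightarrow> int" where
  "laplacian G u v = degree_mat G u v - adjacency_mat G u v"

text \<open>
  The image of \<open>\<int>\<^bsup>W\<^esup>\<close> under the integer matrix with rows and columns indexed by \<open>W\<close>.
\<close>

definition lattice_image :: "'a set \<Rightarrow> ('a \<Rightarrow> 'a \<Rightarrow> int) \<Rightarrow> ('a \<Rightarrow> int) set" where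
  "lattice_image W M =
     (\<lambda>x. \<lambda>u\<in>W. \<Sum>v\<in>W. M u v * x v) ` carrier (product_group W (\<lambda>_. integer_group))"

text \<open>
  The sandpile group of a connected graph; deleting the row and column of \<open>r\<close> from the
  Laplacian amounts to restricting both indices to the remaining vertices.
\<close>

definition rooted_sandpile_group :: "'a sgraph \<Rightarrow> 'a \<Rightarrow> ('a \<Rightarrow> int) set monoid" where
  "rooted_sandpile_group G r =
     product_group (fst G - {r}) (\<lambda>_. integer_group)
       Mod lattice_image (fst G - {r}) (laplacian G)"

text \<open>
  The direct sum over all connected components, with an arbitrarily chosen root in each.
  For a connected graph there is one summand, namely the group of the whole graph.
\<close>

definition sandpile_group :: "'a sgraph \<Rightarrow> ('a set \<Rightarrow> ('a \<Rightarrow> int) set) monoid" where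
  "sandpile_group G =
     sum_group (component_sets G)
       (\<lambda>C. rooted_sandpile_group (induced_subgraph G C) (SOME r. r \<in> C))"

text \<open>
  For a multiplicatively written abelian group \<open>A\<close>, the quotient \<open>A/pA\<close> as a module over
  \<open>\<int>/p\<close>: addition is the group operation and \<open>k \<cdot> x\<close> is the \<open>k\<close>-th power.
  The fields \<open>mult\<close> and \<open>one\<close> of the record play no role in a module.
\<close>

definition mod_p_module :: "nat \<Rightarrow> ('a, 'b) monoid_scheme \<Rightarrow> (int, 'a set) module" where
  "mod_p_module p A =
     (let Q = A Mod ((\<lambda>x. x [^]\<^bsub>A\<^esub> p) ` carrier A)
      in \<lparr>carrier = carrier Q, monoid.mult = undefined, one = undefined,
          zero = \<one>\<^bsub>Q\<^esub>, add = (\<lambda>x y. x \<otimes>\<^bsub>Q\<^esub> y),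
          module.smult = (\<lambda>k x. x [^]\<^bsub>Q\<^esub> k)\<rparr>)"

definition p_rank :: "nat \<Rightarrow> ('a, 'b) monoid_scheme \<Rightarrow> nat" where
  "p_rank p A = vectorspace.dim (residue_ring (int p)) (mod_p_module p A)"

definition left_vertices :: "nat \<Rightarrow> (nat + nat) set" where
  "left_vertices n = Inl ` {..<n}"

definition right_vertices :: "nat \<Rightarrow> real \<Rightarrow> (nat + nat) set" where
  "right_vertices n \<alpha> = Inr ` {..<nat \<lfloor>\<alpha> * real n\<rfloor>}"

definition random_bipartite_graph :: "nat \<Rightarrow> real \<Rightarrow> real \<Rightarrow> (nat + nat) sgraph pmf" where
  "random_bipartite_graph n \<alpha> q =
     (let L = left_vertices n; R = right_vertices n \<alpha>
      in map_pmf (\<lambda>b. (L \<union> R, {{v, u} | v u. v \<in> L \<and> u \<in> R \<and> b (v, u)}))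
           (Pi_pmf (L \<times> R) False (\<lambda>_. bernoulli_pmf q)))"

definition expected_p_rank :: "nat \<Rightarrow> real \<Rightarrow> real \<Rightarrow> nat \<Rightarrow> real" where
  "expected_p_rank p \<alpha> q n =
     measure_pmf.expectation (random_bipartite_graph n \<alpha> q)
       (\<lambda>G. real (p_rank p (sandpile_group G)))"

end

theory Submission
  imports Defs "HOL-Real_Asymp.Real_Asymp"
begin

text \<open>
  Let there be \<open>n\<close> left and \<open>m\<close> right vertices, and let \<open>z\<close> be the number of left vertices whose
  degree is divisible by \<open>p\<close>.
  Modulo \<open>p\<close>, the kernel of the Laplacian is assembled from the kernel vectors supported on the
  left side, which live on the \<open>z\<close> zero-degree vertices and satisfy \<open>m\<close> equations, and from the
  projection \<open>J\<close> of the kernel to the right side.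

  To see that \<open>J\<close> has bounded expected dimension, reveal the column sums modulo \<open>p\<close> first and
  then the rows one by one. A new row that does not annihilate \<open>J\<close> lowers its dimension by one,
  any other row raises it by at most one, and by Odlyzko's argument the row annihilates \<open>J\<close> with
  probability exponentially small in \<open>dim J\<close>, because every entry keeps some randomness as long as
  boundedly many rows remain. An exponential potential then contracts, and \<open>n\<close> exceeds the initial
  dimension \<open>m\<close>. The same bound shows that the zero-degree rows have rank \<open>min z m\<close> up to
  a bounded expected error, so the expected \<open>p\<close>-rank is \<open>E max 0 (z - m)\<close> up to a bounded error.

  Finally \<open>z\<close> is binomial with a success probability exponentially close to \<open>1/p\<close>; a variance
  bound settles \<open>\<alpha> \<noteq> 1/p\<close>, and for \<open>\<alpha> = 1/p\<close> De Moivre's formula for the mean deviation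
  together with Stirling's formula gives the constant.
\<close>

section \<open>Subspaces of vectors modulo \<open>p\<close>\<close>

text \<open>The obstacle is the right half of the diagonal: a right degree depends on every row, so
  a matrix grown row by row would change its old diagonal at each step. Fixing the column sums
  modulo \<open>p\<close> freezes it; a left degree depends on its own row only. The price is that
  the rows become dependent. The conditioning is expressed by unnormalised weights, products over
  the columns of \<open>binmod\<close>, the probability that the unseen part of a column completes
  its sum. As \<open>binmod\<close> tends to 1/p, an entry with at least \<open>k0\<close> later
  rows takes either value with conditional probability at most \<open>b\<close> < 1; the last
  \<open>k0\<close> rows cost a constant factor each.

  The exponent \<open>th\<close> is tuned to p^th = 1/b. The potential |J|^th is then the reciprocal
  of Odlyzko's bound b^(dim J) for a row annihilating J, so these rows add only a constant to the
  expected potential while all others multiply it by b.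

  Dimensions appear only at the end: estimates are stated for cardinalities of finite sets of
  residue vectors and turned into ranks by logarithms.\<close>

definition fvec :: "nat \<Rightarrow> 'a set \<Rightarrow> ('a \<Rightarrow> int) set" where
  "fvec p I = PiE_dflt I 0 (\<lambda>_. {0..<int p})"

lemma fvec_iff: "x \<in> fvec p I \<longleftrightarrow> (\<forall>i\<in>I. 0 \<le> x i \<and> x i < int p) \<and> (\<forall>i. i \<notin> I \<longrightarrow> x i = 0)"
  unfolding fvec_def PiE_dflt_def by auto

lemma finite_fvec [simp]: "finite I \<Longrightarrow> finite (fvec p I)"
  unfolding fvec_def by (rule finite_PiE_dflt) auto

lemma card_fvec: "finite I \<Longrightarrow> card (fvec p I) = p ^ card I"
  unfolding fvec_def by (subst card_PiE_dflt) auto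

lemma fvec_mod: "x \<in> fvec p I \<Longrightarrow> x i mod int p = x i"
  by (cases "i \<in> I") (auto simp: fvec_iff)

lemma zero_in_fvec [simp]: "0 < p \<Longrightarrow> (\<lambda>_. 0) \<in> fvec p I"
  by (simp add: fvec_iff)

lemma fvec_eqI:
  assumes "x \<in> fvec p I" "y \<in> fvec p I" "\<And>i. i \<in> I \<Longrightarrow> int p dvd x i - y i"
  shows "x = y"
proof
  fix i
  have "int p dvd x i - y i"
    using assms by (cases "i \<in> I") (auto simp: fvec_iff)
  then have "x i mod int p = y i mod int p" by (simp only: mod_eq_dvd_iff)
  then show "x i = y i" using assms(1,2) by (simp add: fvec_mod)
qed

text \<open>Subspaces of F_p^I, with residues represented by integers in [0, p). Taking k = -1 and x
  = y gives the zero vector, hence all linear combinations.\<close>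

definition fsubspace :: "nat \<Rightarrow> 'a set \<Rightarrow> ('a \<Rightarrow> int) set \<Rightarrow> bool" where
  "fsubspace p I W \<longleftrightarrow> W \<subseteq> fvec p I \<and> W \<noteq> {} \<and>
     (\<forall>x\<in>W. \<forall>y\<in>W. \<forall>k. (\<lambda>i. (x i + k * y i) mod int p) \<in> W)"

lemma fsubspaceD:
  assumes "fsubspace p I W"
  shows "W \<subseteq> fvec p I" "W \<noteq> {}"
    "\<And>x y k. x \<in> W \<Longrightarrow> y \<in> W \<Longrightarrow> (\<lambda>i. (x i + k * y i) mod int p) \<in> W"
  using assms unfolding fsubspace_def by auto

lemma fsubspace_diff:
  assumes "fsubspace p I W" "x \<in> W" "y \<in> W"
  shows "(\<lambda>i. (x i - y i) mod int p) \<in> W"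
  using fsubspaceD(3)[OF assms, of "-1"] by simp

lemma fvec_lincomb:
  assumes "0 < p" "x \<in> fvec p I" "y \<in> fvec p I"
  shows "(\<lambda>i. (x i + k * y i) mod int p) \<in> fvec p I"
  using assms by (auto simp: fvec_iff)

lemma fsubspace_fvec: "0 < p \<Longrightarrow> fsubspace p I (fvec p I)"
  unfolding fsubspace_def using fvec_lincomb zero_in_fvec by blast

lemma fsubspace_finite: "finite I \<Longrightarrow> fsubspace p I W \<Longrightarrow> finite W"
  using finite_subset[OF fsubspaceD(1) finite_fvec] by blast

lemma fsubspace_card_pos: "finite I \<Longrightarrow> fsubspace p I W \<Longrightarrow> 0 < card W"
  by (simp add: card_gt_0_iff fsubspaceD(2) fsubspace_finite)

lemma sum_lincomb_mod:
  "(\<Sum>i\<in>B. (x i + k * y i) mod int p) mod int p = (sum x B + k * sum y B) mod int p"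
  by (simp add: mod_sum_eq sum.distrib sum_distrib_left)

lemma fsubspace_row_kernel:
  assumes "fsubspace p I W" "0 < p"
  shows "fsubspace p I {x \<in> W. int p dvd sum x B}"
proof -
  obtain w where w: "w \<in> W" using fsubspaceD(2)[OF assms(1)] by blast
  have z: "(\<lambda>_. 0) \<in> W" using fsubspace_diff[OF assms(1) w w] by simp
  show ?thesis
    unfolding fsubspace_def
  proof (intro conjI ballI allI)
    fix x y k assume x: "x \<in> {x \<in> W. int p dvd sum x B}" and y: "y \<in> {x \<in> W. int p dvd sum x B}"
    have "int p dvd (\<Sum>i\<in>B. (x i + k * y i) mod int p)"
      using x y sum_lincomb_mod[of x k y p B] by (simp add: dvd_eq_mod_eq_0 [symmetric])
    then show "(\<lambda>i. (x i + k * y i) mod int p) \<in> {x \<in> W. int p dvd sum x B}"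
      using fsubspaceD(3)[OF assms(1)] x y by simp
  qed (use z fsubspaceD(1)[OF assms(1)] in auto)
qed

text \<open>The counting substitute for rank-nullity: subtracting one of its points moves a fibre of
  f injectively into \<open>W0\<close>. Only differences inside a fibre are constrained because f is
  later also a map obtained by choosing witnesses, which is not linear.\<close>

lemma card_le_card_mult_differences:
  assumes "finite I" "W \<subseteq> fvec p I" "f ` W \<subseteq> T" "finite T" "finite W0"
    and "\<And>x y. x \<in> W \<Longrightarrow> y \<in> W \<Longrightarrow> f x = f y \<Longrightarrow> (\<lambda>i. (x i - y i) mod int p) \<in> W0"
  shows "card W \<le> card T * card W0"
proof -
  have fW: "finite W" using assms(1,2) finite_fvec finite_subset by metis
  have "card W = card (\<Union>t\<in>T. {x \<in> W. f x = t})"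
    by (rule arg_cong[of _ _ card]) (use assms(3) in auto)
  also have "\<dots> \<le> (\<Sum>t\<in>T. card {x \<in> W. f x = t})"
    by (rule card_UN_le[OF assms(4)])
  also have "\<dots> \<le> (\<Sum>t\<in>T. card W0)"
  proof (rule sum_mono)
    fix t assume "t \<in> T"
    show "card {x \<in> W. f x = t} \<le> card W0"
    proof (cases "{x \<in> W. f x = t} = {}")
      case False
      then obtain y where y: "y \<in> W" "f y = t" by auto
      let ?g = "\<lambda>x i. (x i - y i) mod int p"
      have inj: "inj_on ?g {x \<in> W. f x = t}"
      proof (rule inj_onI)
        fix a b assume a: "a \<in> {x \<in> W. f x = t}" and b: "b \<in> {x \<in> W. f x = t}" and eq: "?g a = ?g b"
        show "a = b"
        proof (rule fvec_eqI[of _ p I])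
          fix i
          have "int p dvd (a i - y i) - (b i - y i)" using fun_cong[OF eq, of i] by (simp only: mod_eq_dvd_iff)
          then show "int p dvd a i - b i" by simp
        qed (use a b assms(2) in auto)
      qed
      have "?g ` {x \<in> W. f x = t} \<subseteq> W0" using assms(6) y by auto
      then show ?thesis by (rule card_inj_on_le[OF inj _ assms(5)])
    next
      case True then show ?thesis by (simp only: card.empty)
    qed
  qed
  finally show ?thesis by simp
qed

lemma card_le_row_kernel:
  assumes "finite I" "fsubspace p I W" "0 < p"
  shows "card W \<le> p * card {x \<in> W. int p dvd sum x B}"
proof -
  have "card W \<le> card {0..<int p} * card {x \<in> W. int p dvd sum x B}"
  proof (rule card_le_card_mult_differences[OF assms(1) fsubspaceD(1)[OF assms(2)], of "\<lambda>x. (sum x B) mod int p"])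
    fix x y assume x: "x \<in> W" "y \<in> W" "(sum x B) mod int p = sum y B mod int p"
    have "int p dvd (\<Sum>i\<in>B. (x i - y i) mod int p)"
      using sum_lincomb_mod[of x "-1" y p B] x(3)
      by (simp add: mod_eq_dvd_iff) (metis dvd_eq_mod_eq_0 mod_eq_dvd_iff)
    then show "(\<lambda>i. (x i - y i) mod int p) \<in> {x \<in> W. int p dvd sum x B}"
      using fsubspace_diff[OF assms(2) x(1,2)] by simp
  qed (use assms fsubspace_finite[OF assms(1,2)] in auto)
  then show ?thesis by simp
qed

text \<open>The p translates of the kernel by multiples of e are disjoint: the sum over B determines
  the multiple, since its value at e is invertible modulo the prime p.\<close>

lemma card_row_kernel_le:
  assumes "finite I" "fsubspace p I W" "prime p" "e \<in> W" "\<not> int p dvd sum e B"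
  shows "p * card {x \<in> W. int p dvd sum x B} \<le> card W"
proof -
  let ?W0 = "{x \<in> W. int p dvd sum x B}"
  let ?g = "\<lambda>(k, x). \<lambda>i. (x i + k * e i) mod int p"
  have inj: "inj_on ?g ({0..<int p} \<times> ?W0)"
  proof (rule inj_onI, clarify)
    fix k x l y
    assume k: "k \<in> {0..<int p}" "l \<in> {0..<int p}" and x: "x \<in> W" "int p dvd sum x B"
      and y: "y \<in> W" "int p dvd sum y B"
      and eq: "(\<lambda>i. (x i + k * e i) mod int p) = (\<lambda>i. (y i + l * e i) mod int p)"
    have "(sum x B + k * sum e B) mod int p = (sum y B + l * sum e B) mod int p"
      using sum_lincomb_mod[of x k e p B] sum_lincomb_mod[of y l e p B] fun_cong[OF eq] by simp
    then have "int p dvd (sum x B + k * sum e B) - (sum y B + l * sum e B)"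
      by (simp only: mod_eq_dvd_iff)
    moreover have "(sum x B + k * sum e B) - (sum y B + l * sum e B)
        = (sum x B - sum y B) + (k - l) * sum e B"
      by (simp add: algebra_simps)
    ultimately have "int p dvd (k - l) * sum e B"
      using x(2) y(2) by (metis dvd_add_right_iff dvd_diff)
    then have "int p dvd k - l"
      using assms(3,5) by (metis prime_dvd_mult_iff prime_nat_int_transfer)
    then have kl: "k = l"
      using k by (metis atLeastLessThan_iff mod_eq_dvd_iff mod_pos_pos_trivial)
    have "x = y"
    proof (rule fvec_eqI[of _ p I])
      fix i
      have "int p dvd (x i + k * e i) - (y i + l * e i)"
        using fun_cong[OF eq, of i] by (simp only: mod_eq_dvd_iff)
      then show "int p dvd x i - y i" using kl by simp
    qed (use x y fsubspaceD(1)[OF assms(2)] in auto)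
    with kl show "k = l \<and> x = y" by simp
  qed
  have "?g ` ({0..<int p} \<times> ?W0) \<subseteq> W"
    using fsubspaceD(3)[OF assms(2) _ assms(4)] by auto
  then have "card ({0..<int p} \<times> ?W0) \<le> card W"
    by (rule card_inj_on_le[OF inj _ fsubspace_finite[OF assms(1,2)]])
  then show ?thesis by (simp add: card_cartesian_product)
qed

text \<open>Odlyzko's argument: once the entries outside the last coordinate are known, at most one value
  of the last entry is compatible with a constraint involving it. As \<open>card W\<close> is a power of \<open>p\<close>,
  the factor \<open>card W powr th\<close> is \<open>(1 / b) ^ dim W\<close>.\<close>

lemma weighted_annihilator_bound:
  fixes f0 f1 :: "nat \<Rightarrow> real"
  assumes p: "prime p" and W: "fsubspace p {..<m} W"
    and b: "0 < b" "b \<le> 1" and th: "real p powr th * b = 1"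
    and f: "\<And>u. u < m \<Longrightarrow> 0 \<le> f0 u" "\<And>u. u < m \<Longrightarrow> 0 \<le> f1 u"
      "\<And>u. u < m \<Longrightarrow> f0 u \<le> b * (f0 u + f1 u)" "\<And>u. u < m \<Longrightarrow> f1 u \<le> b * (f0 u + f1 u)"
  shows "(\<Sum>B | B \<subseteq> {..<m} \<and> (\<forall>y\<in>W. int p dvd sum y B).
            \<Prod>u<m. if u \<in> B then f1 u else f0 u) * real (card W) powr th
         \<le> (\<Prod>u<m. f0 u + f1 u)"
  using W f
proof (induction m arbitrary: W)
  case 0
  have "fvec p {..<0::nat} = {\<lambda>_. 0}" unfolding fvec_def PiE_dflt_def by auto
  then have "W = {\<lambda>_. 0}" using fsubspaceD(1,2)[OF "0.prems"(1)] by auto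
  moreover have "{B. B \<subseteq> {..<0::nat} \<and> (\<forall>y\<in>W. int p dvd sum y B)} = {{}}" by auto
  ultimately show ?case by simp
next
  case (Suc m)
  have p0: "0 < p" using p prime_gt_0_nat by blast
  have thpos: "0 \<le> th"
  proof (rule ccontr)
    assume "\<not> 0 \<le> th"
    then have "real p powr th < 1" using p prime_gt_1_nat[OF p] by (simp add: powr_less_one)
    then have "real p powr th * b < 1 * 1" using b by (intro mult_less_le_imp_less) auto
    with th show False by simp
  qed
  define W0 where "W0 = {y \<in> W. y m = 0}"
  have W0eq: "W0 = {y \<in> W. int p dvd (sum y {m})}"
  proof -
    have "int p dvd y m \<longleftrightarrow> y m = 0" if "y \<in> W" for y
      using fvec_mod[of y p "{..<Suc m}" m] fsubspaceD(1)[OF Suc.prems(1)] that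
      by (auto simp: dvd_eq_mod_eq_0)
    then show ?thesis unfolding W0_def by auto
  qed
  have sub0: "fsubspace p {..<Suc m} W0"
    unfolding W0eq by (rule fsubspace_row_kernel[OF Suc.prems(1) p0])
  have sub: "fsubspace p {..<m} W0"
  proof -
    have "W0 \<subseteq> fvec p {..<m}"
    proof
      fix y assume y: "y \<in> W0"
      then have "y m = 0" by (simp add: W0_def)
      moreover have "y \<in> fvec p {..<Suc m}" using fsubspaceD(1)[OF sub0] y by auto
      ultimately show "y \<in> fvec p {..<m}"
        unfolding fvec_iff by (metis lessThan_iff less_Suc_eq)
    qed
    with sub0 show ?thesis unfolding fsubspace_def by blast
  qed
  have cle: "card W \<le> p * card W0"
    unfolding W0eq by (rule card_le_row_kernel[OF _ Suc.prems(1) p0]) simp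
  define g where "g = (\<lambda>B. \<Prod>u<m. if u \<in> B then f1 u else f0 u)"
  define A where "A = {B. B \<subseteq> {..<m} \<and> (\<forall>y\<in>W0. int p dvd sum y B)}"
  define A' where "A' = {B. B \<subseteq> {..<Suc m} \<and> (\<forall>y\<in>W. int p dvd sum y B)}"
  have IH: "(sum g A) * real (card W0) powr th \<le> (\<Prod>u<m. f0 u + f1 u)"
    unfolding A_def g_def using Suc.prems by (intro Suc.IH[OF sub]) auto
  have gnn: "0 \<le> g B" for B unfolding g_def using Suc.prems by (intro prod_nonneg) auto
  have finA: "finite A" unfolding A_def by simp
  have finA': "finite A'" unfolding A'_def by simp
  define s where "s = f0 m + f1 m"
  have snn: "0 \<le> s" using Suc.prems(2)[of m] Suc.prems(3)[of m] by (simp add: s_def)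
  have remv: "B - {m} \<in> A" if "B \<in> A'" for B
  proof -
    have BS: "B \<subseteq> {..<Suc m}" using that by (simp add: A'_def)
    have "int p dvd sum y (B - {m})" if y: "y \<in> W0" for y
    proof -
      have "(sum y B) = sum y (B - {m})"
        using y finite_subset[OF BS] by (intro sum.mono_neutral_right) (auto simp: W0_def)
      then show ?thesis using \<open>B \<in> A'\<close> y by (auto simp: A'_def W0_def)
    qed
    then show ?thesis using BS unfolding A_def by (auto simp: less_Suc_eq)
  qed
  have prodS: "(\<Prod>u<Suc m. if u \<in> B then f1 u else f0 u) = g (B - {m}) * (if m \<in> B then f1 m else f0 m)" for B
  proof -
    have "(\<Prod>u<m. if u \<in> B then f1 u else f0 u) = g (B - {m})"
      unfolding g_def by (rule prod.cong) auto
    then show ?thesis by simp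
  qed
  have main: "(\<Sum>B\<in>A'. g (B - {m}) * (if m \<in> B then f1 m else f0 m)) * real (card W) powr th
      \<le> (sum g A * real (card W0) powr th) * s"
  proof (cases "W0 = W")
    \<comment> \<open>Coordinate m never occurs in W, so m may be added to B or not; the two weights
      sum to the full factor s, and no power of p is lost.\<close>
    case True
    have "(\<Sum>B\<in>A'. g (B - {m}) * (if m \<in> B then f1 m else f0 m)) \<le>
        (\<Sum>B\<in>A \<union> insert m ` A. g (B - {m}) * (if m \<in> B then f1 m else f0 m))"
    proof (rule sum_mono2)
      show "A' \<subseteq> A \<union> insert m ` A"
      proof
        fix B assume "B \<in> A'"
        from remv[OF this] show "B \<in> A \<union> insert m ` A"
          by (cases "m \<in> B") (auto simp: insert_absorb image_iff intro!: bexI[of _ "B - {m}"])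
      qed
    qed (use finA gnn Suc.prems in auto)
    also have "\<dots> = (\<Sum>B\<in>A. g (B - {m}) * (if m \<in> B then f1 m else f0 m))
        + (\<Sum>B\<in>insert m ` A. g (B - {m}) * (if m \<in> B then f1 m else f0 m))"
      using finA by (intro sum.union_disjoint) (auto simp: A_def)
    also have "(\<Sum>B\<in>insert m ` A. g (B - {m}) * (if m \<in> B then f1 m else f0 m))
        = (\<Sum>B\<in>A. g B * f1 m)"
    proof (subst sum.reindex)
      show "inj_on (insert m) A"
        by (rule inj_onI) (auto simp: A_def dest!: insert_ident[THEN iffD1, rotated 2])
    qed (auto intro!: sum.cong arg_cong[of _ _ g] simp: A_def)
    also have "(\<Sum>B\<in>A. g (B - {m}) * (if m \<in> B then f1 m else f0 m)) = (\<Sum>B\<in>A. g B * f0 m)"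
      by (rule sum.cong) (auto simp: A_def intro!: arg_cong[of _ _ g])
    finally have "(\<Sum>B\<in>A'. g (B - {m}) * (if m \<in> B then f1 m else f0 m)) \<le> (sum g A) * s"
      by (simp add: sum_distrib_right s_def distrib_left sum.distrib)
    from mult_right_mono[OF this powr_ge_zero[of "real (card W)" th]] True show ?thesis
      by (simp add: mult_ac)
  next
    case False
    then obtain y1 where y1: "y1 \<in> W" "\<not> int p dvd y1 m" unfolding W0eq by auto
    \<comment> \<open>Here B is determined by B - {m}, so only one of the two weights occurs. Each
      is at most b * s, and this b pays for the factor \<open>p powr th\<close> by which
      \<open>W\<close> may exceed \<open>W0\<close>.\<close>
    have inj: "inj_on (\<lambda>B. B - {m}) A'"
    proof (rule inj_onI)
      fix B C assume BC: "B \<in> A'" "C \<in> A'" and eq: "B - {m} = C - {m}"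
      have fin: "finite B" "finite C" using BC finite_subset[OF _ finite_lessThan] by (auto simp: A'_def)
      have "m \<in> B \<longleftrightarrow> m \<in> C"
      proof (rule ccontr)
        assume neq: "\<not> (m \<in> B \<longleftrightarrow> m \<in> C)"
        have dv: "int p dvd sum y1 B" "int p dvd sum y1 C"
          using BC y1 by (auto simp: A'_def)
        have rem: "(sum y1 X) = sum y1 (X - {m}) + (if m \<in> X then y1 m else 0)" if "finite X" for X
          using sum.remove[OF that, of m y1] by (cases "m \<in> X") auto
        have "int p dvd sum y1 (B - {m}) + (if m \<in> B then y1 m else 0)"
          "int p dvd sum y1 (B - {m}) + (if m \<in> C then y1 m else 0)"
          using dv rem[OF fin(1)] rem[OF fin(2)] eq by simp_all
        with neq have "int p dvd y1 m"
          by (cases "m \<in> B"; cases "m \<in> C") (auto simp: dvd_add_right_iff)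
        with y1 show False by simp
      qed
      with eq show "B = C" by blast
    qed
    have "(\<Sum>B\<in>A'. g (B - {m}) * (if m \<in> B then f1 m else f0 m)) \<le> (\<Sum>B\<in>A'. g (B - {m}) * (b * s))"
      using Suc.prems(4)[of m] Suc.prems(5)[of m] gnn
      by (intro sum_mono mult_left_mono) (auto simp: s_def)
    also have "\<dots> = (\<Sum>B\<in>(\<lambda>B. B - {m}) ` A'. g B * (b * s))"
      by (subst sum.reindex[OF inj]) simp
    also have "\<dots> \<le> (\<Sum>B\<in>A. g B * (b * s))"
      using remv gnn b snn by (intro sum_mono2 finA) auto
    finally have 1: "(\<Sum>B\<in>A'. g (B - {m}) * (if m \<in> B then f1 m else f0 m)) \<le> (sum g A) * (b * s)"
      by (simp add: sum_distrib_right)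
    have "real (card W) powr th \<le> (real p * real (card W0)) powr th"
      using cle thpos by (intro powr_mono2) (auto simp flip: of_nat_mult)
    also have "\<dots> = real p powr th * real (card W0) powr th"
      by (simp add: powr_mult)
    finally have 2: "real (card W) powr th \<le> real p powr th * real (card W0) powr th" .
    have "(\<Sum>B\<in>A'. g (B - {m}) * (if m \<in> B then f1 m else f0 m)) * real (card W) powr th
        \<le> (sum g A * (b * s)) * (real p powr th * real (card W0) powr th)"
      using b snn gnn by (intro mult_mono 1 2 mult_nonneg_nonneg sum_nonneg) auto
    also have "\<dots> = (sum g A * real (card W0) powr th * s) * (real p powr th * b)"
      by (simp only: mult_ac)
    finally show ?thesis by (simp add: th)
  qed
  also have "\<dots> \<le> (\<Prod>u<m. f0 u + f1 u) * s"
    using IH snn by (rule mult_right_mono)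
  finally show ?case unfolding A'_def[symmetric] prodS by (simp add: s_def)
qed

section \<open>Kernel vectors of the bipartite Laplacian\<close>

definition left_sum :: "nat \<Rightarrow> (nat \<Rightarrow> nat set) \<Rightarrow> (nat \<Rightarrow> int) \<Rightarrow> nat \<Rightarrow> int" where
  "left_sum t r x u = (\<Sum>v<t. if u \<in> r v then x v else 0)"

lemma left_sum_Suc: "left_sum (Suc t) r x u = left_sum t r x u + (if u \<in> r t then x t else 0)"
  by (simp add: left_sum_def)

lemma left_sum_lincomb: "left_sum t r (\<lambda>v. x v + k * y v) u = left_sum t r x u + k * left_sum t r y u"
  unfolding left_sum_def sum_distrib_left sum.distrib[symmetric] by (rule sum.cong) auto

lemma left_sum_mod: "left_sum t r (\<lambda>v. x v mod k) u mod k = left_sum t r x u mod k"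
proof -
  have "left_sum t r (\<lambda>v. x v mod k) u mod k = (\<Sum>v<t. (if u \<in> r v then x v else 0) mod k) mod k"
    unfolding left_sum_def by (auto intro!: sum.cong arg_cong[of _ _ "\<lambda>x. x mod k"])
  then show ?thesis unfolding left_sum_def by (simp add: mod_sum_eq)
qed

text \<open>Adjointness: \<open>left_sum\<close> is the transpose of the map taking y to its sums
  over the rows.\<close>

lemma sum_mult_left_sum:
  assumes "\<And>v. v < t \<Longrightarrow> r v \<subseteq> {..<m}"
  shows "(\<Sum>u<m. y u * left_sum t r x u) = (\<Sum>v<t. x v * sum y (r v))"
proof -
  have "(\<Sum>u<m. y u * left_sum t r x u) = (\<Sum>v<t. \<Sum>u<m. if u \<in> r v then x v * y u else 0)"
    unfolding left_sum_def sum_distrib_left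
    by (subst sum.swap) (auto intro!: sum.cong)
  also have "\<dots> = (\<Sum>v<t. \<Sum>u\<in>r v. x v * y u)"
    using assms by (intro sum.cong refl sum.mono_neutral_cong_right) auto
  finally show ?thesis by (simp add: sum_distrib_left)
qed

lemma dvd_diff_mod_cong: "a mod k = b mod k \<Longrightarrow> (k::int) dvd c - a \<longleftrightarrow> k dvd c - b"
  using mod_diff_right_eq[of c a k] mod_diff_right_eq[of c b k] by (simp add: dvd_eq_mod_eq_0)

text \<open>The equations say that \<open>(x, y)\<close> is killed, modulo \<open>p\<close>, by the Laplacian of the graph on the
  first \<open>t\<close> left vertices, where \<open>r v\<close> is the neighbourhood of \<open>v\<close> and the diagonal entries on the
  right side are prescribed to be \<open>D\<close> instead of the current degrees.\<close>

definition kernel_pair :: "nat \<Rightarrow> nat \<Rightarrow> nat \<Rightarrow> (nat \<Rightarrow> nat set) \<Rightarrow> (nat \<Rightarrow> int) \<Rightarrow> (nat \<Rightarrow> int) \<Rightarrow> (nat \<Rightarrow> int) \<Rightarrow> bool" where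
  "kernel_pair p m t r D y x \<longleftrightarrow>
     (\<forall>v<t. int p dvd int (card (r v)) * x v - sum y (r v)) \<and>
     (\<forall>u<m. int p dvd D u * y u - left_sum t r x u)"

text \<open>The space J of the overview. The eliminated left part is an arbitrary integer function,
  since only its residues enter the equations.\<close>

definition right_part :: "nat \<Rightarrow> nat \<Rightarrow> nat \<Rightarrow> (nat \<Rightarrow> nat set) \<Rightarrow> (nat \<Rightarrow> int) \<Rightarrow> (nat \<Rightarrow> int) set" where
  "right_part p m t r D = {y \<in> fvec p {..<m}. \<exists>x. kernel_pair p m t r D y x}"

lemma kernel_pair_lincomb:
  assumes "kernel_pair p m t r D y x" "kernel_pair p m t r D y' x'"
  shows "kernel_pair p m t r D (\<lambda>u. (y u + k * y' u) mod int p) (\<lambda>v. x v + k * x' v)"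
  unfolding kernel_pair_def
proof (intro conjI allI impI)
  fix v assume v: "v < t"
  have "int p dvd (int (card (r v)) * x v - sum y (r v)) + k * (int (card (r v)) * x' v - (\<Sum>u\<in>r v. y' u))"
    using assms v unfolding kernel_pair_def by (intro dvd_add dvd_mult) auto
  also have "\<dots> = int (card (r v)) * (x v + k * x' v) - (sum y (r v) + k * (\<Sum>u\<in>r v. y' u))"
    by (simp add: algebra_simps)
  finally show "int p dvd int (card (r v)) * (x v + k * x' v) - (\<Sum>u\<in>r v. (y u + k * y' u) mod int p)"
    using dvd_diff_mod_cong[OF sum_lincomb_mod] by blast
next
  fix u assume u: "u < m"
  have "int p dvd (D u * y u - left_sum t r x u) + k * (D u * y' u - left_sum t r x' u)"
    using assms u unfolding kernel_pair_def by (intro dvd_add dvd_mult) auto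
  also have "\<dots> = D u * (y u + k * y' u) - (left_sum t r x u + k * left_sum t r x' u)"
    by (simp add: algebra_simps)
  finally have "(D u * (y u + k * y' u) - left_sum t r (\<lambda>v. x v + k * x' v) u) mod int p = 0"
    by (simp add: left_sum_lincomb)
  then have "(D u * ((y u + k * y' u) mod int p) - left_sum t r (\<lambda>v. x v + k * x' v) u) mod int p = 0"
    by (metis mod_diff_left_eq mod_mult_right_eq)
  then show "int p dvd D u * ((y u + k * y' u) mod int p) - left_sum t r (\<lambda>v. x v + k * x' v) u"
    by (simp add: dvd_eq_mod_eq_0)
qed

lemma fsubspace_right_part:
  assumes "0 < p"
  shows "fsubspace p {..<m} (right_part p m t r D)"
  unfolding fsubspace_def
proof (intro conjI ballI allI)
  have "(\<lambda>_. 0) \<in> right_part p m t r D"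
    using assms unfolding right_part_def kernel_pair_def
    by (auto intro!: exI[of _ "\<lambda>_. 0"] simp: left_sum_def)
  then show "right_part p m t r D \<noteq> {}" by blast
  show "(\<lambda>i. (x i + k * y i) mod int p) \<in> right_part p m t r D"
    if "x \<in> right_part p m t r D" "y \<in> right_part p m t r D" for x y k
    using that kernel_pair_lincomb fvec_lincomb[OF assms] unfolding right_part_def by blast
qed (auto simp: right_part_def)

lemma right_part_cong:
  assumes "\<And>v. v < t \<Longrightarrow> r v = r' v" "\<And>u. u < m \<Longrightarrow> D u mod int p = D' u mod int p"
  shows "right_part p m t r D = right_part p m t r' D'"
proof -
  have 1: "left_sum t r x u = left_sum t r' x u" for x u
    unfolding left_sum_def using assms(1) by (intro sum.cong) auto
  have 2: "int p dvd D u * y - c \<longleftrightarrow> int p dvd D' u * y - c" if "u < m" for u y c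
  proof -
    have "(D u * y - c) mod int p = (D' u * y - c) mod int p"
      using assms(2)[OF that] by (metis mod_diff_left_eq mod_mult_left_eq)
    then show ?thesis by (simp add: dvd_eq_mod_eq_0)
  qed
  show ?thesis unfolding right_part_def kernel_pair_def using assms(1) by (auto simp: 1 2)
qed

text \<open>Pairing a kernel vector of the enlarged matrix with an old kernel vector that the new row
  does not annihilate forces the new coordinate to vanish.\<close>

lemma right_part_Suc_subset:
  assumes p: "prime p" and r: "\<And>v. v \<le> t \<Longrightarrow> r v \<subseteq> {..<m}"
    and y0: "y0 \<in> right_part p m t r D" and nd: "\<not> int p dvd sum y0 (r t)"
  shows "right_part p m (Suc t) r D \<subseteq> {y \<in> right_part p m t r D. int p dvd sum y (r t)}"
proof
  fix y assume "y \<in> right_part p m (Suc t) r D"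
  then obtain x where y: "y \<in> fvec p {..<m}" and x: "kernel_pair p m (Suc t) r D y x"
    unfolding right_part_def by blast
  obtain x0 where x0: "kernel_pair p m t r D y0 x0" using y0 unfolding right_part_def by blast
  let ?s = "\<lambda>v y. (sum y (r v))"
  \<comment> \<open>The old symmetric matrix is evaluated on the pair of vectors in both orders. S
    and c are the right and left diagonal contributions, a and b the two off-diagonal ones; the four
    resulting congruences cancel except for the contribution of the new row.\<close>
  define S where "S = (\<Sum>u<m. D u * y u * y0 u)"
  define a where "a = (\<Sum>v<t. x v * ?s v y0)"
  define b where "b = (\<Sum>v<t. x0 v * ?s v y)"
  define c where "c = (\<Sum>v<t. int (card (r v)) * x v * x0 v)"
  have "int p dvd (\<Sum>u<m. y0 u * (D u * y u - left_sum (Suc t) r x u))"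
    using x unfolding kernel_pair_def by (intro dvd_sum dvd_mult) auto
  also have "\<dots> = S - (\<Sum>u<m. y0 u * left_sum (Suc t) r x u)"
    by (simp add: S_def algebra_simps sum_subtractf)
  also have "(\<Sum>u<m. y0 u * left_sum (Suc t) r x u) = a + x t * ?s t y0"
    using r by (subst sum_mult_left_sum) (auto simp: a_def)
  finally have 1: "int p dvd S - (a + x t * ?s t y0)" .
  have "int p dvd (\<Sum>u<m. y u * (D u * y0 u - left_sum t r x0 u))"
    using x0 unfolding kernel_pair_def by (intro dvd_sum dvd_mult) auto
  also have "\<dots> = S - (\<Sum>u<m. y u * left_sum t r x0 u)"
    by (simp add: S_def algebra_simps sum_subtractf)
  also have "(\<Sum>u<m. y u * left_sum t r x0 u) = b"
    unfolding b_def using r by (intro sum_mult_left_sum) auto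
  finally have 2: "int p dvd S - b" .
  have "int p dvd (\<Sum>v<t. x v * (int (card (r v)) * x0 v - ?s v y0))"
    using x0 unfolding kernel_pair_def by (intro dvd_sum dvd_mult) auto
  then have 3: "int p dvd c - a"
    by (simp add: c_def a_def algebra_simps sum_subtractf)
  have "int p dvd (\<Sum>v<t. x0 v * (int (card (r v)) * x v - ?s v y))"
    using x unfolding kernel_pair_def by (intro dvd_sum dvd_mult) auto
  then have 4: "int p dvd c - b"
    by (simp add: c_def b_def algebra_simps sum_subtractf)
  have "x t * ?s t y0 = (S - b) - (S - (a + x t * ?s t y0)) - ((c - b) - (c - a))" by simp
  also have "int p dvd \<dots>" by (rule dvd_diff[OF dvd_diff[OF 2 1] dvd_diff[OF 4 3]])
  finally have px: "int p dvd x t" using p nd by (metis prime_dvd_mult_iff prime_nat_int_transfer)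
  have "int p dvd D u * y u - left_sum t r x u" if "u < m" for u
  proof -
    have "int p dvd D u * y u - left_sum (Suc t) r x u"
      using x that unfolding kernel_pair_def by blast
    then have "int p dvd (D u * y u - left_sum (Suc t) r x u) + (if u \<in> r t then x t else 0)"
      using px by (intro dvd_add) auto
    then show ?thesis by (simp add: left_sum_Suc)
  qed
  then have "kernel_pair p m t r D y x" using x unfolding kernel_pair_def by auto
  moreover have "int p dvd ?s t y"
  proof -
    have "int p dvd int (card (r t)) * x t - ?s t y" using x unfolding kernel_pair_def by blast
    then show ?thesis using px by (metis dvd_diff_right_iff dvd_mult)
  qed
  ultimately show "y \<in> {y \<in> right_part p m t r D. int p dvd ?s t y}"
    using y unfolding right_part_def by blast
qed

text \<open>Choose a left witness for every vector. Two vectors whose witnesses agree at the new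
  coordinate differ by a solution of the old system, so there are at most p classes.\<close>

lemma card_right_part_Suc_le:
  assumes p: "0 < p"
  shows "card (right_part p m (Suc t) r D) \<le> p * card (right_part p m t r D)"
proof -
  define w where "w = (\<lambda>y. SOME x. kernel_pair p m (Suc t) r D y x)"
  have w: "kernel_pair p m (Suc t) r D y (w y)" if "y \<in> right_part p m (Suc t) r D" for y
    using that unfolding right_part_def w_def by (simp add: someI_ex)
  have "card (right_part p m (Suc t) r D) \<le> card {0..<int p} * card (right_part p m t r D)"
  proof (rule card_le_card_mult_differences[of "{..<m}" _ p "\<lambda>y. w y t mod int p"])
    fix y z assume yz: "y \<in> right_part p m (Suc t) r D" "z \<in> right_part p m (Suc t) r D"
      and eq: "w y t mod int p = w z t mod int p"
    let ?d = "\<lambda>i. (y i - z i) mod int p" and ?x = "\<lambda>v. w y v - w z v"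
    have rk: "kernel_pair p m (Suc t) r D ?d ?x"
      using kernel_pair_lincomb[OF w w, of y z "-1"] yz by simp
    have xt: "int p dvd ?x t" using eq by (simp only: mod_eq_dvd_iff)
    have "int p dvd D u * ?d u - left_sum t r ?x u" if "u < m" for u
    proof -
      have "int p dvd (D u * ?d u - left_sum (Suc t) r ?x u) + (if u \<in> r t then ?x t else 0)"
        using rk xt that unfolding kernel_pair_def by (intro dvd_add) auto
      then show ?thesis by (simp add: left_sum_Suc)
    qed
    then have "kernel_pair p m t r D ?d ?x" using rk unfolding kernel_pair_def by auto
    moreover have "?d \<in> fvec p {..<m}"
      using yz fvec_lincomb[OF p, of y _ z "-1"] by (simp add: right_part_def)
    ultimately show "?d \<in> right_part p m t r D" unfolding right_part_def by blast
  qed (use p fsubspace_finite[OF _ fsubspace_right_part[OF p], of m t r D] in \<open>auto simp: right_part_def\<close>)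
  then show ?thesis by simp
qed

section \<open>Rows of degree divisible by \<open>p\<close>: their annihilator and their linear
  dependencies\<close>

definition zero_rows :: "nat \<Rightarrow> nat \<Rightarrow> (nat \<Rightarrow> nat set) \<Rightarrow> nat" where
  "zero_rows p t r = card {v. v < t \<and> p dvd card (r v)}"

lemma zero_rows_0 [simp]: "zero_rows p 0 r = 0"
  by (simp add: zero_rows_def)

lemma zero_rows_Suc: "zero_rows p (Suc t) r = zero_rows p t r + (if p dvd card (r t) then 1 else 0)"
proof -
  have "{v. v < Suc t \<and> p dvd card (r v)} = {v. v < t \<and> p dvd card (r v)} \<union> (if p dvd card (r t) then {t} else {})"
    by (auto simp: less_Suc_eq)
  then show ?thesis unfolding zero_rows_def by (auto simp: card_insert_if)
qed

lemma zero_rows_cong: "(\<And>v. v < t \<Longrightarrow> r v = r' v) \<Longrightarrow> zero_rows p t r = zero_rows p t r'"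
  unfolding zero_rows_def by (rule arg_cong[of _ _ card]) auto

text \<open>By duality its dimension is m minus the rank of the zero rows, so this set keeps track
  of the rank through a cardinality.\<close>

definition row_annihilator :: "nat \<Rightarrow> nat \<Rightarrow> nat \<Rightarrow> (nat \<Rightarrow> nat set) \<Rightarrow> (nat \<Rightarrow> int) set" where
  "row_annihilator p m t r = {y \<in> fvec p {..<m}. \<forall>v<t. p dvd card (r v) \<longrightarrow> int p dvd sum y (r v)}"

lemma row_annihilator_0 [simp]: "row_annihilator p m 0 r = fvec p {..<m}"
  by (simp add: row_annihilator_def)

lemma row_annihilator_Suc: "row_annihilator p m (Suc t) r =
    (if p dvd card (r t) then {y \<in> row_annihilator p m t r. int p dvd sum y (r t)} else row_annihilator p m t r)"
  by (auto simp: row_annihilator_def less_Suc_eq)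

lemma row_annihilator_cong: "(\<And>v. v < t \<Longrightarrow> r v = r' v) \<Longrightarrow> row_annihilator p m t r = row_annihilator p m t r'"
  by (auto simp: row_annihilator_def)

lemma fsubspace_row_annihilator: "0 < p \<Longrightarrow> fsubspace p {..<m} (row_annihilator p m t r)"
  by (induction t) (simp_all add: row_annihilator_Suc fsubspace_fvec fsubspace_row_kernel)

lemma card_row_annihilator_lower: "0 < p \<Longrightarrow> p ^ m \<le> card (row_annihilator p m t r) * p ^ zero_rows p t r"
proof (induction t)
  case 0 then show ?case by (simp add: card_fvec)
next
  case (Suc t)
  have "card (row_annihilator p m t r) \<le> p * card {y \<in> row_annihilator p m t r. int p dvd sum y (r t)}"
    using Suc.prems by (intro card_le_row_kernel[OF _ fsubspace_row_annihilator]) auto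
  from order_trans[OF Suc.IH[OF Suc.prems] mult_right_mono[OF this]]
  have "p ^ m \<le> p * card {y \<in> row_annihilator p m t r. int p dvd sum y (r t)} * p ^ zero_rows p t r"
    by simp
  with Suc.IH[OF Suc.prems] show ?case
    by (cases "p dvd card (r t)") (simp_all add: row_annihilator_Suc zero_rows_Suc mult_ac)
qed

text \<open>Kernel vectors with vanishing right part. For prime p the first condition forces x v = 0
  unless p divides the degree of v, so these are the linear dependencies among the zero
  rows.\<close>

definition left_kernel :: "nat \<Rightarrow> nat \<Rightarrow> nat \<Rightarrow> (nat \<Rightarrow> nat set) \<Rightarrow> (nat \<Rightarrow> int) set" where
  "left_kernel p m t r = {x \<in> fvec p {..<t}. (\<forall>v<t. int p dvd int (card (r v)) * x v) \<and>
     (\<forall>u<m. int p dvd left_sum t r x u)}"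

lemma finite_left_kernel [simp]: "finite (left_kernel p m t r)"
  by (rule finite_subset[of _ "fvec p {..<t}"]) (auto simp: left_kernel_def)

lemma left_kernel_Suc_zero:
  assumes "x \<in> left_kernel p m (Suc t) r" "x t = 0"
  shows "x \<in> left_kernel p m t r"
proof -
  have "x i = 0" if "i \<notin> {..<t}" for i
    using assms that unfolding left_kernel_def fvec_iff by (cases "i = t") auto
  then have "x \<in> fvec p {..<t}" using assms(1) unfolding left_kernel_def fvec_iff by auto
  moreover have "left_sum (Suc t) r x u = left_sum t r x u" for u
    using assms(2) by (simp add: left_sum_Suc)
  ultimately show ?thesis using assms(1) unfolding left_kernel_def by simp
qed

lemma fvec_dvd_zero: "x \<in> fvec p I \<Longrightarrow> int p dvd x i \<Longrightarrow> x i = 0"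
  using fvec_mod[of x p I i] by (simp add: dvd_eq_mod_eq_0)

lemma card_left_kernel_Suc_le:
  assumes p: "0 < p"
  shows "card (left_kernel p m (Suc t) r) \<le> p * card (left_kernel p m t r)"
proof -
  have "card (left_kernel p m (Suc t) r) \<le> card {0..<int p} * card (left_kernel p m t r)"
  proof (rule card_le_card_mult_differences[of "{..<Suc t}" _ p "\<lambda>x. x t"])
    fix x y assume xy: "x \<in> left_kernel p m (Suc t) r" "y \<in> left_kernel p m (Suc t) r" and eq: "x t = y t"
    let ?d = "\<lambda>i. (x i - y i) mod int p"
    have "?d \<in> left_kernel p m (Suc t) r"
      unfolding left_kernel_def
    proof (intro CollectI conjI allI impI)
      show "?d \<in> fvec p {..<Suc t}"
        using xy fvec_lincomb[OF p, of x _ y "-1"] by (simp add: left_kernel_def)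
      fix v assume "v < Suc t"
      then have "int p dvd int (card (r v)) * x v - int (card (r v)) * y v"
        using xy unfolding left_kernel_def by (intro dvd_diff) auto
      then have "(int (card (r v)) * (x v - y v)) mod int p = 0" by (simp add: algebra_simps)
      then show "int p dvd int (card (r v)) * ?d v"
        by (metis dvd_eq_mod_eq_0 mod_mult_right_eq)
    next
      fix u assume "u < m"
      then have "int p dvd left_sum (Suc t) r x u - left_sum (Suc t) r y u"
        using xy unfolding left_kernel_def by (intro dvd_diff) auto
      then have "int p dvd left_sum (Suc t) r (\<lambda>v. x v - y v) u"
        using left_sum_lincomb[of "Suc t" r x "-1" y u] by simp
      then show "int p dvd left_sum (Suc t) r ?d u"
        using left_sum_mod[of "Suc t" r "\<lambda>v. x v - y v" "int p" u] by (simp only: dvd_eq_mod_eq_0)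
    qed
    then show "?d \<in> left_kernel p m t r" by (rule left_kernel_Suc_zero) (simp add: eq)
  qed (use finite_left_kernel[of p m t r] in \<open>auto simp: left_kernel_def fvec_iff\<close>)
  then show ?thesis by simp
qed

text \<open>A dependency among the zero rows is paired with a y that kills the earlier ones but not
  the new one; what survives is the new coefficient times a unit, so that coefficient
  vanishes.\<close>

lemma left_kernel_Suc_subset:
  assumes p: "prime p" and r: "\<And>v. v \<le> t \<Longrightarrow> r v \<subseteq> {..<m}"
    and c: "\<not> p dvd card (r t) \<or> (\<exists>y\<in>row_annihilator p m t r. \<not> int p dvd sum y (r t))"
  shows "left_kernel p m (Suc t) r \<subseteq> left_kernel p m t r"
proof
  fix x assume x: "x \<in> left_kernel p m (Suc t) r"
  have nz: "int p dvd x v" if "v < Suc t" "\<not> p dvd card (r v)" for v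
  proof -
    have "int p dvd int (card (r v)) * x v" using x that unfolding left_kernel_def by blast
    then show ?thesis using p that(2) by (metis int_dvd_int_iff prime_dvd_mult_iff prime_nat_int_transfer)
  qed
  have "int p dvd x t"
  proof (cases "p dvd card (r t)")
    case True
    with c obtain y where y: "y \<in> row_annihilator p m t r" "\<not> int p dvd sum y (r t)" by blast
    have "int p dvd (\<Sum>u<m. y u * left_sum (Suc t) r x u)"
      using x unfolding left_kernel_def by (intro dvd_sum dvd_mult) auto
    also have "\<dots> = (\<Sum>v<Suc t. x v * sum y (r v))"
      using r by (intro sum_mult_left_sum) auto
    finally have 1: "int p dvd (\<Sum>v<t. x v * sum y (r v)) + x t * sum y (r t)" by simp
    have "int p dvd x v * sum y (r v)" if "v < t" for v
    proof (cases "p dvd card (r v)")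
      case True then show ?thesis using y that unfolding row_annihilator_def by (intro dvd_mult) auto
    next
      case False then show ?thesis using nz[of v] that by (intro dvd_mult2) auto
    qed
    then have "int p dvd (\<Sum>v<t. x v * sum y (r v))" by (intro dvd_sum) auto
    with 1 have "int p dvd x t * sum y (r t)" by (simp add: dvd_add_right_iff)
    then show ?thesis using p y by (metis prime_dvd_mult_iff prime_nat_int_transfer)
  qed (use nz in auto)
  then have "x t = 0" using x fvec_dvd_zero[of x p "{..<Suc t}" t] unfolding left_kernel_def by blast
  then show "x \<in> left_kernel p m t r" using left_kernel_Suc_zero x by blast
qed

text \<open>Rank-nullity with the rank eliminated: the dependencies have dimension z - rank, the
  annihilator m - rank. A new row either has nonzero degree, or is independent and shrinks the
  annihilator, or is dependent and enlarges the left kernel by at most a factor p.\<close>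

lemma card_left_kernel_le:
  assumes p: "prime p" and r: "\<And>v. v < t \<Longrightarrow> r v \<subseteq> {..<m}"
  shows "card (left_kernel p m t r) * p ^ m \<le> card (row_annihilator p m t r) * p ^ zero_rows p t r"
  using r
proof (induction t)
  case 0
  have "left_kernel p m 0 r \<subseteq> {\<lambda>_. 0}" by (auto simp: left_kernel_def fvec_iff)
  then have "card (left_kernel p m 0 r) \<le> 1" using card_mono[of "{\<lambda>_. 0}"] by simp
  then show ?case by (simp add: card_fvec)
next
  case (Suc t)
  have p0: "0 < p" using p prime_gt_0_nat by blast
  have IH: "card (left_kernel p m t r) * p ^ m \<le> card (row_annihilator p m t r) * p ^ zero_rows p t r"
    using Suc by simp
  consider "\<not> p dvd card (r t)" | "p dvd card (r t)" "\<exists>y\<in>row_annihilator p m t r. \<not> int p dvd sum y (r t)"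
    | "p dvd card (r t)" "\<forall>y\<in>row_annihilator p m t r. int p dvd sum y (r t)" by blast
  then show ?case
  proof cases
    case 1
    then have "card (left_kernel p m (Suc t) r) \<le> card (left_kernel p m t r)"
      using Suc.prems by (intro card_mono finite_left_kernel left_kernel_Suc_subset p) auto
    from order_trans[OF mult_right_mono[OF this] IH] 1 show ?thesis by (simp add: row_annihilator_Suc zero_rows_Suc)
  next
    case 2
    then have "card (left_kernel p m (Suc t) r) \<le> card (left_kernel p m t r)"
      using Suc.prems by (intro card_mono finite_left_kernel left_kernel_Suc_subset p) auto
    from order_trans[OF mult_right_mono[OF this] IH]
    have "card (left_kernel p m (Suc t) r) * p ^ m \<le> card (row_annihilator p m t r) * p ^ zero_rows p t r" by simp
    also have "card (row_annihilator p m t r) \<le> p * card {y \<in> row_annihilator p m t r. int p dvd sum y (r t)}"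
      using p0 by (intro card_le_row_kernel[OF _ fsubspace_row_annihilator]) auto
    finally show ?thesis using 2 by (simp add: row_annihilator_Suc zero_rows_Suc mult_ac)
  next
    case 3
    then have K: "row_annihilator p m (Suc t) r = row_annihilator p m t r" by (auto simp: row_annihilator_Suc)
    have "card (left_kernel p m (Suc t) r) * p ^ m \<le> p * card (left_kernel p m t r) * p ^ m"
      by (rule mult_right_mono[OF card_left_kernel_Suc_le[OF p0]]) simp
    also have "\<dots> \<le> p * (card (row_annihilator p m t r) * p ^ zero_rows p t r)"
      using mult_left_mono[OF IH, of p] by (simp add: mult_ac)
    finally have "card (left_kernel p m (Suc t) r) * p ^ m \<le> p * (card (row_annihilator p m t r) * p ^ zero_rows p t r)" .
    then show ?thesis using 3 by (simp add: K zero_rows_Suc mult_ac)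
  qed
qed

lemma fvec_mono:
  assumes "0 < p" "I \<subseteq> J"
  shows "fvec p I \<subseteq> fvec p J"
proof
  fix x assume x: "x \<in> fvec p I"
  have "0 \<le> x i \<and> x i < int p" for i
    using x assms(1) by (cases "i \<in> I") (auto simp: fvec_iff)
  with x assms(2) show "x \<in> fvec p J" by (auto simp: fvec_iff)
qed

text \<open>The m column equations take at most p^m values on vectors supported on the zero rows.
  Empty rows are excluded because an isolated vertex is the root of its own component and
  contributes nothing to the sandpile group.\<close>

lemma pow_zero_rows_le_card_left_kernel:
  assumes p: "0 < p"
  shows "p ^ card {v. v < t \<and> p dvd card (r v) \<and> r v \<noteq> {}}
     \<le> p ^ m * card {x \<in> left_kernel p m t r. \<forall>v<t. r v = {} \<longrightarrow> x v = 0}"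
proof -
  let ?Z = "{v. v < t \<and> p dvd card (r v) \<and> r v \<noteq> {}}"
  let ?f = "\<lambda>x u. if u < m then left_sum t r x u mod int p else 0"
  have "card (fvec p ?Z) \<le> card (fvec p {..<m}) * card {x \<in> left_kernel p m t r. \<forall>v<t. r v = {} \<longrightarrow> x v = 0}"
  proof (rule card_le_card_mult_differences[of ?Z _ p ?f])
    show "?f ` fvec p ?Z \<subseteq> fvec p {..<m}" using p by (auto simp: fvec_iff)
    fix x y assume xy: "x \<in> fvec p ?Z" "y \<in> fvec p ?Z" and eq: "?f x = ?f y"
    let ?d = "\<lambda>i. (x i - y i) mod int p"
    have d: "?d \<in> fvec p ?Z" using xy fvec_lincomb[OF p, of x _ y "-1"] by simp
    have "int p dvd left_sum t r ?d u" if "u < m" for u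
    proof -
      have "left_sum t r x u mod int p = left_sum t r y u mod int p"
        using fun_cong[OF eq, of u] that by simp
      then have "int p dvd left_sum t r x u - left_sum t r y u" by (simp only: mod_eq_dvd_iff)
      then have "int p dvd left_sum t r (\<lambda>v. x v - y v) u"
        using left_sum_lincomb[of t r x "-1" y u] by simp
      then show ?thesis
        using left_sum_mod[of t r "\<lambda>v. x v - y v" "int p" u] by (simp only: dvd_eq_mod_eq_0)
    qed
    moreover have "int p dvd int (card (r v)) * ?d v" if "v < t" for v
      using d by (cases "v \<in> ?Z") (auto simp: fvec_iff)
    moreover have "?d \<in> fvec p {..<t}" using d fvec_mono[OF p, of ?Z "{..<t}"] by blast
    moreover have "?d v = 0" if "r v = {}" for v
    proof -
      have "v \<notin> ?Z" using that by simp
      then show ?thesis using d unfolding fvec_iff by blast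
    qed
    ultimately show "?d \<in> {x \<in> left_kernel p m t r. \<forall>v<t. r v = {} \<longrightarrow> x v = 0}"
      unfolding left_kernel_def by simp
  qed auto
  then show ?thesis by (simp add: card_fvec)
qed

section \<open>Independent random rows\<close>

lemma sum_Pow_prod_if:
  fixes f0 f1 :: "nat \<Rightarrow> real"
  shows "(\<Sum>B\<in>Pow {..<m}. \<Prod>u<m. if u \<in> B then f1 u else f0 u) = (\<Prod>u<m. f0 u + f1 u)"
proof -
  have "(\<Prod>u<m. f0 u + f1 u) = (\<Prod>u<m. f1 u + f0 u)" by (simp add: add.commute)
  also have "\<dots> = (\<Sum>B\<in>Pow {..<m}. prod f1 B * prod f0 ({..<m} - B))"
    by (rule prod_add) simp
  also have "\<dots> = (\<Sum>B\<in>Pow {..<m}. \<Prod>u<m. if u \<in> B then f1 u else f0 u)"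
  proof (rule sum.cong[OF refl])
    fix B assume "B \<in> Pow {..<m}"
    then have "{..<m} \<inter> {u. u \<in> B} = B" "{..<m} \<inter> - {u. u \<in> B} = {..<m} - B" by auto
    then show "prod f1 B * prod f0 ({..<m} - B) = (\<Prod>u<m. if u \<in> B then f1 u else f0 u)"
      by (simp add: prod.If_cases)
  qed
  finally show ?thesis ..
qed

definition row_weight :: "real \<Rightarrow> nat \<Rightarrow> nat set \<Rightarrow> real" where
  "row_weight q m B = (\<Prod>u<m. if u \<in> B then q else 1 - q)"

lemma row_weight_nonneg: "0 \<le> q \<Longrightarrow> q \<le> 1 \<Longrightarrow> 0 \<le> row_weight q m B"
  unfolding row_weight_def by (intro prod_nonneg) auto

lemma sum_row_weight: "(\<Sum>B\<in>Pow {..<m}. row_weight q m B) = 1"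
  unfolding row_weight_def by (subst sum_Pow_prod_if) simp

text \<open>Expectation over independent rows \<open>r 0, \<dots>, r (t - 1)\<close>, each containing every element of
  \<open>{..<m}\<close> with probability \<open>q\<close>; later rows are empty.\<close>

primrec rows_exp :: "real \<Rightarrow> nat \<Rightarrow> nat \<Rightarrow> ((nat \<Rightarrow> nat set) \<Rightarrow> real) \<Rightarrow> real" where
  "rows_exp q m 0 f = f (\<lambda>_. {})"
| "rows_exp q m (Suc t) f = rows_exp q m t (\<lambda>r. \<Sum>B\<in>Pow {..<m}. row_weight q m B * f (r(t := B)))"

lemma rows_exp_mono:
  assumes "0 \<le> q" "q \<le> 1" "\<And>r. (\<And>v. r v \<subseteq> {..<m}) \<Longrightarrow> f r \<le> g r"
  shows "rows_exp q m t f \<le> rows_exp q m t g"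
  using assms(3)
proof (induction t arbitrary: f g)
  case (Suc t)
  show ?case
    unfolding rows_exp.simps
  proof (rule Suc.IH, rule sum_mono, rule mult_left_mono)
    fix r :: "nat \<Rightarrow> nat set" and B assume r: "\<And>v. r v \<subseteq> {..<m}" and B: "B \<in> Pow {..<m}"
    show "f (r(t := B)) \<le> g (r(t := B))" using r B by (intro Suc.prems) auto
  qed (use assms row_weight_nonneg in auto)
qed auto

lemma rows_exp_add: "rows_exp q m t (\<lambda>r. f r + g r) = rows_exp q m t f + rows_exp q m t g"
  by (induction t arbitrary: f g) (simp_all add: distrib_left sum.distrib)

lemma rows_exp_cmult: "rows_exp q m t (\<lambda>r. c * f r) = c * rows_exp q m t f"
proof (induction t arbitrary: f)
  case (Suc t)
  have "rows_exp q m (Suc t) (\<lambda>r. c * f r)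
      = rows_exp q m t (\<lambda>r. c * (\<Sum>B\<in>Pow {..<m}. row_weight q m B * f (r(t := B))))"
    by (simp add: sum_distrib_left mult_ac)
  then show ?case by (simp add: Suc.IH)
qed simp

lemma rows_exp_const [simp]: "rows_exp q m t (\<lambda>_. c) = c"
proof (induction t)
  case (Suc t)
  have "(\<Sum>B\<in>Pow {..<m}. row_weight q m B * c) = c"
    unfolding sum_distrib_right[symmetric] by (simp add: sum_row_weight)
  then show ?case by (simp add: Suc)
qed simp

lemma rows_exp_diff: "rows_exp q m t (\<lambda>r. f r - g r) = rows_exp q m t f - rows_exp q m t g"
  using rows_exp_add[of q m t f "\<lambda>r. -1 * g r"] by (simp only: rows_exp_cmult) simp

text \<open>\<open>binmod p q k s\<close> is the probability that a binomial variable with parameters \<open>k\<close> and \<open>q\<close> is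
  congruent to \<open>s\<close> modulo \<open>p\<close>.\<close>

fun binmod :: "nat \<Rightarrow> real \<Rightarrow> nat \<Rightarrow> int \<Rightarrow> real" where
  "binmod p q 0 s = of_bool (int p dvd s)"
| "binmod p q (Suc k) s = q * binmod p q k (s - 1) + (1 - q) * binmod p q k s"

lemma binmod_bounds:
  assumes "0 \<le> q" "q \<le> 1"
  shows "0 \<le> binmod p q k s" "binmod p q k s \<le> 1"
proof -
  have "0 \<le> binmod p q k s \<and> binmod p q k s \<le> 1"
  proof (induction k arbitrary: s)
    case (Suc k)
    have "q * binmod p q k (s - 1) + (1 - q) * binmod p q k s \<le> q * 1 + (1 - q) * 1"
      using Suc assms by (intro add_mono mult_left_mono) auto
    then show ?case using Suc assms by auto
  qed auto
  then show "0 \<le> binmod p q k s" "binmod p q k s \<le> 1" by auto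
qed

lemma binmod_sum_residues:
  assumes "0 < p"
  shows "(\<Sum>d\<in>{0..<int p}. binmod p q k (d - s)) = 1"
proof (induction k arbitrary: s)
  case 0
  have "{d \<in> {0..<int p}. int p dvd d - s} = {s mod int p}"
    using assms by (auto simp: mod_eq_dvd_iff[symmetric])
  then show ?case by (simp add: Int_def flip: sum.inter_filter)
next
  case (Suc k)
  have "(\<Sum>d\<in>{0..<int p}. binmod p q (Suc k) (d - s)) =
      q * (\<Sum>d\<in>{0..<int p}. binmod p q k (d - (s + 1))) + (1 - q) * (\<Sum>d\<in>{0..<int p}. binmod p q k (d - s))"
    by (simp add: sum.distrib sum_distrib_left diff_diff_eq)
  then show ?case by (simp only: Suc) simp
qed

section \<open>Equidistribution of binomial residues by Fourier analysis on Z/p\<close>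

lemma sum_cis_roots:
  assumes "0 < p"
  shows "(\<Sum>j<p. cis (- (2 * pi * real j * of_int s / real p))) = (if int p dvd s then of_nat p else 0)"
proof -
  define z where "z = cis (- (2 * pi * of_int s / real p))"
  have "(\<Sum>j<p. cis (- (2 * pi * real j * of_int s / real p))) = (\<Sum>j<p. z ^ j)"
  proof (rule sum.cong[OF refl])
    fix j
    have "z ^ j = cis (real j * (- (2 * pi * of_int s / real p)))" unfolding z_def by (rule Complex.DeMoivre)
    also have "real j * (- (2 * pi * of_int s / real p)) = - (2 * pi * real j * of_int s / real p)" by simp
    finally show "cis (- (2 * pi * real j * of_int s / real p)) = z ^ j" ..
  qed
  also have "\<dots> = (if int p dvd s then of_nat p else 0)"
  proof (cases "int p dvd s")
    case True
    then obtain k where k: "s = int p * k" by blast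
    have "z = cis (2 * pi * of_int (- k))"
      unfolding z_def k using assms by (intro arg_cong[of _ _ cis]) simp
    also have "\<dots> = 1" by (rule cis_multiple_2pi) simp
    finally show ?thesis using True by simp
  next
    case False
    have "z \<noteq> 1"
    proof
      assume "z = 1"
      then have "cos (- (2 * pi * of_int s / real p)) = 1" unfolding z_def by (metis cis.sel(1) one_complex.sel(1))
      then obtain n :: int where "- (2 * pi * of_int s / real p) = of_int n * 2 * pi"
        unfolding cos_one_2pi_int by blast
      then have "pi * of_int s = pi * (- of_int n * real p)" using assms by (simp add: field_simps)
      then have "of_int s = - of_int n * real p" by (simp only: mult_cancel_left pi_neq_zero) simp
      then have "real_of_int s = real_of_int (int p * (- n))" by simp
      then have "s = int p * (- n)" by (simp only: of_int_eq_iff)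
      with False show False by simp
    qed
    moreover have "z ^ p = 1"
    proof -
      have "z ^ p = cis (2 * pi * of_int (- s))"
        unfolding z_def Complex.DeMoivre using assms by (intro arg_cong[of _ _ cis]) simp
      also have "\<dots> = 1" by (rule cis_multiple_2pi) simp
      finally show ?thesis .
    qed
    ultimately show ?thesis using False by (simp add: geometric_sum)
  qed
  finally show ?thesis .
qed

text \<open>Fourier inversion: one trial has characteristic function 1 - q + q * zeta^j at frequency
  j, and k independent trials raise it to the k-th power.\<close>

lemma binmod_fourier:
  assumes "0 < p"
  shows "complex_of_real (binmod p q k s) = (\<Sum>j<p. cis (- (2 * pi * real j * of_int s / real p))
     * (1 - of_real q + of_real q * cis (2 * pi * real j / real p)) ^ k) / of_nat p"
proof (induction k arbitrary: s)
  case 0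
  show ?case using assms by (simp add: sum_cis_roots)
next
  case (Suc k)
  let ?e = "\<lambda>j s. cis (- (2 * pi * real j * of_int s / real p))"
  let ?a = "\<lambda>j. 1 - of_real q + of_real q * cis (2 * pi * real j / real p)"
  have e: "?e j (s - 1) = ?e j s * cis (2 * pi * real j / real p)" for j
    unfolding cis_mult by (intro arg_cong[of _ _ cis]) (simp add: add_divide_distrib diff_divide_distrib algebra_simps)
  have "complex_of_real (binmod p q (Suc k) s) = of_real q * ((\<Sum>j<p. ?e j (s - 1) * ?a j ^ k) / of_nat p)
      + (1 - of_real q) * ((\<Sum>j<p. ?e j s * ?a j ^ k) / of_nat p)"
    by (simp only: binmod.simps of_real_add of_real_mult of_real_diff of_real_1 Suc)
  also have "\<dots> = (\<Sum>j<p. of_real q * (?e j (s - 1) * ?a j ^ k) + (1 - of_real q) * (?e j s * ?a j ^ k)) / of_nat p"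
    by (simp add: sum.distrib sum_distrib_left add_divide_distrib sum_divide_distrib)
  also have "\<dots> = (\<Sum>j<p. ?e j s * ?a j ^ Suc k) / of_nat p"
  proof (intro arg_cong2[of _ _ _ _ "(/)"] sum.cong refl)
    have alg: "c * (E * Z * A ^ k) + (1 - c) * (E * A ^ k) = E * A ^ Suc k" if "A = 1 - c + c * Z"
      for c E Z A :: complex
      by (simp add: that algebra_simps)
    fix j
    show "of_real q * (?e j (s - 1) * ?a j ^ k) + (1 - of_real q) * (?e j s * ?a j ^ k) = ?e j s * ?a j ^ Suc k"
      unfolding e by (rule alg) simp
  qed
  finally show ?case .
qed

text \<open>A proper convex combination of 1 and another point of the unit circle lies strictly
  inside the disc.\<close>

lemma norm_lazy_cis_less_1:
  assumes "0 < q" "q < 1" "0 < j" "j < p"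
  shows "norm (1 - of_real q + of_real q * cis (2 * pi * real j / real p)) < 1"
proof -
  let ?x = "2 * pi * real j / real p"
  have "cos ?x \<noteq> 1"
  proof
    assume "cos ?x = 1"
    then obtain n :: int where "?x = of_int n * 2 * pi" unfolding cos_one_2pi_int by blast
    then have "real j = of_int n * real p" using assms by (auto simp: field_simps)
    then have "real_of_int (int j) = real_of_int (n * int p)" by simp
    then have "int j = n * int p" by (simp only: of_int_eq_iff)
    then have "int p dvd int j" by simp
    then show False using assms by (auto dest: dvd_imp_le)
  qed
  then have cl: "cos ?x < 1" using cos_le_one[of ?x] by linarith
  have gen: "(1 - q + q * c)\<^sup>2 + (q * s)\<^sup>2 = (1 - q)\<^sup>2 + 2 * (1 - q) * q * c + q\<^sup>2 * (s\<^sup>2 + c\<^sup>2)" for c s :: real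
    by (simp add: power2_eq_square algebra_simps)
  have "(norm (1 - of_real q + of_real q * cis ?x))\<^sup>2 = (1 - q + q * cos ?x)\<^sup>2 + (q * sin ?x)\<^sup>2"
    by (simp add: cmod_power2)
  also have "\<dots> = (1 - q)\<^sup>2 + 2 * (1 - q) * q * cos ?x + q\<^sup>2 * ((sin ?x)\<^sup>2 + (cos ?x)\<^sup>2)"
    by (rule gen)
  also have "\<dots> = 1 - 2 * q * (1 - q) * (1 - cos ?x)"
    by (simp add: power2_eq_square algebra_simps)
  also have "\<dots> < 1" using assms cl by simp
  finally have "(norm (1 - of_real q + of_real q * cis ?x))\<^sup>2 < 1\<^sup>2" by simp
  then show ?thesis by (rule power2_less_imp_less) simp
qed

text \<open>Frequency 0 contributes exactly 1/p, and every other frequency decays geometrically, at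
  a rate independent of the residue.\<close>

lemma binmod_equidistributed:
  assumes "0 < p" "0 < q" "q < 1"
  shows "\<exists>g. 0 < g \<and> g < 1 \<and> (\<forall>k s. \<bar>binmod p q k s - 1 / real p\<bar> \<le> g ^ k)"
proof -
  let ?a = "\<lambda>j. 1 - complex_of_real q + of_real q * cis (2 * pi * real j / real p)"
  \<comment> \<open>The extra element 1/2 keeps g positive and covers p = 1, where there are no
    other frequencies.\<close>
  define g where "g = Max (insert (1/2) ((\<lambda>j. norm (?a j)) ` {1..<p}))"
  have "g < 1" unfolding g_def using assms norm_lazy_cis_less_1 by (subst Max_less_iff) auto
  have "1/2 \<le> g" unfolding g_def by (intro Max_ge) auto
  have ag: "norm (?a j) \<le> g" if "j \<in> {1..<p}" for j
    unfolding g_def using that by (intro Max_ge) auto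
  have "\<bar>binmod p q k s - 1 / real p\<bar> \<le> g ^ k" for k s
  proof -
    let ?e = "\<lambda>j. cis (- (2 * pi * real j * of_int s / real p))"
    have "{..<p} = insert 0 {1..<p}" using assms by auto
    then have "(\<Sum>j<p. ?e j * ?a j ^ k) = 1 + (\<Sum>j\<in>{1..<p}. ?e j * ?a j ^ k)"
      by simp
    then have "complex_of_real (binmod p q k s) - 1 / of_nat p = (\<Sum>j\<in>{1..<p}. ?e j * ?a j ^ k) / of_nat p"
      using assms by (simp add: binmod_fourier add_divide_distrib)
    moreover have "complex_of_real (binmod p q k s) - 1 / of_nat p = complex_of_real (binmod p q k s - 1 / real p)"
      by simp
    ultimately have "complex_of_real (binmod p q k s - 1 / real p) = (\<Sum>j\<in>{1..<p}. ?e j * ?a j ^ k) / of_nat p"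
      by (simp only:)
    from arg_cong[OF this, of norm]
    have "\<bar>binmod p q k s - 1 / real p\<bar> = norm (\<Sum>j\<in>{1..<p}. ?e j * ?a j ^ k) / real p"
      by (simp only: norm_of_real norm_divide norm_of_nat)
    also have "\<dots> \<le> (\<Sum>j\<in>{1..<p}. norm (?e j * ?a j ^ k)) / real p"
      by (intro divide_right_mono norm_sum) auto
    also have "\<dots> \<le> (\<Sum>j\<in>{1..<p}. g ^ k) / real p"
      using ag by (intro divide_right_mono sum_mono) (auto simp: norm_mult norm_power intro!: power_mono)
    also have "\<dots> \<le> g ^ k"
      using assms \<open>1/2 \<le> g\<close> by (simp add: divide_le_eq mult.commute mult_left_mono)
    finally show ?thesis .
  qed
  with \<open>g < 1\<close> \<open>1/2 \<le> g\<close> show ?thesis by (intro exI[of _ g]) auto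
qed

text \<open>\<open>binmod\<close> serves both directions: completing the unseen entries of a column
  in the walk, and the degree of a row of length m here.\<close>

lemma sum_row_weight_residue:
  "(\<Sum>B\<in>Pow {..<m}. row_weight q m B * of_bool (int p dvd s - int (card B))) = binmod p q m s"
proof (induction m arbitrary: s)
  case 0 then show ?case by (simp add: row_weight_def)
next
  case (Suc m)
  let ?F = "\<lambda>B. row_weight q (Suc m) B * of_bool (int p dvd s - int (card B))"
  have Pow: "Pow {..<Suc m} = Pow {..<m} \<union> insert m ` Pow {..<m}"
    by (simp add: lessThan_Suc Pow_insert)
  have inj: "inj_on (insert m) (Pow {..<m})" 
    by (intro inj_onI) (metis Pow_iff insert_ident lessThan_iff less_irrefl subsetD)
  have 1: "row_weight q (Suc m) B = (1 - q) * row_weight q m B" if "B \<in> Pow {..<m}" for B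
    using that by (auto simp: row_weight_def)
  have 2: "row_weight q (Suc m) (insert m B) = q * row_weight q m B" if "B \<in> Pow {..<m}" for B
    using that by (auto simp: row_weight_def intro!: prod.cong)
  have 3: "card (insert m B) = Suc (card B)" if "B \<in> Pow {..<m}" for B
    using that finite_subset[of B "{..<m}"] by (subst card_insert_disjoint) auto
  have "(\<Sum>B\<in>Pow {..<Suc m}. ?F B) = (\<Sum>B\<in>Pow {..<m}. ?F B) + (\<Sum>B\<in>insert m ` Pow {..<m}. ?F B)"
    unfolding Pow by (rule sum.union_disjoint) auto
  also have "(\<Sum>B\<in>insert m ` Pow {..<m}. ?F B) = (\<Sum>B\<in>Pow {..<m}. ?F (insert m B))"
    by (subst sum.reindex[OF inj]) simp
  also have "\<dots> = q * (\<Sum>B\<in>Pow {..<m}. row_weight q m B * of_bool (int p dvd (s - 1) - int (card B)))"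
    unfolding sum_distrib_left by (rule sum.cong[OF refl]) (simp add: 2 3 algebra_simps)
  also have "(\<Sum>B\<in>Pow {..<m}. ?F B) = (1 - q) * (\<Sum>B\<in>Pow {..<m}. row_weight q m B * of_bool (int p dvd s - int (card B)))"
    unfolding sum_distrib_left by (rule sum.cong[OF refl]) (simp add: 1)
  finally show ?case by (simp add: Suc)
qed

lemma sum_row_weight_dvd_card:
  "(\<Sum>B\<in>{B\<in>Pow {..<m}. p dvd card B}. row_weight q m B) = binmod p q m 0"
proof -
  have "(\<Sum>B\<in>{B\<in>Pow {..<m}. p dvd card B}. row_weight q m B)
      = (\<Sum>B\<in>Pow {..<m}. if p dvd card B then row_weight q m B else 0)"
    by (rule sum.inter_filter) simp
  also have "\<dots> = (\<Sum>B\<in>Pow {..<m}. row_weight q m B * of_bool (int p dvd 0 - int (card B)))"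
    by (rule sum.cong) auto
  finally show ?thesis by (simp only: sum_row_weight_residue)
qed

section \<open>Expected kernel dimensions\<close>

lemma left_sum_cong: "(\<And>v. v < t \<Longrightarrow> r v = r' v) \<Longrightarrow> left_sum t r x u = left_sum t r' x u"
  unfolding left_sum_def by (intro sum.cong) auto

lemma left_sum_upd: "left_sum (Suc t) (r(t := B)) x u = left_sum t r x u + (if u \<in> B then x t else 0)"
  unfolding left_sum_Suc using left_sum_cong[of t "r(t := B)" r x u] by simp

text \<open>\<open>b\<close> bounds the probability of each value of an entry, unconditionally by
  \<open>qb\<close> and given its column sum by \<open>k0\<close>. In the latter the two shares of
  an entry sum to at most 1, so a lower bound 1 - b on one of them leaves the other at most b times
  their sum.\<close>

locale row_walk =
  fixes p k0 :: nat and q b th :: real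
  assumes p: "prime p" and q: "0 < q" "q < 1" and b: "0 < b" "b < 1"
    and th: "real p powr th * b = 1" and qb: "q \<le> b" "1 - q \<le> b"
    and k0: "\<And>k s. k0 \<le> k \<Longrightarrow> 1 - b \<le> q * binmod p q k s"
            "\<And>k s. k0 \<le> k \<Longrightarrow> 1 - b \<le> (1 - q) * binmod p q k s"
begin

lemma p_pos: "0 < p"
  using p prime_gt_0_nat by blast

lemma th_pos: "0 < th"
proof (rule ccontr)
  assume "\<not> 0 < th"
  then have "real p powr th \<le> real p powr 0" using prime_gt_1_nat[OF p] by (intro powr_mono) auto
  then have "real p powr th * b \<le> 1 * b" using b p_pos by (intro mult_right_mono) auto
  with th b show False by simp
qed

definition lam :: real where "lam = real p powr th"

lemma lam_b: "lam * b = 1"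
  using th by (simp add: lam_def)

lemma lam_gt_1: "1 < lam"
proof (rule ccontr)
  assume "\<not> 1 < lam"
  then have "lam * b \<le> 1 * b" using b by (intro mult_right_mono) auto
  with lam_b b show False by simp
qed

section \<open>One-step estimates for the potential of the right part\<close>

definition pot :: "nat \<Rightarrow> nat \<Rightarrow> (nat \<Rightarrow> nat set) \<Rightarrow> (nat \<Rightarrow> int) \<Rightarrow> real" where
  "pot m t r D = real (card (right_part p m t r D)) powr th"

lemma pot_nonneg: "0 \<le> pot m t r D"
  by (simp add: pot_def)

lemma powr_card_le:
  assumes "a \<le> p * c"
  shows "real a powr th \<le> lam * real c powr th"
proof -
  have "real a powr th \<le> (real p * real c) powr th"
    using assms th_pos by (intro powr_mono2) (auto simp flip: of_nat_mult)
  then show ?thesis by (simp add: powr_mult lam_def)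
qed

lemma pot_Suc_le: "pot m (Suc t) r D \<le> lam * pot m t r D"
  unfolding pot_def by (rule powr_card_le[OF card_right_part_Suc_le[OF p_pos]])

lemma pot_Suc_le':
  assumes r: "\<And>v. v \<le> t \<Longrightarrow> r v \<subseteq> {..<m}"
    and y0: "y0 \<in> right_part p m t r D" "\<not> int p dvd sum y0 (r t)"
  shows "pot m (Suc t) r D \<le> b * pot m t r D"
proof -
  let ?J0 = "{y \<in> right_part p m t r D. int p dvd sum y (r t)}"
  have fin: "finite (right_part p m t r D)"
    using fsubspace_finite[OF _ fsubspace_right_part[OF p_pos]] by auto
  have "p * card (right_part p m (Suc t) r D) \<le> p * card ?J0"
    using right_part_Suc_subset[OF p r y0] fin by (intro mult_left_mono card_mono) auto
  also have "\<dots> \<le> card (right_part p m t r D)"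
    by (rule card_row_kernel_le[OF _ fsubspace_right_part[OF p_pos] p y0]) simp
  finally have "real (p * card (right_part p m (Suc t) r D)) powr th \<le> real (card (right_part p m t r D)) powr th"
    using th_pos by (intro powr_mono2) (auto simp only: of_nat_le_iff of_nat_0_le_iff)
  then have "lam * pot m (Suc t) r D \<le> pot m t r D"
    by (simp add: powr_mult pot_def lam_def)
  then have "b * (lam * pot m (Suc t) r D) \<le> b * pot m t r D"
    using b by (intro mult_left_mono) auto
  moreover have "b * (lam * pot m (Suc t) r D) = pot m (Suc t) r D" using lam_b by (simp add: mult_ac)
  ultimately show ?thesis by simp
qed

text \<open>The joint weight of a row and of all column completions factorises over the columns,
  which is the product form covered by \<open>weighted_annihilator_bound\<close>.\<close>

lemma row_weight_times_binmod:
  "row_weight q m B * (\<Prod>u<m. binmod p q k (c u - of_bool (u \<in> B))) =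
     (\<Prod>u<m. if u \<in> B then q * binmod p q k (c u - 1) else (1 - q) * binmod p q k (c u))"
  unfolding row_weight_def prod.distrib[symmetric] by (rule prod.cong) auto

text \<open>The crude step, meant for the last \<open>k0\<close> rows, where the column sums may
  already determine the entries.\<close>

lemma expected_pot_step_le:
  "(\<Sum>B\<in>Pow {..<m}. row_weight q m B *
      ((\<Prod>u<m. binmod p q k (c u - of_bool (u \<in> B))) * pot m (Suc t) (r(t := B)) D))
   \<le> (\<Prod>u<m. binmod p q (Suc k) (c u)) * (lam * pot m t r D)"
proof -
  define f1 where "f1 = (\<lambda>u. q * binmod p q k (c u - 1))"
  define f0 where "f0 = (\<lambda>u. (1 - q) * binmod p q k (c u))"
  define G where "G = (\<lambda>B. \<Prod>u<m. if u \<in> B then f1 u else f0 u)"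
  have Gnn: "0 \<le> G B" for B
    unfolding G_def f0_def f1_def using q by (intro prod_nonneg) (auto simp: binmod_bounds)
  have "(\<Sum>B\<in>Pow {..<m}. row_weight q m B *
      ((\<Prod>u<m. binmod p q k (c u - of_bool (u \<in> B))) * pot m (Suc t) (r(t := B)) D))
      = (\<Sum>B\<in>Pow {..<m}. G B * pot m (Suc t) (r(t := B)) D)"
    unfolding mult.assoc[symmetric] row_weight_times_binmod G_def f0_def f1_def ..
  also have "\<dots> \<le> (\<Sum>B\<in>Pow {..<m}. G B * (lam * pot m t r D))"
  proof (intro sum_mono mult_left_mono Gnn)
    fix B
    have "right_part p m t (r(t := B)) D = right_part p m t r D" by (rule right_part_cong) auto
    then show "pot m (Suc t) (r(t := B)) D \<le> lam * pot m t r D"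
      using pot_Suc_le[of m t "r(t := B)" D] by (simp add: pot_def)
  qed
  also have "\<dots> = (\<Prod>u<m. f0 u + f1 u) * (lam * pot m t r D)"
    unfolding sum_distrib_right[symmetric] G_def sum_Pow_prod_if ..
  also have "(\<Prod>u<m. f0 u + f1 u) = (\<Prod>u<m. binmod p q (Suc k) (c u))"
    by (simp add: f0_def f1_def add.commute)
  finally show ?thesis .
qed

text \<open>Rows outside A shrink the potential by b. Rows in A may multiply it by
  \<open>lam\<close>, but their weight times the potential is at most the total weight, so they
  contribute a constant whatever the dimension.\<close>

lemma expected_pot_step_contract:
  assumes k: "k0 \<le> k" and r: "\<And>v. r v \<subseteq> {..<m}"
  shows "(\<Sum>B\<in>Pow {..<m}. row_weight q m B *
      ((\<Prod>u<m. binmod p q k (c u - of_bool (u \<in> B))) * pot m (Suc t) (r(t := B)) D))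
   \<le> (\<Prod>u<m. binmod p q (Suc k) (c u)) * (b * pot m t r D + lam)"
proof -
  define f1 where "f1 = (\<lambda>u. q * binmod p q k (c u - 1))"
  define f0 where "f0 = (\<lambda>u. (1 - q) * binmod p q k (c u))"
  define G where "G = (\<lambda>B. \<Prod>u<m. if u \<in> B then f1 u else f0 u)"
  let ?J = "right_part p m t r D"
  define A where "A = {B. B \<subseteq> {..<m} \<and> (\<forall>y\<in>?J. int p dvd sum y B)}"
  have finA: "finite A" and AP: "A \<subseteq> Pow {..<m}" unfolding A_def by auto
  have fnn: "0 \<le> f0 u" "0 \<le> f1 u" for u
    using q by (auto simp: f0_def f1_def binmod_bounds)
  have Gnn: "0 \<le> G B" for B
    unfolding G_def using fnn by (intro prod_nonneg) auto
  have fs: "f0 u + f1 u = binmod p q (Suc k) (c u)" for u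
    by (simp add: f0_def f1_def)
  have fle: "f0 u \<le> b * (f0 u + f1 u)" "f1 u \<le> b * (f0 u + f1 u)" for u
  proof -
    have "f0 u + f1 u \<le> 1" unfolding fs using q by (intro binmod_bounds) auto
    then have "(1 - b) * (f0 u + f1 u) \<le> (1 - b) * 1" using b by (intro mult_left_mono) auto
    moreover have "1 - b \<le> f0 u" "1 - b \<le> f1 u" unfolding f0_def f1_def using k0[OF k] by auto
    ultimately show "f0 u \<le> b * (f0 u + f1 u)" "f1 u \<le> b * (f0 u + f1 u)"
      by (simp_all add: left_diff_distrib)
  qed
  have Pnn: "0 \<le> (\<Prod>u<m. f0 u + f1 u)" using fnn by (intro prod_nonneg) auto
  have J: "right_part p m t (r(t := B)) D = ?J" for B by (rule right_part_cong) auto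
  have "(\<Sum>B\<in>Pow {..<m}. row_weight q m B *
      ((\<Prod>u<m. binmod p q k (c u - of_bool (u \<in> B))) * pot m (Suc t) (r(t := B)) D))
      = (\<Sum>B\<in>Pow {..<m}. G B * pot m (Suc t) (r(t := B)) D)"
    unfolding mult.assoc[symmetric] row_weight_times_binmod G_def f0_def f1_def ..
  also have "\<dots> \<le> (\<Sum>B\<in>Pow {..<m}. G B * (b * pot m t r D) + (if B \<in> A then G B * (lam * pot m t r D) else 0))"
  proof (rule sum_mono)
    fix B assume B: "B \<in> Pow {..<m}"
    show "G B * pot m (Suc t) (r(t := B)) D \<le> G B * (b * pot m t r D) + (if B \<in> A then G B * (lam * pot m t r D) else 0)"
    proof (cases "B \<in> A")
      case True
      have "pot m (Suc t) (r(t := B)) D \<le> lam * pot m t r D"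
        using pot_Suc_le[of m t "r(t := B)" D] by (simp add: pot_def J)
      from mult_left_mono[OF this Gnn[of B]] True show ?thesis
        using Gnn[of B] pot_nonneg[of m t r D] b by (simp add: add_increasing)
    next
      case False
      then obtain y0 where "y0 \<in> ?J" "\<not> int p dvd sum y0 B" using B unfolding A_def by auto
      then have "pot m (Suc t) (r(t := B)) D \<le> b * pot m t (r(t := B)) D"
        using r B by (intro pot_Suc_le'[of _ _ _ y0]) (auto simp: J)
      from mult_left_mono[OF this Gnn[of B]] False show ?thesis by (simp add: pot_def J)
    qed
  qed
  also have "\<dots> = (\<Sum>B\<in>Pow {..<m}. G B) * (b * pot m t r D) + (\<Sum>B\<in>A. G B * (lam * pot m t r D))"
  proof -
    have "Pow {..<m} \<inter> {B. B \<in> A} = A" using AP by auto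
    then show ?thesis by (simp add: sum.distrib sum_distrib_right sum.If_cases)
  qed
  also have "(\<Sum>B\<in>A. G B * (lam * pot m t r D)) = lam * (sum G A * pot m t r D)"
    by (simp add: sum_distrib_right sum_distrib_left mult_ac)
  also have "(\<Sum>B\<in>Pow {..<m}. G B) = (\<Prod>u<m. f0 u + f1 u)"
    unfolding G_def by (rule sum_Pow_prod_if)
  also have "(\<Prod>u<m. f0 u + f1 u) * (b * pot m t r D) + lam * (sum G A * pot m t r D)
      \<le> (\<Prod>u<m. f0 u + f1 u) * (b * pot m t r D) + lam * (\<Prod>u<m. f0 u + f1 u)"
  proof (intro add_left_mono mult_left_mono)
    show "(sum G A) * pot m t r D \<le> (\<Prod>u<m. f0 u + f1 u)"
      unfolding A_def G_def pot_def
      using fnn fle b th by (intro weighted_annihilator_bound[OF p fsubspace_right_part[OF p_pos]]) auto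
  qed (use lam_gt_1 in simp)
  finally have "(\<Sum>B\<in>Pow {..<m}. row_weight q m B *
      ((\<Prod>u<m. binmod p q k (c u - of_bool (u \<in> B))) * pot m (Suc t) (r(t := B)) D))
     \<le> (\<Prod>u<m. f0 u + f1 u) * (b * pot m t r D) + lam * (\<Prod>u<m. f0 u + f1 u)" .
  then show ?thesis by (simp only: fs distrib_left mult.commute[of lam])
qed

text \<open>The column sums modulo \<open>p\<close> are revealed first; \<open>walk m n t\<close> is the expectation of the
  potential after revealing the first \<open>t\<close> of \<open>n\<close> rows, where the product of \<open>binmod\<close> terms is the
  probability that the remaining rows complete the prescribed column sums.\<close>

definition walk :: "nat \<Rightarrow> nat \<Rightarrow> nat \<Rightarrow> real" where
  "walk m n t = rows_exp q m t (\<lambda>r. \<Sum>D\<in>PiE {..<m} (\<lambda>_. {0..<int p}).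
     (\<Prod>u<m. binmod p q (n - t) (D u - left_sum t r (\<lambda>_. 1) u)) * pot m t r D)"

section \<open>Iterating the one-step estimates over all rows\<close>

lemma walk_mass:
  fixes m :: nat
  shows "(\<Sum>D\<in>PiE {..<m} (\<lambda>_. {0..<int p}). \<Prod>u<m. binmod p q k (D u - c u)) = 1"
proof -
  have "(\<Sum>D\<in>PiE {..<m} (\<lambda>_. {0..<int p}). \<Prod>u<m. binmod p q k (D u - c u))
     = (\<Prod>u<m. \<Sum>d\<in>{0..<int p}. binmod p q k (d - c u))"
    by (rule prod_sum_PiE[symmetric]) auto
  then show ?thesis using binmod_sum_residues[OF p_pos] by simp
qed

lemma walk_0: "walk m n 0 \<le> lam ^ m"
proof -
  have "pot m 0 (\<lambda>_. {}) D \<le> lam ^ m" for D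
  proof -
    have "card (right_part p m 0 (\<lambda>_. {}) D) \<le> card (fvec p {..<m})"
      by (intro card_mono) (auto simp: right_part_def)
    then have "real (card (right_part p m 0 (\<lambda>_. {}) D)) \<le> real p ^ m"
      by (simp add: card_fvec flip: of_nat_power)
    then have "pot m 0 (\<lambda>_. {}) D \<le> (real p ^ m) powr th"
      unfolding pot_def using th_pos by (intro powr_mono2) auto
    also have "\<dots> = lam ^ m"
      using p_pos unfolding lam_def
      by (simp add: powr_power powr_powr mult.commute flip: powr_realpow)
    finally show ?thesis .
  qed
  then have "walk m n 0 \<le> (\<Sum>D\<in>PiE {..<m} (\<lambda>_. {0..<int p}).
      (\<Prod>u<m. binmod p q n (D u - left_sum 0 (\<lambda>_. {}) (\<lambda>_. 1) u)) * lam ^ m)"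
    unfolding walk_def rows_exp.simps minus_nat.diff_0 using q
    by (intro sum_mono mult_left_mono) (auto intro!: prod_nonneg simp: binmod_bounds)
  also have "\<dots> = lam ^ m"
    unfolding sum_distrib_right[symmetric] walk_mass by simp
  finally show ?thesis .
qed

lemma walk_Suc_eq:
  assumes "t < n"
  shows "walk m n (Suc t) = rows_exp q m t (\<lambda>r. \<Sum>D\<in>PiE {..<m} (\<lambda>_. {0..<int p}).
     \<Sum>B\<in>Pow {..<m}. row_weight q m B *
      ((\<Prod>u<m. binmod p q (n - Suc t) ((D u - left_sum t r (\<lambda>_. 1) u) - of_bool (u \<in> B)))
        * pot m (Suc t) (r(t := B)) D))"
proof -
  have 1: "D u - left_sum (Suc t) (r(t := B)) (\<lambda>_. 1) u = (D u - left_sum t r (\<lambda>_. 1) u) - of_bool (u \<in> B)"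
    for D r B u by (simp add: left_sum_upd)
  show ?thesis
    unfolding walk_def rows_exp.simps sum_distrib_left 1 by (subst sum.swap) simp
qed

lemma walk_Suc_le:
  assumes "t < n"
  shows "walk m n (Suc t) \<le> lam * walk m n t"
proof -
  have nt: "n - t = Suc (n - Suc t)" using assms by simp
  have "walk m n (Suc t) \<le> rows_exp q m t (\<lambda>r. \<Sum>D\<in>PiE {..<m} (\<lambda>_. {0..<int p}).
      (\<Prod>u<m. binmod p q (Suc (n - Suc t)) (D u - left_sum t r (\<lambda>_. 1) u)) * (lam * pot m t r D))"
    unfolding walk_Suc_eq[OF assms]
    using q by (intro rows_exp_mono sum_mono expected_pot_step_le) auto
  also have "\<dots> = rows_exp q m t (\<lambda>r. lam * (\<Sum>D\<in>PiE {..<m} (\<lambda>_. {0..<int p}).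
      (\<Prod>u<m. binmod p q (n - t) (D u - left_sum t r (\<lambda>_. 1) u)) * pot m t r D))"
    unfolding nt sum_distrib_left by (simp only: mult_ac)
  also have "\<dots> = lam * walk m n t"
    unfolding rows_exp_cmult walk_def ..
  finally show ?thesis .
qed

lemma walk_Suc_contract:
  assumes "t + k0 < n"
  shows "walk m n (Suc t) \<le> b * walk m n t + lam"
proof -
  have t: "t < n" and k: "k0 \<le> n - Suc t" using assms by auto
  have nt: "n - t = Suc (n - Suc t)" using assms by simp
  define W where "W = (\<lambda>r D. \<Prod>u<m. binmod p q (n - t) (D u - left_sum t r (\<lambda>_. 1) u))"
  have "walk m n (Suc t) \<le> rows_exp q m t (\<lambda>r. \<Sum>D\<in>PiE {..<m} (\<lambda>_. {0..<int p}).
      W r D * (b * pot m t r D + lam))"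
    unfolding walk_Suc_eq[OF t] W_def nt
    using q k by (intro rows_exp_mono sum_mono expected_pot_step_contract) auto
  also have "\<dots> = rows_exp q m t (\<lambda>r. b * (\<Sum>D\<in>PiE {..<m} (\<lambda>_. {0..<int p}). W r D * pot m t r D)
      + lam * (\<Sum>D\<in>PiE {..<m} (\<lambda>_. {0..<int p}). W r D))"
    by (simp add: distrib_left sum.distrib sum_distrib_left mult_ac)
  also have "\<dots> = rows_exp q m t (\<lambda>r. b * (\<Sum>D\<in>PiE {..<m} (\<lambda>_. {0..<int p}). W r D * pot m t r D) + lam)"
    unfolding W_def walk_mass by simp
  also have "\<dots> = b * walk m n t + lam"
    unfolding rows_exp_add rows_exp_cmult walk_def W_def by simp
  finally show ?thesis .
qed

text \<open>\<open>lam / (1 - b)\<close> is the fixed point of the recursion; the distance from the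
  initial value \<open>lam ^ m\<close> to it contracts by b per row.\<close>

lemma walk_bound:
  assumes "t + k0 \<le> n"
  shows "walk m n t \<le> lam ^ m * b ^ t + lam / (1 - b)"
  using assms
proof (induction t)
  case 0
  then show ?case using walk_0[of m n] lam_gt_1 b by (simp add: add_increasing2)
next
  case (Suc t)
  have "walk m n (Suc t) \<le> b * walk m n t + lam"
    using Suc.prems by (intro walk_Suc_contract) auto
  also have "\<dots> \<le> b * (lam ^ m * b ^ t + lam / (1 - b)) + lam"
    using Suc b by (intro add_right_mono mult_left_mono) auto
  also have "\<dots> = lam ^ m * b ^ Suc t + lam / (1 - b)"
    using b by (simp add: field_simps)
  finally show ?case .
qed

text \<open>As lam * b = 1, the initial potential \<open>lam ^ m\<close> is used up after m rows,
  which leaves room for \<open>k0\<close> uncontrolled rows costing a factor \<open>lam\<close>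
  each. This is why the left side has to be the larger one.\<close>

lemma walk_final:
  assumes "m + k0 \<le> n"
  shows "walk m n n \<le> lam ^ k0 * (1 + lam / (1 - b))"
proof -
  have "walk m n (n - k0 + i) \<le> lam ^ i * (1 + lam / (1 - b))" if "i \<le> k0" for i
    using that
  proof (induction i)
    case 0
    have "lam ^ m * b ^ (n - k0) \<le> lam ^ m * b ^ m"
      using assms b lam_gt_1 by (intro mult_left_mono power_decreasing) auto
    also have "\<dots> = 1" by (simp add: lam_b flip: power_mult_distrib)
    finally show ?case using walk_bound[of "n - k0" n m] assms by simp
  next
    case (Suc i)
    have "walk m n (n - k0 + Suc i) \<le> lam * walk m n (n - k0 + i)"
      using Suc.prems assms walk_Suc_le[of "n - k0 + i" n m] by simp
    also have "\<dots> \<le> lam * (lam ^ i * (1 + lam / (1 - b)))"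
      using Suc lam_gt_1 by (intro mult_left_mono) auto
    finally show ?case by simp
  qed
  from this[of k0] show ?thesis using assms by simp
qed

lemma expected_ln_card_right_part_le:
  assumes "m + k0 \<le> n"
  shows "rows_exp q m n (\<lambda>r. ln (real (card (right_part p m n r (left_sum n r (\<lambda>_. 1))))))
    \<le> lam ^ k0 * (1 + lam / (1 - b)) / th"
proof -
  have "rows_exp q m n (\<lambda>r. th * ln (real (card (right_part p m n r (left_sum n r (\<lambda>_. 1))))))
      \<le> walk m n n"
    unfolding walk_def
  proof (rule rows_exp_mono)
    fix r :: "nat \<Rightarrow> nat set" assume r: "\<And>v. r v \<subseteq> {..<m}"
    \<comment> \<open>With no row left the weights are indicators, and only the true column sums
      modulo p have weight one. This term is the Laplacian of the actual graph; the others are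
      dropped by nonnegativity.\<close>
    define D0 where "D0 = (\<lambda>u\<in>{..<m}. left_sum n r (\<lambda>_. 1) u mod int p)"
    have D0: "D0 \<in> PiE {..<m} (\<lambda>_. {0..<int p})" using p_pos by (auto simp: D0_def)
    have J: "right_part p m n r D0 = right_part p m n r (left_sum n r (\<lambda>_. 1))"
      by (rule right_part_cong) (auto simp: D0_def)
    have one: "(\<Prod>u<m. binmod p q (n - n) (D0 u - left_sum n r (\<lambda>_. 1) u)) = 1"
      by (rule prod.neutral) (auto simp: D0_def mod_eq_dvd_iff[symmetric])
    have c1: "1 \<le> real (card (right_part p m n r D0))"
      using fsubspace_card_pos[OF _ fsubspace_right_part[OF p_pos], of m n r D0] by simp
    have "th * ln (real (card (right_part p m n r D0))) \<le> pot m n r D0"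
      using ln_powr_bound[OF c1 th_pos] th_pos by (simp add: pot_def field_simps)
    also have "\<dots> = (\<Prod>u<m. binmod p q (n - n) (D0 u - left_sum n r (\<lambda>_. 1) u)) * pot m n r D0"
      unfolding one by simp
    also have "\<dots> \<le> (\<Sum>D\<in>PiE {..<m} (\<lambda>_. {0..<int p}).
        (\<Prod>u<m. binmod p q (n - n) (D u - left_sum n r (\<lambda>_. 1) u)) * pot m n r D)"
      using q by (intro member_le_sum[OF D0] mult_nonneg_nonneg prod_nonneg pot_nonneg ballI
          binmod_bounds(1) finite_PiE) auto
    finally show "th * ln (real (card (right_part p m n r (left_sum n r (\<lambda>_. 1)))))
       \<le> (\<Sum>D\<in>PiE {..<m} (\<lambda>_. {0..<int p}).
        (\<Prod>u<m. binmod p q (n - n) (D u - left_sum n r (\<lambda>_. 1) u)) * pot m n r D)"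
      by (simp only: J)
  qed (use q in auto)
  also have "\<dots> \<le> lam ^ k0 * (1 + lam / (1 - b))" by (rule walk_final[OF assms])
  finally show ?thesis using th_pos by (simp add: rows_exp_cmult field_simps)
qed

text \<open>With \<open>z\<close> zero rows so far, a new zero row is dependent on them with probability at most
  \<open>b ^ (m - z)\<close>. The decrease of \<open>comp_pot\<close> in one step has exactly this expectation.\<close>

definition comp_pot :: "real \<Rightarrow> nat \<Rightarrow> nat \<Rightarrow> real" where
  "comp_pot rho m z = (\<Sum>i\<in>{z..<m}. b ^ (m - i)) / rho"

section \<open>Rank deficiency of the zero rows\<close>

lemma comp_pot_step: "z < m \<Longrightarrow> comp_pot rho m z = comp_pot rho m (Suc z) + b ^ (m - z) / rho"
  unfolding comp_pot_def by (simp add: sum.atLeast_Suc_lessThan add_divide_distrib)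

lemma comp_pot_0_le:
  assumes "0 < rho"
  shows "comp_pot rho m 0 \<le> b / (1 - b) / rho"
proof -
  have "(\<Sum>i\<in>{0..<m}. b ^ (m - i)) = (\<Sum>i\<in>{1..m}. b ^ i)"
    by (rule sum.reindex_bij_witness[of _ "\<lambda>i. m - i" "\<lambda>i. m - i"]) auto
  also have "\<dots> = b * (\<Sum>i<m. b ^ i)"
    unfolding sum_distrib_left by (rule sum.reindex_bij_witness[of _ Suc "\<lambda>i. i - 1"]) (auto simp flip: power_Suc)
  also have "\<dots> = b * ((1 - b ^ m) / (1 - b))" using b by (simp add: sum_gp_strict)
  also have "\<dots> \<le> b * (1 / (1 - b))" using b by (intro mult_left_mono divide_right_mono) auto
  finally show ?thesis unfolding comp_pot_def using assms by (intro divide_right_mono) auto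
qed

text \<open>As the annihilator has dimension m - rank, the first two terms equal min z m - rank. The
  compensator \<open>comp_pot\<close> turns this deficiency into a supermartingale.\<close>

definition defect :: "nat \<Rightarrow> nat \<Rightarrow> (nat \<Rightarrow> nat set) \<Rightarrow> real" where
  "defect m t r = log p (card (row_annihilator p m t r)) - max 0 (real m - real (zero_rows p t r))
     + comp_pot (binmod p q m 0) m (zero_rows p t r)"

lemma card_row_annihilator_pos: "0 < card (row_annihilator p m t r)"
  by (rule fsubspace_card_pos[OF _ fsubspace_row_annihilator[OF p_pos]]) simp

text \<open>While z < m, a zero row raises the deficiency, by one, only if it lies in A. The
  annihilator has at least p^(m - z) elements, so A has weight at most b^(m - z), which the expected
  decrease of the compensator balances. For z \<ge> m the deficiency cannot grow.\<close>

lemma expected_defect_step: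
  assumes rho: "0 < binmod p q m 0" and r: "\<And>v. r v \<subseteq> {..<m}"
  shows "(\<Sum>B\<in>Pow {..<m}. row_weight q m B * defect m (Suc t) (r(t := B))) \<le> defect m t r"
proof -
  let ?rho = "binmod p q m 0" and ?z = "zero_rows p t r" and ?K = "row_annihilator p m t r"
  have K: "row_annihilator p m t (r(t := B)) = ?K" "zero_rows p t (r(t := B)) = ?z" for B
    by (auto intro!: row_annihilator_cong zero_rows_cong)
  have p1: "1 < p" using prime_gt_1_nat[OF p] .
  have finK: "finite ?K" using fsubspace_finite[OF _ fsubspace_row_annihilator[OF p_pos]] by auto
  have notp: "defect m (Suc t) (r(t := B)) = defect m t r" if "\<not> p dvd card B" for B
    using that by (simp add: defect_def row_annihilator_Suc zero_rows_Suc K)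
  define A where "A = {B. B \<subseteq> {..<m} \<and> (\<forall>y\<in>?K. int p dvd sum y B)}"
  have logK: "log p (card {y \<in> ?K. int p dvd sum y B}) \<le> log p (card ?K) - 1"
    if B: "B \<subseteq> {..<m}" "B \<notin> A" for B
  proof -
    obtain y where y: "y \<in> ?K" "\<not> int p dvd sum y B" using B unfolding A_def by auto
    let ?c = "card {y \<in> ?K. int p dvd sum y B}"
    have "p * ?c \<le> card ?K" by (rule card_row_kernel_le[OF _ fsubspace_row_annihilator[OF p_pos] p y]) simp
    then have le: "real p * real ?c \<le> real (card ?K)" by (simp flip: of_nat_mult)
    have c: "0 < ?c"
      by (rule fsubspace_card_pos[OF _ fsubspace_row_kernel[OF fsubspace_row_annihilator[OF p_pos] p_pos]]) simp
    have "log p (real p * real ?c) \<le> log p (card ?K)"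
      using le p1 c card_row_annihilator_pos by (subst log_le_cancel_iff) auto
    then show ?thesis using p1 c by (simp add: log_mult)
  qed
  have logK': "log p (card {y \<in> ?K. int p dvd sum y B}) \<le> log p (card ?K)" for B
  proof -
    have "card {y \<in> ?K. int p dvd sum y B} \<le> card ?K" using finK by (intro card_mono) auto
    moreover have "0 < card {y \<in> ?K. int p dvd sum y B}"
      by (rule fsubspace_card_pos[OF _ fsubspace_row_kernel[OF fsubspace_row_annihilator[OF p_pos] p_pos]]) simp
    ultimately show ?thesis using p1 by (subst log_le_cancel_iff) auto
  qed
  have wnn: "0 \<le> row_weight q m B" for B using q row_weight_nonneg by auto
  show ?thesis
  proof (cases "?z < m")
    case False
    have "defect m (Suc t) (r(t := B)) \<le> defect m t r" for B
    proof (cases "p dvd card B")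
      case True
      then show ?thesis using False logK'[of B]
        by (simp add: defect_def row_annihilator_Suc zero_rows_Suc K comp_pot_def max_def)
    qed (simp add: notp)
    then have "(\<Sum>B\<in>Pow {..<m}. row_weight q m B * defect m (Suc t) (r(t := B)))
       \<le> (\<Sum>B\<in>Pow {..<m}. row_weight q m B * defect m t r)"
      using wnn by (intro sum_mono mult_left_mono) auto
    also have "\<dots> = defect m t r" unfolding sum_distrib_right[symmetric] sum_row_weight by simp
    finally show ?thesis .
  next
    case True
    let ?e = "b ^ (m - ?z) / ?rho"
    have step: "row_weight q m B * defect m (Suc t) (r(t := B)) \<le> row_weight q m B * defect m t r
        - (if p dvd card B then row_weight q m B * ?e else 0) + (if B \<in> A then row_weight q m B else 0)"
      if B: "B \<in> Pow {..<m}" for B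
    proof (cases "p dvd card B")
      case p1: True
      have "defect m (Suc t) (r(t := B)) \<le> defect m t r - ?e + (if B \<in> A then 1 else 0)"
        using True p1 logK[of B] logK'[of B] comp_pot_step[OF True, of ?rho] B
        by (cases "B \<in> A") (simp_all add: defect_def row_annihilator_Suc zero_rows_Suc K)
      from mult_left_mono[OF this wnn[of B]] p1 show ?thesis
        by (auto simp: algebra_simps)
    qed (use wnn in \<open>simp add: notp\<close>)
    have "(\<Sum>B\<in>Pow {..<m}. row_weight q m B * defect m (Suc t) (r(t := B)))
       \<le> (\<Sum>B\<in>Pow {..<m}. row_weight q m B * defect m t r
        - (if p dvd card B then row_weight q m B * ?e else 0) + (if B \<in> A then row_weight q m B else 0))"
      by (rule sum_mono[OF step])
    also have "\<dots> = defect m t r - b ^ (m - ?z) + (\<Sum>B\<in>A. row_weight q m B)"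
    proof -
      have "Pow {..<m} \<inter> {B. B \<in> A} = A" unfolding A_def by auto
      moreover have "(\<Sum>B\<in>Pow {..<m}. if p dvd card B then row_weight q m B * ?e else 0) = ?rho * ?e"
        unfolding sum_row_weight_dvd_card[symmetric] sum_distrib_right
        by (rule sum.inter_filter[symmetric]) simp
      moreover have "(\<Sum>B\<in>Pow {..<m}. row_weight q m B * defect m t r) = defect m t r"
        unfolding sum_distrib_right[symmetric] sum_row_weight by simp
      ultimately show ?thesis using rho by (simp add: sum.distrib sum_subtractf sum.If_cases)
    qed
    also have "(\<Sum>B\<in>A. row_weight q m B) \<le> b ^ (m - ?z)"
    proof -
      have "(\<Sum>B\<in>A. row_weight q m B) * real (card ?K) powr th \<le> (\<Prod>u<m. (1 - q) + q)"
        unfolding A_def row_weight_def using b th q qb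
        by (intro weighted_annihilator_bound[OF p fsubspace_row_annihilator[OF p_pos]]) auto
      then have 1: "(\<Sum>B\<in>A. row_weight q m B) * real (card ?K) powr th \<le> 1" by simp
      have "p ^ m \<le> card ?K * p ^ ?z" by (rule card_row_annihilator_lower[OF p_pos])
      moreover have "p ^ m = p ^ (m - ?z) * p ^ ?z" using True by (simp flip: power_add)
      ultimately have "p ^ (m - ?z) \<le> card ?K" using p_pos by simp
      then have "real p ^ (m - ?z) \<le> real (card ?K)" by (simp flip: of_nat_power)
      then have "(real p ^ (m - ?z)) powr th \<le> real (card ?K) powr th"
        using th_pos by (intro powr_mono2) auto
      moreover have "(real p ^ (m - ?z)) powr th = lam ^ (m - ?z)"
        using p_pos unfolding lam_def
        by (simp add: powr_power powr_powr mult.commute flip: powr_realpow)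
      ultimately have "(\<Sum>B\<in>A. row_weight q m B) * lam ^ (m - ?z) \<le> (\<Sum>B\<in>A. row_weight q m B) * real (card ?K) powr th"
        using wnn by (intro mult_left_mono sum_nonneg) auto
      with 1 have "(\<Sum>B\<in>A. row_weight q m B) * lam ^ (m - ?z) \<le> 1" by linarith
      then have "(\<Sum>B\<in>A. row_weight q m B) * lam ^ (m - ?z) * b ^ (m - ?z) \<le> 1 * b ^ (m - ?z)"
        using b by (intro mult_right_mono) auto
      moreover have "lam ^ (m - ?z) * b ^ (m - ?z) = 1" by (simp add: lam_b flip: power_mult_distrib)
      ultimately show ?thesis by (simp add: mult.assoc)
    qed
    finally show ?thesis by simp
  qed
qed

lemma expected_defect_le:
  assumes rho: "0 < binmod p q m 0"
  shows "rows_exp q m t (defect m t) \<le> b / (1 - b) / binmod p q m 0"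
proof (induction t)
  case 0
  have "defect m 0 (\<lambda>_. {}) = comp_pot (binmod p q m 0) m 0"
    using prime_gt_1_nat[OF p] by (simp add: defect_def card_fvec log_nat_power)
  then show ?case using comp_pot_0_le[OF rho] by simp
next
  case (Suc t)
  have "rows_exp q m (Suc t) (defect m (Suc t)) \<le> rows_exp q m t (defect m t)"
    unfolding rows_exp.simps using q by (intro rows_exp_mono expected_defect_step rho) auto
  with Suc show ?case by linarith
qed

text \<open>In logarithms, \<open>card_left_kernel_le\<close> bounds the left kernel by z - m plus
  the dimension of the annihilator, that is by max 0 (z - m) plus the deficiency.\<close>

lemma expected_log_card_left_kernel_le:
  assumes rho: "0 < binmod p q m 0"
  shows "rows_exp q m t (\<lambda>r. log p (card (left_kernel p m t r)))
    \<le> rows_exp q m t (\<lambda>r. max 0 (real (zero_rows p t r) - real m)) + b / (1 - b) / binmod p q m 0"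
proof -
  have p1: "1 < p" using prime_gt_1_nat[OF p] .
  have "rows_exp q m t (\<lambda>r. log p (card (left_kernel p m t r)))
     \<le> rows_exp q m t (\<lambda>r. max 0 (real (zero_rows p t r) - real m) + defect m t r)"
  proof (rule rows_exp_mono)
    fix r :: "nat \<Rightarrow> nat set" assume r: "\<And>v. r v \<subseteq> {..<m}"
    have "(\<lambda>_. 0) \<in> left_kernel p m t r" using p_pos by (simp add: left_kernel_def left_sum_def)
    then have E0: "left_kernel p m t r \<noteq> {}" by blast
    then have E: "0 < card (left_kernel p m t r)" by (simp add: card_gt_0_iff)
    have "real (card (left_kernel p m t r)) * real p ^ m \<le> real (card (row_annihilator p m t r)) * real p ^ zero_rows p t r"
      using card_left_kernel_le[OF p r, of t] by (simp flip: of_nat_power of_nat_mult)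
    then have "log p (real (card (left_kernel p m t r)) * real p ^ m) \<le> log p (real (card (row_annihilator p m t r)) * real p ^ zero_rows p t r)"
      using p1 E card_row_annihilator_pos by (subst log_le_cancel_iff) auto
    then have "log p (card (left_kernel p m t r)) + real m \<le> log p (card (row_annihilator p m t r)) + real (zero_rows p t r)"
      using p1 E0 card_row_annihilator_pos[of m t r] by (simp add: log_mult log_nat_power)
    moreover have "0 \<le> comp_pot (binmod p q m 0) m (zero_rows p t r)"
      unfolding comp_pot_def using rho b by (intro divide_nonneg_pos sum_nonneg) auto
    ultimately show "log p (card (left_kernel p m t r)) \<le> max 0 (real (zero_rows p t r) - real m) + defect m t r"
      unfolding defect_def by (auto simp: max_def)
  qed (use q in auto)
  also have "\<dots> \<le> rows_exp q m t (\<lambda>r. max 0 (real (zero_rows p t r) - real m)) + b / (1 - b) / binmod p q m 0"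
    unfolding rows_exp_add using expected_defect_le[OF rho] by (intro add_left_mono)
  finally show ?thesis .
qed

end

section \<open>Mean deviation of the binomial distribution\<close>

text \<open>Expectation of \<open>F\<close> under the binomial distribution with \<open>n\<close> trials and success probability \<open>c\<close>.\<close>

primrec binomial_exp :: "real \<Rightarrow> nat \<Rightarrow> (nat \<Rightarrow> real) \<Rightarrow> real" where
  "binomial_exp c 0 F = F 0"
| "binomial_exp c (Suc n) F = binomial_exp c n (\<lambda>k. c * F (Suc k) + (1 - c) * F k)"

text \<open>The degree of a left vertex depends on its own row only, so the zero rows are
  independent events of equal probability.\<close>

lemma rows_exp_zero_rows:
  assumes "0 \<le> q" "q \<le> 1"
  shows "rows_exp q m n (\<lambda>r. F (zero_rows p n r)) = binomial_exp (binmod p q m 0) n F"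
proof (induction n arbitrary: F)
  case (Suc n)
  let ?rho = "binmod p q m 0"
  have *: "(\<Sum>B\<in>Pow {..<m}. row_weight q m B * F (zero_rows p (Suc n) (r(n := B))))
      = ?rho * F (Suc (zero_rows p n r)) + (1 - ?rho) * F (zero_rows p n r)" for r
  proof -
    let ?z = "zero_rows p n r"
    have z: "zero_rows p n (r(n := B)) = ?z" for B by (rule zero_rows_cong) auto
    have "(\<Sum>B\<in>Pow {..<m}. row_weight q m B * F (zero_rows p (Suc n) (r(n := B))))
      = (\<Sum>B\<in>Pow {..<m}. row_weight q m B * F ?z + (if p dvd card B then row_weight q m B * (F (Suc ?z) - F ?z) else 0))"
      by (rule sum.cong) (auto simp: zero_rows_Suc z algebra_simps)
    also have "\<dots> = F ?z + ?rho * (F (Suc ?z) - F ?z)"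
    proof -
      have "(\<Sum>B\<in>Pow {..<m}. if p dvd card B then row_weight q m B * (F (Suc ?z) - F ?z) else 0) = ?rho * (F (Suc ?z) - F ?z)"
        unfolding sum_row_weight_dvd_card[symmetric] sum_distrib_right
        by (rule sum.inter_filter[symmetric]) simp
      then show ?thesis
        unfolding sum.distrib sum_distrib_right[symmetric] sum_row_weight by simp
    qed
    finally show ?thesis by (simp add: algebra_simps)
  qed
  show ?case unfolding rows_exp.simps * binomial_exp.simps by (rule Suc.IH)
qed simp

section \<open>Moments, tails and perturbations of binomial expectations\<close>

lemma binomial_exp_mono:
  assumes "0 \<le> c" "c \<le> 1" "\<And>k. F k \<le> G k"
  shows "binomial_exp c n F \<le> binomial_exp c n G"
  using assms(3)
proof (induction n arbitrary: F G)
  case (Suc n)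
  show ?case unfolding binomial_exp.simps
    using Suc.prems assms(1,2) by (intro Suc.IH add_mono mult_left_mono) auto
qed simp

lemma binomial_exp_add: "binomial_exp c n (\<lambda>k. F k + G k) = binomial_exp c n F + binomial_exp c n G"
proof (induction n arbitrary: F G)
  case (Suc n)
  show ?case unfolding binomial_exp.simps Suc.IH[symmetric] by (simp add: algebra_simps)
qed simp

lemma binomial_exp_cmult: "binomial_exp c n (\<lambda>k. a * F k) = a * binomial_exp c n F"
proof (induction n arbitrary: F)
  case (Suc n)
  show ?case unfolding binomial_exp.simps Suc.IH[symmetric] by (simp add: algebra_simps)
qed simp

lemma binomial_exp_const [simp]: "binomial_exp c n (\<lambda>_. a) = a"
  by (induction n) (simp_all add: algebra_simps)

lemma binomial_exp_mean: "binomial_exp c n (\<lambda>k. real k - a) = real n * c - a"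
proof (induction n arbitrary: a)
  case (Suc n)
  have "binomial_exp c (Suc n) (\<lambda>k. real k - a) = binomial_exp c n (\<lambda>k. real k - (a - c))"
    unfolding binomial_exp.simps by (simp add: algebra_simps)
  also have "\<dots> = real n * c - (a - c)" by (rule Suc.IH)
  finally show ?case by (simp add: algebra_simps)
qed simp

lemma binomial_exp_square: "binomial_exp c n (\<lambda>k. (real k - a)\<^sup>2) = (real n * c - a)\<^sup>2 + real n * (c * (1 - c))"
proof (induction n arbitrary: a)
  case (Suc n)
  have "binomial_exp c (Suc n) (\<lambda>k. (real k - a)\<^sup>2) = binomial_exp c n (\<lambda>k. (real k - (a - c))\<^sup>2 + c * (1 - c))"
    unfolding binomial_exp.simps by (simp add: power2_eq_square algebra_simps)
  also have "\<dots> = binomial_exp c n (\<lambda>k. (real k - (a - c))\<^sup>2) + c * (1 - c)"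
    unfolding binomial_exp_add by simp
  also have "\<dots> = (real n * c - (a - c))\<^sup>2 + real n * (c * (1 - c)) + c * (1 - c)" by (simp only: Suc.IH)
  finally show ?case by (simp add: power2_eq_square algebra_simps)
qed simp

text \<open>The line x - g is tangent to the parabola x^2 / (4 g) at x = 2 g, so the variance alone
  bounds the expected excess. For g linear in n the bound is constant.\<close>

lemma binomial_exp_tail_le:
  assumes c: "0 \<le> c" "c \<le> 1" and g: "0 < g"
  shows "binomial_exp c n (\<lambda>k. max 0 (real k - real n * c - g)) \<le> real n / (4 * g)"
    and "binomial_exp c n (\<lambda>k. max 0 (real n * c - real k - g)) \<le> real n / (4 * g)"
proof -
  have quad: "max 0 (x - g) \<le> 1 / (4 * g) * x\<^sup>2" for x
  proof -
    have "0 \<le> (x - 2 * g)\<^sup>2" by simp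
    then have "4 * g * (x - g) \<le> x\<^sup>2" by (simp add: power2_eq_square algebra_simps)
    then show ?thesis using g by (simp add: field_simps)
  qed
  have "c * (1 - c) \<le> 1 * 1" using c by (intro mult_mono) auto
  then have v: "binomial_exp c n (\<lambda>k. 1 / (4 * g) * (real k - real n * c)\<^sup>2) \<le> real n / (4 * g)"
    unfolding binomial_exp_cmult binomial_exp_square using g by (simp add: divide_right_mono mult_left_le)
  have "binomial_exp c n (\<lambda>k. max 0 (real k - real n * c - g)) \<le> binomial_exp c n (\<lambda>k. 1 / (4 * g) * (real k - real n * c)\<^sup>2)"
    by (rule binomial_exp_mono[OF c quad])
  with v show "binomial_exp c n (\<lambda>k. max 0 (real k - real n * c - g)) \<le> real n / (4 * g)" by linarith
  have "max 0 (real n * c - real k - g) \<le> 1 / (4 * g) * (real k - real n * c)\<^sup>2" for k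
    using quad[of "real n * c - real k"] by (simp add: power2_commute)
  then have "binomial_exp c n (\<lambda>k. max 0 (real n * c - real k - g)) \<le> binomial_exp c n (\<lambda>k. 1 / (4 * g) * (real k - real n * c)\<^sup>2)"
    by (intro binomial_exp_mono[OF c])
  with v show "binomial_exp c n (\<lambda>k. max 0 (real n * c - real k - g)) \<le> real n / (4 * g)" by linarith
qed

text \<open>Replace the trials one at a time: each replacement moves the expectation of a
  1-Lipschitz function by at most |c - d|. The factor n is affordable because the success
  probability is exponentially close to 1/p.\<close>

lemma binomial_exp_Lipschitz_parameter:
  assumes "0 \<le> c" "c \<le> 1" "0 \<le> d" "d \<le> 1" "\<And>k. \<bar>F (Suc k) - F k\<bar> \<le> 1"
  shows "\<bar>binomial_exp c n F - binomial_exp d n F\<bar> \<le> real n * \<bar>c - d\<bar>"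
  using assms(5)
proof (induction n arbitrary: F)
  case (Suc n)
  let ?G = "\<lambda>c k. c * F (Suc k) + (1 - c) * F k"
  have lip: "\<bar>?G c (Suc k) - ?G c k\<bar> \<le> 1" for k
  proof -
    have "?G c (Suc k) - ?G c k = c * (F (Suc (Suc k)) - F (Suc k)) + (1 - c) * (F (Suc k) - F k)"
      by (simp add: algebra_simps)
    also have "\<bar>\<dots>\<bar> \<le> c * \<bar>F (Suc (Suc k)) - F (Suc k)\<bar> + (1 - c) * \<bar>F (Suc k) - F k\<bar>"
      using assms(1,2) by (intro order_trans[OF abs_triangle_ineq]) (simp add: abs_mult)
    also have "\<dots> \<le> c * 1 + (1 - c) * 1"
      using assms(1,2) Suc.prems by (intro add_mono mult_left_mono) auto
    finally show ?thesis by simp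
  qed
  have close: "\<bar>?G c k - ?G d k\<bar> \<le> \<bar>c - d\<bar>" for k
  proof -
    have "?G c k - ?G d k = (c - d) * (F (Suc k) - F k)" by (simp add: algebra_simps)
    then show ?thesis using Suc.prems[of k] by (simp add: abs_mult mult_left_le)
  qed
  have "binomial_exp d n (?G c) \<le> binomial_exp d n (\<lambda>k. ?G d k + \<bar>c - d\<bar>)"
    by (intro binomial_exp_mono assms(3,4)) (use close in \<open>auto simp: abs_le_iff diff_le_eq add.commute\<close>)
  moreover have "binomial_exp d n (?G d) \<le> binomial_exp d n (\<lambda>k. ?G c k + \<bar>c - d\<bar>)"
  proof (intro binomial_exp_mono assms(3,4))
    fix k show "?G d k \<le> ?G c k + \<bar>c - d\<bar>" using close[of k] by linarith
  qed
  ultimately have "\<bar>binomial_exp d n (?G c) - binomial_exp d n (?G d)\<bar> \<le> \<bar>c - d\<bar>"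
    unfolding binomial_exp_add binomial_exp_const by linarith
  moreover have "\<bar>binomial_exp c n (?G c) - binomial_exp d n (?G c)\<bar> \<le> real n * \<bar>c - d\<bar>"
    by (rule Suc.IH) (rule lip)
  ultimately show ?case by (simp add: algebra_simps)
qed simp

text \<open>Lets n be rounded down to a multiple of p, so that the mean n/p becomes an integer as De
  Moivre's formula requires.\<close>

lemma binomial_exp_Lipschitz_trials:
  assumes "0 \<le> c" "c \<le> 1" "\<And>k. \<bar>F (Suc k) - F k\<bar> \<le> 1"
  shows "\<bar>binomial_exp c (n + j) F - binomial_exp c n F\<bar> \<le> real j"
proof (induction j)
  case (Suc j)
  let ?G = "\<lambda>k. c * F (Suc k) + (1 - c) * F k"
  have close: "\<bar>?G k - F k\<bar> \<le> 1" for k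
  proof -
    have "?G k - F k = c * (F (Suc k) - F k)" by (simp add: algebra_simps)
    then have "\<bar>?G k - F k\<bar> = c * \<bar>F (Suc k) - F k\<bar>" using assms(1) by (simp add: abs_mult)
    also have "\<dots> \<le> 1 * 1" using assms by (intro mult_mono) auto
    finally show ?thesis by simp
  qed
  have "binomial_exp c (n + j) ?G \<le> binomial_exp c (n + j) (\<lambda>k. F k + 1)"
  proof (intro binomial_exp_mono assms(1,2))
    fix k show "?G k \<le> F k + 1" using close[of k] by linarith
  qed
  moreover have "binomial_exp c (n + j) F \<le> binomial_exp c (n + j) (\<lambda>k. ?G k + 1)"
  proof (intro binomial_exp_mono assms(1,2))
    fix k show "F k \<le> ?G k + 1" using close[of k] by linarith
  qed
  ultimately have "\<bar>binomial_exp c (n + j) ?G - binomial_exp c (n + j) F\<bar> \<le> 1"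
    unfolding binomial_exp_add binomial_exp_const by linarith
  with Suc show ?case by simp
qed simp

lemma binomial_exp_Bernstein: "binomial_exp c n F = (\<Sum>k\<le>n. Bernstein n k c * F k)"
proof (induction n arbitrary: F)
  case 0 then show ?case by (simp add: Bernstein_def)
next
  case (Suc n)
  have rec: "Bernstein (Suc n) (Suc k) c = c * Bernstein n k c + (1 - c) * Bernstein n (Suc k) c" if "k \<le> n" for k
  proof (cases "k = n")
    case False
    then have "n - k = Suc (n - Suc k)" using that by simp
    then show ?thesis by (simp add: Bernstein_def algebra_simps)
  qed (simp add: Bernstein_def)
  have "(\<Sum>k\<le>Suc n. Bernstein (Suc n) k c * F k) = Bernstein (Suc n) 0 c * F 0 + (\<Sum>k\<le>n. Bernstein (Suc n) (Suc k) c * F (Suc k))"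
    by (rule sum.atMost_Suc_shift)
  also have "\<dots> = (1 - c) * Bernstein n 0 c * F 0 + (\<Sum>k\<le>n. c * Bernstein n k c * F (Suc k) + (1 - c) * Bernstein n (Suc k) c * F (Suc k))"
  proof (intro arg_cong2[of _ _ _ _ "(+)"] sum.cong refl)
    show "Bernstein (Suc n) 0 c * F 0 = (1 - c) * Bernstein n 0 c * F 0" by (simp add: Bernstein_def)
    fix k assume "k \<in> {..n}"
    then show "Bernstein (Suc n) (Suc k) c * F (Suc k)
        = c * Bernstein n k c * F (Suc k) + (1 - c) * Bernstein n (Suc k) c * F (Suc k)"
      by (simp add: rec distrib_right)
  qed
  also have "\<dots> = (\<Sum>k\<le>n. c * Bernstein n k c * F (Suc k)) + ((1 - c) * Bernstein n 0 c * F 0 + (\<Sum>k\<le>n. (1 - c) * Bernstein n (Suc k) c * F (Suc k)))"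
    by (simp add: sum.distrib)
  also have "(1 - c) * Bernstein n 0 c * F 0 + (\<Sum>k\<le>n. (1 - c) * Bernstein n (Suc k) c * F (Suc k))
      = (\<Sum>k\<le>Suc n. (1 - c) * Bernstein n k c * F k)"
    by (rule sum.atMost_Suc_shift[symmetric])
  also have "\<dots> = (\<Sum>k\<le>n. (1 - c) * Bernstein n k c * F k)"
    by (simp add: Bernstein_def)
  finally show ?case
    by (simp add: Suc.IH sum.distrib[symmetric] algebra_simps)
qed

text \<open>De Moivre's telescoping evaluation of the mean deviation: the summand
  \<open>(k - n c) Bernstein n k c\<close> is the difference of consecutive values of
  \<open>c (n - k) Bernstein n k c\<close>.\<close>

lemma de_Moivre_mean_deviation:
  assumes N: "real N = real n * c" "N \<le> n"
  shows "binomial_exp c n (\<lambda>k. max 0 (real k - real N)) = c * (real n - real N) * Bernstein n N c"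
proof -
  let ?T = "\<lambda>k. c * (real n - real k) * Bernstein n k c"
  have tel: "(real (Suc k) - real n * c) * Bernstein n (Suc k) c = ?T k - ?T (Suc k)" if "k < n" for k
  proof -
    have e: "n - k = Suc (n - Suc k)" using that by simp
    have "Suc k * (n choose Suc k) = (n - k) * (n choose k)"
      using binomial_absorb_comp[of n k] binomial_absorption[of k "n"] that
      by (metis Suc_times_binomial_eq binomial_absorb_comp mult.commute Suc_diff_Suc Suc_pred)
    then have "real (Suc k * (n choose Suc k)) = real ((n - k) * (n choose k))" by (rule arg_cong)
    then have ch: "real (Suc k) * real (n choose Suc k) = (real n - real k) * real (n choose k)"
      using that by (simp only: of_nat_mult of_nat_diff[OF less_imp_le])
    have "(1 - c) * real (Suc k) * Bernstein n (Suc k) c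
       = (real (Suc k) * real (n choose Suc k)) * c ^ Suc k * (1 - c) ^ Suc (n - Suc k)"
      by (simp add: Bernstein_def)
    also have "\<dots> = ?T k" unfolding ch by (simp add: Bernstein_def e)
    finally show ?thesis by (simp add: algebra_simps)
  qed
  have "binomial_exp c n (\<lambda>k. max 0 (real k - real N)) = (\<Sum>k\<le>n. Bernstein n k c * max 0 (real k - real N))"
    by (rule binomial_exp_Bernstein)
  also have "\<dots> = (\<Sum>k\<in>{Suc N..n}. Bernstein n k c * max 0 (real k - real N))"
    by (rule sum.mono_neutral_right) (auto simp: not_less_eq_eq)
  also have "\<dots> = (\<Sum>k\<in>{Suc N..n}. ?T (k - 1) - ?T k)"
  proof (rule sum.cong[OF refl])
    fix k assume k: "k \<in> {Suc N..n}"
    then have "k - 1 < n" by auto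
    from tel[OF this] k N show "Bernstein n k c * max 0 (real k - real N) = ?T (k - 1) - ?T k"
      by (simp add: mult.commute)
  qed
  also have "\<dots> = (\<Sum>k\<in>{N..<n}. ?T k - ?T (Suc k))"
    by (rule sum.reindex_bij_witness[of _ Suc "\<lambda>k. k - 1"]) auto
  also have "\<dots> = ?T N - ?T n"
    using sum_Suc_diff'[of N n "\<lambda>k. - ?T k"] N(2) by simp
  finally show ?thesis by simp
qed

section \<open>Stirling's formula with an explicit error\<close>

lemma ln_one_plus_bounds:
  fixes x :: real
  assumes "0 \<le> x"
  shows "x - x\<^sup>2 / 2 \<le> ln (1 + x)" "ln (1 + x) \<le> x - x\<^sup>2 / 2 + x ^ 3 / 3"
proof -
  have "(\<lambda>t. ln (1 + t) - (t - t\<^sup>2 / 2)) 0 \<le> (\<lambda>t. ln (1 + t) - (t - t\<^sup>2 / 2)) x"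
  proof (rule DERIV_nonneg_imp_nondecreasing[OF assms])
    fix t :: real assume t: "0 \<le> t" "t \<le> x"
    have "((\<lambda>t. ln (1 + t) - (t - t\<^sup>2 / 2)) has_real_derivative (1 / (1 + t) - (1 - t))) (at t)"
      using t by (auto intro!: derivative_eq_intros)
    moreover have "1 / (1 + t) - (1 - t) = t\<^sup>2 / (1 + t)" using t by (simp add: field_simps power2_eq_square)
    ultimately show "\<exists>y. ((\<lambda>t. ln (1 + t) - (t - t\<^sup>2 / 2)) has_real_derivative y) (at t) \<and> 0 \<le> y"
      using t by (intro exI[of _ "t\<^sup>2 / (1 + t)"]) simp
  qed
  then show "x - x\<^sup>2 / 2 \<le> ln (1 + x)" by simp
  have "(\<lambda>t. (t - t\<^sup>2 / 2 + t ^ 3 / 3) - ln (1 + t)) 0 \<le> (\<lambda>t. (t - t\<^sup>2 / 2 + t ^ 3 / 3) - ln (1 + t)) x"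
  proof (rule DERIV_nonneg_imp_nondecreasing[OF assms])
    fix t :: real assume t: "0 \<le> t" "t \<le> x"
    have "((\<lambda>t. (t - t\<^sup>2 / 2 + t ^ 3 / 3) - ln (1 + t)) has_real_derivative ((1 - t + t\<^sup>2) - 1 / (1 + t))) (at t)"
      using t by (auto intro!: derivative_eq_intros simp: power2_eq_square)
    moreover have "(1 - t + t\<^sup>2) - 1 / (1 + t) = t ^ 3 / (1 + t)"
      using t by (simp add: field_simps power2_eq_square power3_eq_cube)
    ultimately show "\<exists>y. ((\<lambda>t. (t - t\<^sup>2 / 2 + t ^ 3 / 3) - ln (1 + t)) has_real_derivative y) (at t) \<and> 0 \<le> y"
      using t by (intro exI[of _ "t ^ 3 / (1 + t)"]) simp
  qed
  then show "ln (1 + x) \<le> x - x\<^sup>2 / 2 + x ^ 3 / 3" by simp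
qed

text \<open>Logarithm of the ratio of n! to n^(n + 1/2) e^(-n); it tends to ln (2 pi) / 2.\<close>

definition stirling_error :: "nat \<Rightarrow> real" where
  "stirling_error n = ln (fact n) - (real n + 1/2) * ln (real n) + real n"

text \<open>The shift 1/2 cancels the terms of order 1/n in (n + 1/2) ln (1 + 1/n) - 1. The
  remaining O(1/n^2) is bounded by a telescoping difference; the factor 2 comes from n + 1 \<le> 2
  n.\<close>

lemma stirling_error_diff:
  assumes "0 < n"
  shows "\<bar>stirling_error (Suc n) - stirling_error n\<bar> \<le> 2 * (1 / real n - 1 / real (Suc n))"
proof -
  define x where "x = 1 / real n"
  have x: "0 < x" "x \<le> 1" and nx: "real n * x = 1" using assms by (auto simp: x_def)
  have "ln (real (Suc n)) = ln (real n * (1 + x))" using nx by (simp add: distrib_left add.commute)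
  also have "\<dots> = ln (real n) + ln (1 + x)" using assms x by (simp add: ln_mult)
  finally have l: "ln (real (Suc n)) = ln (real n) + ln (1 + x)" .
  have "stirling_error n - stirling_error (Suc n) = (real n + 1/2) * ln (1 + x) - 1"
  proof -
    have "ln (fact (Suc n) :: real) = ln (real (Suc n)) + ln (fact n)"
      unfolding fact_Suc by (rule ln_mult_pos) auto
    then show ?thesis unfolding stirling_error_def l by (simp add: algebra_simps)
  qed
  moreover have "(real n + 1/2) * ln (1 + x) - 1 \<le> x\<^sup>2"
  proof -
    have "(real n + 1/2) * ln (1 + x) \<le> (real n + 1/2) * (x - x\<^sup>2 / 2 + x ^ 3 / 3)"
      using ln_one_plus_bounds(2)[of x] x by (intro mult_left_mono) auto
    also have "\<dots> = (real n * x) * (1 - x / 2 + x\<^sup>2 / 3) + x / 2 - x\<^sup>2 / 4 + x ^ 3 / 6"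
      by (simp add: algebra_simps power2_eq_square power3_eq_cube)
    also have "\<dots> = 1 + x\<^sup>2 / 12 + x ^ 3 / 6" unfolding nx by simp
    also have "x ^ 3 \<le> x\<^sup>2" using x by (intro power_decreasing) auto
    finally show ?thesis using zero_le_power2[of x] by linarith
  qed
  moreover have "- (x\<^sup>2) \<le> (real n + 1/2) * ln (1 + x) - 1"
  proof -
    have "(real n + 1/2) * (x - x\<^sup>2 / 2) \<le> (real n + 1/2) * ln (1 + x)"
      using ln_one_plus_bounds(1)[of x] x by (intro mult_left_mono) auto
    also have "(real n + 1/2) * (x - x\<^sup>2 / 2) = (real n * x) * (1 - x / 2) + x / 2 - x\<^sup>2 / 4"
      by (simp add: algebra_simps power2_eq_square)
    also have "\<dots> = 1 - x\<^sup>2 / 4" unfolding nx by simp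
    finally show ?thesis using zero_le_power2[of x] by linarith
  qed
  moreover have "x\<^sup>2 \<le> 2 * (1 / real n - 1 / real (Suc n))"
  proof -
    have "x\<^sup>2 = 2 / (real n * (2 * real n))" by (simp add: x_def power2_eq_square)
    also have "\<dots> \<le> 2 / (real n * real (Suc n))"
      using assms by (intro divide_left_mono mult_left_mono mult_pos_pos) auto
    also have "\<dots> = 2 * (1 / real n - 1 / real (Suc n))"
      using assms by (simp add: divide_simps)
    finally show ?thesis .
  qed
  ultimately show ?thesis by linarith
qed

lemma stirling_error_Cauchy:
  assumes "0 < n" "n \<le> k"
  shows "\<bar>stirling_error k - stirling_error n\<bar> \<le> 2 * (1 / real n - 1 / real k)"
  using assms(2)
proof (induction k rule: dec_induct)
  case (step k)
  have "\<bar>stirling_error (Suc k) - stirling_error k\<bar> \<le> 2 * (1 / real k - 1 / real (Suc k))"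
    using assms step by (intro stirling_error_diff) auto
  moreover have "\<bar>stirling_error (Suc k) - stirling_error n\<bar>
      \<le> \<bar>stirling_error (Suc k) - stirling_error k\<bar> + \<bar>stirling_error k - stirling_error n\<bar>"
    using abs_triangle_ineq[of "stirling_error (Suc k) - stirling_error k" "stirling_error k - stirling_error n"]
    by simp
  ultimately show ?case using step.IH unfolding right_diff_distrib by linarith
qed simp

text \<open>The partial Wallis product is a quotient of factorials in which all exponential growth
  cancels, so its limit pi / 2 determines the constant in Stirling's formula.\<close>

lemma wallis_stirling:
  assumes "0 < n"
  shows "ln (\<Prod>k=1..n. (4 * real k ^ 2) / (4 * real k ^ 2 - 1))
    = 4 * stirling_error n - 2 * stirling_error (2 * n) + ln (real n / (2 * (2 * real n + 1)))"
proof -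
  have prod: "(\<Prod>k=1..n. (4 * real k ^ 2) / (4 * real k ^ 2 - 1))
     = (4 ^ n * fact n ^ 2)\<^sup>2 / ((fact (2 * n))\<^sup>2 * (2 * real n + 1))" for n
  proof (induction n)
    case (Suc n)
    have f: "(fact (2 * Suc n) :: real) = (2 * real n + 2) * (2 * real n + 1) * fact (2 * n)"
      by (simp add: algebra_simps)
    have g: "4 * real (Suc n) ^ 2 - 1 = (2 * real n + 1) * (2 * real n + 3)"
      by (simp add: power2_eq_square algebra_simps)
    have h: "(fact (2 * n) :: real) \<noteq> 0" "2 * real n + 1 \<noteq> 0" "2 * real n + 3 \<noteq> 0" "2 * real n + 2 \<noteq> 0" by auto
    have "(\<Prod>k=1..Suc n. (4 * real k ^ 2) / (4 * real k ^ 2 - 1)) =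
      (\<Prod>k=1..n. (4 * real k ^ 2) / (4 * real k ^ 2 - 1)) * (4 * real (Suc n) ^ 2 / (4 * real (Suc n) ^ 2 - 1))"
      by simp
    also have "\<dots> = (4 ^ n * fact n ^ 2)\<^sup>2 / ((fact (2 * n))\<^sup>2 * (2 * real n + 1)) * (4 * real (Suc n) ^ 2 / (4 * real (Suc n) ^ 2 - 1))"
      by (simp only: Suc.IH)
    also have "\<dots> = (4 ^ Suc n * fact (Suc n) ^ 2)\<^sup>2 / ((fact (2 * Suc n))\<^sup>2 * (2 * real (Suc n) + 1))"
      unfolding g f fact_Suc using h
      by (simp add: divide_simps) (simp add: power2_eq_square power4_eq_xxxx algebra_simps)
    finally show ?case .
  qed simp
  have ln4: "ln (4::real) = 2 * ln 2" using ln_realpow[of "2::real" 2] by simp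
  have lf: "ln (fact k :: real) = stirling_error k + (real k + 1/2) * ln (real k) - real k" for k
    by (simp add: stirling_error_def)
  have "ln (\<Prod>k=1..n. (4 * real k ^ 2) / (4 * real k ^ 2 - 1))
     = 2 * (real n * (2 * ln 2) + 2 * ln (fact n)) - (2 * ln (fact (2 * n)) + ln (2 * real n + 1))"
    unfolding prod by (simp add: ln_div ln_mult ln_realpow ln4)
  also have "\<dots> = 4 * stirling_error n - 2 * stirling_error (2 * n) + ln (real n) - ln 2 - ln (2 * real n + 1)"
    unfolding lf using assms by (simp add: ln_mult algebra_simps)
  also have "\<dots> = 4 * stirling_error n - 2 * stirling_error (2 * n) + ln (real n / (2 * (2 * real n + 1)))"
  proof -
    have "ln (2 * (2 * real n + 1)) = ln 2 + ln (2 * real n + 1)" by (rule ln_mult_pos) auto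
    moreover have "ln (real n / (2 * (2 * real n + 1))) = ln (real n) - ln (2 * (2 * real n + 1))"
      using assms by (subst ln_div) auto
    ultimately show ?thesis by linarith
  qed
  finally show ?thesis .
qed

text \<open>The limit A satisfies 4 A - 2 A + ln (1/4) = ln (pi / 2), and the rate follows by
  letting k tend to infinity in the Cauchy estimate. A rate is required because the mean deviation,
  of order sqrt n, has to be known up to a bounded error.\<close>

lemma stirling_error_limit:
  assumes "0 < n"
  shows "\<bar>stirling_error n - ln (2 * pi) / 2\<bar> \<le> 2 / real n"
proof -
  have "Cauchy stirling_error"
  proof (rule metric_CauchyI)
    fix e :: real assume e: "0 < e"
    obtain M where M: "4 / e < real M" using reals_Archimedean2 by blast
    then have M0: "0 < M" using e by (metis divide_pos_pos less_trans of_nat_0_less_iff zero_less_numeral)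
    have near: "\<bar>stirling_error k - stirling_error M\<bar> < e / 2" if "k \<ge> M" for k
    proof -
      have "\<bar>stirling_error k - stirling_error M\<bar> \<le> 2 * (1 / real M - 1 / real k)"
        using stirling_error_Cauchy[OF M0 that] .
      also have "\<dots> \<le> 2 / real M" by simp
      also have "\<dots> < e / 2" using M M0 e by (simp add: field_simps)
      finally show ?thesis .
    qed
    show "\<exists>M. \<forall>m\<ge>M. \<forall>n\<ge>M. dist (stirling_error m) (stirling_error n) < e"
    proof (intro exI allI impI)
      fix m n assume "m \<ge> M" "n \<ge> M"
      from near[OF this(1)] near[OF this(2)] show "dist (stirling_error m) (stirling_error n) < e"
        unfolding dist_real_def by linarith
    qed
  qed
  then obtain A where A: "stirling_error \<longlonglongrightarrow> A" using Cauchy_convergent convergent_def by blast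
  have A2: "(\<lambda>n. stirling_error (2 * n)) \<longlonglongrightarrow> A"
    using LIMSEQ_subseq_LIMSEQ[OF A, of "\<lambda>n. 2 * n"] by (simp add: strict_mono_def o_def)
  have l4: "(\<lambda>n. ln (real n / (2 * (2 * real n + 1)))) \<longlonglongrightarrow> ln (1 / 4)"
  proof (rule tendsto_ln)
    show "(\<lambda>n. real n / (2 * (2 * real n + 1))) \<longlonglongrightarrow> 1 / 4" by real_asymp
  qed simp
  have "(\<lambda>n. 4 * stirling_error n - 2 * stirling_error (2 * n) + ln (real n / (2 * (2 * real n + 1))))
     \<longlonglongrightarrow> 4 * A - 2 * A + ln (1 / 4)"
    by (intro tendsto_intros A A2 l4)
  moreover have "(\<lambda>n. 4 * stirling_error n - 2 * stirling_error (2 * n) + ln (real n / (2 * (2 * real n + 1))))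
     \<longlonglongrightarrow> ln (pi / 2)"
  proof (rule Lim_transform_eventually)
    show "(\<lambda>n. ln (\<Prod>k=1..n. (4 * real k ^ 2) / (4 * real k ^ 2 - 1))) \<longlonglongrightarrow> ln (pi / 2)"
      by (intro tendsto_ln wallis) simp
    show "\<forall>\<^sub>F n in sequentially. ln (\<Prod>k=1..n. (4 * real k ^ 2) / (4 * real k ^ 2 - 1))
       = 4 * stirling_error n - 2 * stirling_error (2 * n) + ln (real n / (2 * (2 * real n + 1)))"
      using eventually_gt_at_top[of 0] by eventually_elim (rule wallis_stirling)
  qed
  ultimately have "4 * A - 2 * A + ln (1 / 4) = ln (pi / 2)" by (rule LIMSEQ_unique)
  moreover have "ln (pi / 2) = ln (2 * pi) - ln 4" "ln (1 / 4 :: real) = - ln 4"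
  proof -
    have "ln (pi / 2) = ln ((2 * pi) / 4)" by simp
    then show "ln (pi / 2) = ln (2 * pi) - ln 4" by (subst (asm) ln_div) auto
    show "ln (1 / 4 :: real) = - ln 4" by (subst ln_div) auto
  qed
  ultimately have Aeq: "A = ln (2 * pi) / 2" by linarith
  have "(\<lambda>k. \<bar>stirling_error k - stirling_error n\<bar>) \<longlonglongrightarrow> \<bar>A - stirling_error n\<bar>"
    by (intro tendsto_intros A)
  moreover have "\<forall>\<^sub>F k in sequentially. \<bar>stirling_error k - stirling_error n\<bar> \<le> 2 / real n"
    using eventually_ge_at_top[of n]
  proof eventually_elim
    case (elim k)
    have "2 * (1 / real n - 1 / real k) \<le> 2 / real n" by simp
    with stirling_error_Cauchy[OF assms elim] show ?case by linarith
  qed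
  ultimately have "\<bar>A - stirling_error n\<bar> \<le> 2 / real n"
    by (rule tendsto_upperbound) simp
  then show ?thesis by (simp add: Aeq abs_minus_commute)
qed

text \<open>All powers and exponentials in Stirling's formula cancel at the mean N. What remains is
  the inverse root of the variance N (1 - 1/p); the factor 1 / sqrt (2 pi) is still hidden in the
  three errors.\<close>

lemma central_Bernstein:
  assumes p: "2 \<le> p" and N: "0 < N"
  shows "Bernstein (p * N) N (1 / real p) =
    exp (stirling_error (p * N) - stirling_error N - stirling_error ((p - 1) * N)) / sqrt (real N * (1 - 1 / real p))"
proof -
  define M where "M = (p - 1) * N"
  have M: "0 < M" "p * N = N + M" "p * N - N = M" using p N by (auto simp: M_def algebra_simps)
  have rM: "real M = (real p - 1) * real N" using p by (simp add: M_def of_nat_diff)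
  have ch: "real (p * N choose N) = fact (p * N) / (fact N * fact M)"
    using M by (subst binomial_fact) auto
  have p1: "0 < 1 - 1 / real p" "1 - 1 / real p = (real p - 1) / real p" using p by (auto simp: field_simps)
  let ?x = "real N * (1 - 1 / real p)"
  have x: "0 < ?x" using p1(1) N by simp
  have lf: "ln (fact k :: real) = stirling_error k + (real k + 1/2) * ln (real k) - real k" for k
    by (simp add: stirling_error_def)
  have Bpos: "0 < Bernstein (p * N) N (1 / real p)"
    using p by (intro Bernstein_pos) auto
  have lp: "ln (1 / real p) = - ln (real p)" "ln (1 - 1 / real p) = ln (real p - 1) - ln (real p)"
    "ln (real (p * N)) = ln (real p) + ln (real N)" "ln (real M) = ln (real p - 1) + ln (real N)"
    "ln ?x = ln (real N) + ln (real p - 1) - ln (real p)"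
    using p N unfolding p1(2) rM by (auto simp: ln_div ln_mult)
  have "ln (Bernstein (p * N) N (1 / real p)) = ln (fact (p * N)) - ln (fact N) - ln (fact M)
      + real N * ln (1 / real p) + real M * ln (1 - 1 / real p)"
    unfolding Bernstein_def M(3) ch using p p1(1) by (simp add: ln_mult ln_div ln_realpow)
  also have "\<dots> = (stirling_error (p * N) - stirling_error N - stirling_error M) - ln ?x / 2"
    unfolding lf lp by (simp add: rM algebra_simps add_divide_distrib diff_divide_distrib)
  also have "\<dots> = ln (exp (stirling_error (p * N) - stirling_error N - stirling_error M) / sqrt ?x)"
  proof -
    have "ln (exp E / sqrt y) = E - ln y / 2" if "0 < y" for E y :: real
      using that by (subst ln_div) (auto simp: ln_sqrt)
    from this[OF x] show ?thesis by simp
  qed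
  finally have "exp (ln (Bernstein (p * N) N (1 / real p))) =
     exp (ln (exp (stirling_error (p * N) - stirling_error N - stirling_error M) / sqrt ?x))"
    by (rule arg_cong)
  then show ?thesis using Bpos x unfolding M_def[symmetric] by simp
qed

lemma mean_deviation_asymptotics:
  assumes p: "2 \<le> p" and N: "6 \<le> N"
  shows "\<bar>binomial_exp (1 / real p) (p * N) (\<lambda>k. max 0 (real k - real N)) - sqrt (real N * (1 - 1 / real p) / (2 * pi))\<bar> \<le> 12"
proof -
  \<comment> \<open>Three Stirling errors with signs +, -, - leave -ln (2 pi) / 2 up to e, at most
    three times 2 / N. For N \<ge> 6 this is at most 1, so exp e - 1 is at most 2 |e| in absolute
    value.\<close>
  define e where "e = stirling_error (p * N) - stirling_error N - stirling_error ((p - 1) * N) + ln (2 * pi) / 2"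
  have e: "\<bar>e\<bar> \<le> 6 / real N"
  proof -
    have b: "2 / real k \<le> 2 / real N" if "N \<le> k" for k using that N by (intro divide_left_mono) auto
    have "N \<le> p * N" "N \<le> (p - 1) * N" using p by auto
    from b[OF this(1)] b[OF this(2)] show ?thesis
      using stirling_error_limit[of "p * N"] stirling_error_limit[of N] stirling_error_limit[of "(p - 1) * N"] p N
      unfolding e_def by auto
  qed
  have e1: "\<bar>e\<bar> \<le> 1"
  proof -
    have "6 / real N \<le> 1" using N by simp
    with e show ?thesis by linarith
  qed
  let ?x = "real N * (1 - 1 / real p)"
  have x: "0 < ?x" using p N by auto
  have xN: "?x \<le> real N" using N by (simp add: mult_left_le)
  have "binomial_exp (1 / real p) (p * N) (\<lambda>k. max 0 (real k - real N)) = (1 / real p) * (real (p * N) - real N) * Bernstein (p * N) N (1 / real p)"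
    using p by (intro de_Moivre_mean_deviation) auto
  also have "(1 / real p) * (real (p * N) - real N) = ?x"
    using p by (simp add: field_simps)
  also have "?x * Bernstein (p * N) N (1 / real p) = sqrt ?x * exp (e - ln (2 * pi) / 2)"
  proof -
    have "s * s * (E / s) = s * E" if "0 < s" for s E :: real using that by simp
    from this[of "sqrt ?x"] x have "?x * (E / sqrt ?x) = sqrt ?x * E" for E by simp
    moreover have "0 < N" using N by simp
    ultimately show ?thesis unfolding central_Bernstein[OF p \<open>0 < N\<close>] e_def by simp
  qed
  also have "\<dots> = sqrt (?x / (2 * pi)) * exp e"
  proof -
    have "exp (ln (2 * pi) / 2) = sqrt (2 * pi)" by (simp add: ln_sqrt[symmetric])
    then show ?thesis by (simp add: exp_diff real_sqrt_divide)
  qed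
  finally have "binomial_exp (1 / real p) (p * N) (\<lambda>k. max 0 (real k - real N)) - sqrt (?x / (2 * pi)) = sqrt (?x / (2 * pi)) * (exp e - 1)"
    by (simp add: algebra_simps)
  then have "\<bar>binomial_exp (1 / real p) (p * N) (\<lambda>k. max 0 (real k - real N)) - sqrt (?x / (2 * pi))\<bar> = sqrt (?x / (2 * pi)) * \<bar>exp e - 1\<bar>"
    using x by (simp add: abs_mult)
  also have "\<dots> \<le> sqrt (real N) * (2 * (6 / real N))"
  proof (intro mult_mono)
    have "?x / (2 * pi) \<le> ?x / 1" using x pi_gt3 by (intro divide_left_mono) auto
    then show "sqrt (?x / (2 * pi)) \<le> sqrt (real N)" using xN by simp
    have "\<bar>exp e - 1\<bar> \<le> 2 * \<bar>e\<bar>"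
    proof (cases "0 \<le> e")
      case True
      then have "exp e \<le> 1 + e + e\<^sup>2" using e1 by (intro exp_bound) auto
      moreover have "e\<^sup>2 \<le> e" using True e1 by (simp add: power2_eq_square mult_left_le)
      ultimately show ?thesis using True by simp
    next
      case False
      then have "exp e \<le> 1" by simp
      with False show ?thesis using exp_ge_add_one_self[of e] by linarith
    qed
    with e show "\<bar>exp e - 1\<bar> \<le> 2 * (6 / real N)" by linarith
  qed auto
  also have "\<dots> = 12 / sqrt (real N)" using N by (simp add: field_simps real_div_sqrt)
  also have "\<dots> \<le> 12" using N by (simp add: field_simps)
  finally show ?thesis .
qed

section \<open>The \<open>p\<close>-rank of a cokernel\<close>

lemma (in vectorspace) card_carrier_eq_power_dim:
  assumes "finite (carrier V)"
  shows "card (carrier V) = card (carrier K) ^ dim"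
proof -
  have "span (carrier V) = carrier V"
    using in_own_span[of "carrier V"] span_is_subset2[of "carrier V"] by auto
  then have "fin_dim" unfolding fin_dim_def using assms by blast
  then obtain A where A: "finite A" "basis A" using finite_basis_exists by blast
  then have AC: "A \<subseteq> carrier V" unfolding basis_def by blast
  have uniq: "\<forall>v. v \<in> carrier V \<longrightarrow> (\<exists>!a. a \<in> A \<rightarrow>\<^sub>E carrier K \<and> lincomb a A = v)"
    using basis_criterion[OF A(1) AC] A(2) by blast
  have "bij_betw (\<lambda>a. lincomb a A) (A \<rightarrow>\<^sub>E carrier K) (carrier V)"
  proof (rule bij_betw_imageI)
    have cl: "lincomb a A \<in> carrier V" if "a \<in> A \<rightarrow>\<^sub>E carrier K" for a
      using that AC by (intro lincomb_closed) auto
    show "inj_on (\<lambda>a. lincomb a A) (A \<rightarrow>\<^sub>E carrier K)"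
      using uniq cl unfolding inj_on_def by metis
    show "(\<lambda>a. lincomb a A) ` (A \<rightarrow>\<^sub>E carrier K) = carrier V"
      using uniq cl by blast
  qed
  then have "card (A \<rightarrow>\<^sub>E carrier K) = card (carrier V)" by (rule bij_betw_same_card)
  then show ?thesis using A by (simp add: card_PiE dim_basis)
qed

lemma (in comm_group) subgroup_powers: "subgroup ((\<lambda>x. x [^] (n::nat)) ` carrier G) G"
proof (rule subgroupI)
  show "(\<lambda>x. x [^] n) ` carrier G \<noteq> {}" by auto
next
  fix a assume "a \<in> (\<lambda>x. x [^] n) ` carrier G"
  then obtain x where x: "x \<in> carrier G" "a = x [^] n" by auto
  then have "inv a = (inv x) [^] n" by (simp add: nat_pow_inv)
  then show "inv a \<in> (\<lambda>x. x [^] n) ` carrier G" using x by auto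
next
  fix a b assume "a \<in> (\<lambda>x. x [^] n) ` carrier G" "b \<in> (\<lambda>x. x [^] n) ` carrier G"
  then obtain x y where x: "x \<in> carrier G" "a = x [^] n" "y \<in> carrier G" "b = y [^] n" by auto
  then have "a \<otimes> b = (x \<otimes> y) [^] n" by (simp add: nat_pow_distrib)
  then show "a \<otimes> b \<in> (\<lambda>x. x [^] n) ` carrier G" using x by auto
qed auto

lemma (in group) r_coset_eq_iff:
  assumes "subgroup H G" "a \<in> carrier G" "b \<in> carrier G"
  shows "H #> a = H #> b \<longleftrightarrow> a \<otimes> inv b \<in> H"
proof -
  have "H #> a = H #> b \<longleftrightarrow> a \<in> H #> b"
    using assms rcos_self repr_independence by metis
  then show ?thesis
    using subgroup.rcos_module[OF assms(1) is_group assms(3,2)] by simp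
qed

text \<open>In A/pA every p-th power is trivial, so exponents matter only modulo p; this makes the
  integer powers compatible with arithmetic in \<open>residue_ring\<close>.\<close>

lemma vectorspace_mod_p_module:
  assumes p: "prime p" and A: "comm_group A"
  shows "vectorspace (residue_ring (int p)) (mod_p_module p A)"
proof -
  define P where "P = (\<lambda>x. x [^]\<^bsub>A\<^esub> p) ` carrier A"
  define Q where "Q = A Mod P"
  define M where "M = mod_p_module p A"
  interpret A: comm_group A by (rule A)
  have sub: "subgroup P A" unfolding P_def by (rule A.subgroup_powers)
  interpret Q: comm_group Q unfolding Q_def by (rule A.abelian_FactGroup[OF sub])
  interpret N: normal P A by (rule A.subgroup_imp_normal[OF sub])
  have M: "carrier M = carrier Q" "zero M = \<one>\<^bsub>Q\<^esub>" "\<And>x y. add M x y = x \<otimes>\<^bsub>Q\<^esub> y"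
    "\<And>k x. module.smult M k x = x [^]\<^bsub>Q\<^esub> k"
    unfolding M_def mod_p_module_def Let_def Q_def P_def by simp_all
  have pow_p: "x [^]\<^bsub>Q\<^esub> int p = \<one>\<^bsub>Q\<^esub>" if xQ: "x \<in> carrier Q" for x
  proof -
    obtain a where a: "a \<in> carrier A" "x = P #>\<^bsub>A\<^esub> a"
      using xQ unfolding Q_def carrier_FactGroup by auto
    have "x [^]\<^bsub>Q\<^esub> int p = P #>\<^bsub>A\<^esub> (a [^]\<^bsub>A\<^esub> int p)"
      unfolding a(2) Q_def by (rule N.FactGroup_int_pow[OF a(1)])
    also have "a [^]\<^bsub>A\<^esub> int p \<in> P" unfolding P_def using a(1) by (auto simp: int_pow_int)
    then have "P #>\<^bsub>A\<^esub> (a [^]\<^bsub>A\<^esub> int p) = P"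
      using A.coset_join2[OF _ sub] a(1) by simp
    finally show ?thesis by (simp add: Q_def)
  qed
  have pow_mod: "x [^]\<^bsub>Q\<^esub> (k mod int p) = x [^]\<^bsub>Q\<^esub> k" if "x \<in> carrier Q" for x k
  proof -
    have "x [^]\<^bsub>Q\<^esub> k = x [^]\<^bsub>Q\<^esub> (int p * (k div int p) + k mod int p)" by simp
    also have "\<dots> = x [^]\<^bsub>Q\<^esub> (int p * (k div int p)) \<otimes>\<^bsub>Q\<^esub> x [^]\<^bsub>Q\<^esub> (k mod int p)"
      by (rule Q.int_pow_mult[OF that])
    also have "x [^]\<^bsub>Q\<^esub> (int p * (k div int p)) = (x [^]\<^bsub>Q\<^esub> int p) [^]\<^bsub>Q\<^esub> (k div int p)"
      using that by (simp add: Q.int_pow_pow)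
    also have "\<dots> = \<one>\<^bsub>Q\<^esub>" by (simp add: pow_p[OF that])
    finally show ?thesis using that by simp
  qed
  interpret R: residues_prime p "residue_ring (int p)" by unfold_locales (use p in auto)
  have field: "Ring.field (residue_ring (int p))" by (rule R.is_field)
  have ab: "abelian_group M"
  proof (rule abelian_groupI)
    show "\<exists>y\<in>carrier M. y \<oplus>\<^bsub>M\<^esub> x = \<zero>\<^bsub>M\<^esub>" if "x \<in> carrier M" for x
      using that Q.l_inv_ex by (auto simp: M)
  qed (simp_all add: M Q.m_ac)
  have "module (residue_ring (int p)) M"
  proof (rule Module.moduleI)
    show "cring (residue_ring (int p))" using field by (simp add: field.axioms(1) domain.axioms(1))
  qed (use ab in \<open>auto simp: M residue_ring_def pow_mod Q.int_pow_mult Q.int_pow_distrib Q.int_pow_pow mult.commute\<close>)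
  then show ?thesis unfolding M_def[symmetric] using field by (rule vectorspace.intro)
qed

lemma card_mod_p_eq_power_p_rank:
  assumes p: "prime p" and A: "comm_group A"
    and fin: "finite (carrier (A Mod ((\<lambda>x. x [^]\<^bsub>A\<^esub> p) ` carrier A)))"
  shows "card (carrier (A Mod ((\<lambda>x. x [^]\<^bsub>A\<^esub> p) ` carrier A))) = p ^ p_rank p A"
proof -
  interpret V: vectorspace "residue_ring (int p)" "mod_p_module p A"
    by (rule vectorspace_mod_p_module[OF p A])
  have c: "carrier (mod_p_module p A) = carrier (A Mod ((\<lambda>x. x [^]\<^bsub>A\<^esub> p) ` carrier A))"
    by (simp add: mod_p_module_def Let_def)
  have "card (carrier (mod_p_module p A)) = card (carrier (residue_ring (int p))) ^ p_rank p A"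
    unfolding p_rank_def by (rule V.card_carrier_eq_power_dim) (simp add: c fin)
  then show ?thesis by (simp add: c residue_ring_def)
qed

section \<open>Counting kernel, image and cokernel modulo \<open>p\<close>\<close>

lemma card_eq_image_times_fibre:
  assumes "finite S" "\<And>y. y \<in> S \<Longrightarrow> card {x \<in> S. F x = F y} = N"
  shows "card S = card (F ` S) * N"
proof -
  have "card S = (\<Sum>x\<in>S. 1)" by simp
  also have "\<dots> = (\<Sum>y\<in>F ` S. \<Sum>x\<in>{x \<in> S. F x = y}. 1)" by (rule sum.image_gen[OF assms(1)])
  also have "\<dots> = (\<Sum>y\<in>F ` S. N)" using assms(2) by (intro sum.cong) auto
  finally show ?thesis by simp
qed

text \<open>Lagrange's count for a map whose fibres are the cosets of W. It is applied to the matrix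
  modulo p, with its kernel, and to the projection onto A/pA, with the image of the matrix.\<close>

lemma card_fvec_eq_image_times_subspace:
  assumes I: "finite I" and p: "0 < p" and W: "fsubspace p I W"
    and F: "\<And>x y. x \<in> fvec p I \<Longrightarrow> y \<in> fvec p I \<Longrightarrow> F x = F y \<longleftrightarrow> (\<lambda>i. (x i - y i) mod int p) \<in> W"
  shows "p ^ card I = card (F ` fvec p I) * card W"
  unfolding card_fvec[OF I, symmetric]
proof (rule card_eq_image_times_fibre)
  fix y assume y: "y \<in> fvec p I"
  have "bij_betw (\<lambda>x i. (x i - y i) mod int p) {x \<in> fvec p I. F x = F y} W"
  proof (rule bij_betw_byWitness[where f' = "\<lambda>w i. (w i + y i) mod int p"])
    have dm: "((a - b) mod int p + b) mod int p = a mod int p" "((a + b) mod int p - b) mod int p = a mod int p" for a b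
      by (simp_all add: mod_simps)
    show "\<forall>x\<in>{x \<in> fvec p I. F x = F y}. (\<lambda>i. ((x i - y i) mod int p + y i) mod int p) = x"
      by (auto simp: dm fvec_mod)
    show "\<forall>w\<in>W. (\<lambda>i. ((w i + y i) mod int p - y i) mod int p) = w"
      using fsubspaceD(1)[OF W] by (auto simp: dm fvec_mod)
    show "(\<lambda>x i. (x i - y i) mod int p) ` {x \<in> fvec p I. F x = F y} \<subseteq> W"
      using F y by auto
    show "(\<lambda>w i. (w i + y i) mod int p) ` W \<subseteq> {x \<in> fvec p I. F x = F y}"
    proof (rule image_subsetI, rule CollectI, rule conjI)
      fix w assume w: "w \<in> W"
      then have wf: "w \<in> fvec p I" using fsubspaceD(1)[OF W] by auto
      show in1: "(\<lambda>i. (w i + y i) mod int p) \<in> fvec p I"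
        using fvec_lincomb[OF p wf y, of 1] by simp
      have "(\<lambda>i. ((w i + y i) mod int p - y i) mod int p) = w" using wf by (auto simp: dm fvec_mod)
      then show "F (\<lambda>i. (w i + y i) mod int p) = F y" using F[OF in1 y] w by simp
    qed
  qed
  then show "card {x \<in> fvec p I. F x = F y} = card W" by (rule bij_betw_same_card)
qed (use I in simp)

definition fkernel :: "nat \<Rightarrow> 'a set \<Rightarrow> ('a \<Rightarrow> 'a \<Rightarrow> int) \<Rightarrow> ('a \<Rightarrow> int) set" where
  "fkernel p I M = {z \<in> fvec p I. \<forall>i\<in>I. int p dvd (\<Sum>j\<in>I. M i j * z j)}"

definition fimage :: "nat \<Rightarrow> 'a set \<Rightarrow> ('a \<Rightarrow> 'a \<Rightarrow> int) \<Rightarrow> ('a \<Rightarrow> int) set" where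
  "fimage p I M = {x \<in> fvec p I. \<exists>z. \<forall>i\<in>I. int p dvd x i - (\<Sum>j\<in>I. M i j * z j)}"

lemma sum_mult_lincomb_mod:
  "(\<Sum>j\<in>I. a j * ((x j + k * y j) mod int p)) mod int p = ((\<Sum>j\<in>I. a j * x j) + k * (\<Sum>j\<in>I. a j * y j)) mod int p"
proof -
  have "(\<Sum>j\<in>I. a j * ((x j + k * y j) mod int p)) mod int p = (\<Sum>j\<in>I. (a j * ((x j + k * y j) mod int p)) mod int p) mod int p"
    by (simp only: mod_sum_eq)
  also have "\<dots> = (\<Sum>j\<in>I. (a j * (x j + k * y j)) mod int p) mod int p"
    by (simp only: mod_mult_right_eq)
  also have "\<dots> = (\<Sum>j\<in>I. a j * (x j + k * y j)) mod int p"
    by (simp only: mod_sum_eq)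
  also have "(\<Sum>j\<in>I. a j * (x j + k * y j)) = (\<Sum>j\<in>I. a j * x j) + k * (\<Sum>j\<in>I. a j * y j)"
    by (simp add: distrib_left sum.distrib sum_distrib_left mult_ac)
  finally show ?thesis .
qed

lemma fsubspace_fkernel:
  assumes "0 < p"
  shows "fsubspace p I (fkernel p I M)"
  unfolding fsubspace_def
proof (intro conjI ballI allI)
  have "(\<lambda>_. 0) \<in> fkernel p I M" using assms by (simp add: fkernel_def)
  then show "fkernel p I M \<noteq> {}" by blast
  fix x y k assume x: "x \<in> fkernel p I M" and y: "y \<in> fkernel p I M"
  show "(\<lambda>i. (x i + k * y i) mod int p) \<in> fkernel p I M"
    unfolding fkernel_def
  proof (intro CollectI conjI ballI)
    show "(\<lambda>i. (x i + k * y i) mod int p) \<in> fvec p I"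
      using x y fvec_lincomb[OF assms, of x I y k] by (simp add: fkernel_def)
    fix i assume "i \<in> I"
    then have "int p dvd (\<Sum>j\<in>I. M i j * x j) + k * (\<Sum>j\<in>I. M i j * y j)"
      using x y by (auto simp: fkernel_def)
    then show "int p dvd (\<Sum>j\<in>I. M i j * ((x j + k * y j) mod int p))"
      by (simp add: dvd_eq_mod_eq_0 sum_mult_lincomb_mod)
  qed
qed (auto simp: fkernel_def)

lemma fsubspace_fimage:
  assumes "0 < p"
  shows "fsubspace p I (fimage p I M)"
  unfolding fsubspace_def
proof (intro conjI ballI allI)
  have "(\<lambda>_. 0) \<in> fimage p I M"
    using assms by (auto simp: fimage_def intro!: exI[of _ "\<lambda>_. 0"])
  then show "fimage p I M \<noteq> {}" by blast
  fix x y k assume x: "x \<in> fimage p I M" and y: "y \<in> fimage p I M"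
  obtain z where z: "\<And>i. i \<in> I \<Longrightarrow> int p dvd x i - (\<Sum>j\<in>I. M i j * z j)" using x by (auto simp: fimage_def)
  obtain w where w: "\<And>i. i \<in> I \<Longrightarrow> int p dvd y i - (\<Sum>j\<in>I. M i j * w j)" using y by (auto simp: fimage_def)
  have "int p dvd (x i + k * y i) mod int p - (\<Sum>j\<in>I. M i j * (z j + k * w j))" if i: "i \<in> I" for i
  proof -
    have "int p dvd (x i - (\<Sum>j\<in>I. M i j * z j)) + k * (y i - (\<Sum>j\<in>I. M i j * w j))"
      using z[OF i] w[OF i] by auto
    also have "\<dots> = (x i + k * y i) - (\<Sum>j\<in>I. M i j * (z j + k * w j))"
      by (simp add: algebra_simps sum.distrib sum_distrib_left)
    finally show ?thesis by (simp add: dvd_eq_mod_eq_0 mod_diff_left_eq)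
  qed
  then show "(\<lambda>i. (x i + k * y i) mod int p) \<in> fimage p I M"
    using x y fvec_lincomb[OF assms, of x I y k] unfolding fimage_def
    by (intro CollectI conjI exI[of _ "\<lambda>j. z j + k * w j"]) auto
qed (auto simp: fimage_def)

lemma card_fimage_fkernel:
  assumes I: "finite I" and p: "0 < p"
  shows "p ^ card I = card (fimage p I M) * card (fkernel p I M)"
proof -
  let ?h = "\<lambda>z i. if i \<in> I then (\<Sum>j\<in>I. M i j * z j) mod int p else 0"
  have "p ^ card I = card (?h ` fvec p I) * card (fkernel p I M)"
  proof (rule card_fvec_eq_image_times_subspace[OF I p fsubspace_fkernel[OF p]])
    fix x y :: "'a \<Rightarrow> int" assume x: "x \<in> fvec p I" and y: "y \<in> fvec p I"
    let ?d = "\<lambda>i. (x i - y i) mod int p"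
    have d: "?d \<in> fvec p I" using fvec_lincomb[OF p x y, of "-1"] by simp
    have "int p dvd (\<Sum>j\<in>I. M i j * ?d j) \<longleftrightarrow>
        (\<Sum>j\<in>I. M i j * x j) mod int p = (\<Sum>j\<in>I. M i j * y j) mod int p" for i
    proof -
      have "(\<Sum>j\<in>I. M i j * ?d j) mod int p = ((\<Sum>j\<in>I. M i j * x j) - (\<Sum>j\<in>I. M i j * y j)) mod int p"
        using sum_mult_lincomb_mod[of "M i" x "-1" y p I] by simp
      then have "int p dvd (\<Sum>j\<in>I. M i j * ?d j) \<longleftrightarrow> int p dvd (\<Sum>j\<in>I. M i j * x j) - (\<Sum>j\<in>I. M i j * y j)"
        by (simp only: dvd_eq_mod_eq_0)
      then show ?thesis by (simp only: mod_eq_dvd_iff)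
    qed
    then show "?h x = ?h y \<longleftrightarrow> ?d \<in> fkernel p I M"
      using d by (auto simp: fkernel_def fun_eq_iff)
  qed
  also have "?h ` fvec p I = fimage p I M"
  proof
    show "?h ` fvec p I \<subseteq> fimage p I M"
    proof
      fix x assume "x \<in> ?h ` fvec p I"
      then obtain z where z: "x = ?h z" by auto
      have "int p dvd x i - (\<Sum>j\<in>I. M i j * z j)" if "i \<in> I" for i
        using that by (simp add: z mod_eq_dvd_iff[symmetric])
      moreover have "x \<in> fvec p I" using p by (auto simp: z fvec_iff)
      ultimately show "x \<in> fimage p I M" by (auto simp: fimage_def)
    qed
    show "fimage p I M \<subseteq> ?h ` fvec p I"
    proof
      fix x assume x: "x \<in> fimage p I M"
      then obtain z where z: "\<And>i. i \<in> I \<Longrightarrow> int p dvd x i - (\<Sum>j\<in>I. M i j * z j)" by (auto simp: fimage_def)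
      let ?z = "\<lambda>i. if i \<in> I then z i mod int p else 0"
      have xf: "x \<in> fvec p I" using x by (simp add: fimage_def)
      have "?h ?z i = x i" for i
      proof (cases "i \<in> I")
        case True
        have "(\<Sum>j\<in>I. M i j * ?z j) mod int p = (\<Sum>j\<in>I. M i j * ((0 + 1 * z j) mod int p)) mod int p"
          by (intro arg_cong[of _ _ "\<lambda>t. t mod int p"] sum.cong) auto
        also have "\<dots> = (\<Sum>j\<in>I. M i j * z j) mod int p"
          by (subst sum_mult_lincomb_mod) simp
        also have "\<dots> = x i mod int p" using z[OF True] by (simp add: mod_eq_dvd_iff dvd_diff_commute)
        also have "\<dots> = x i" by (rule fvec_mod[OF xf])
        finally show ?thesis using True by simp
      next
        case False then show ?thesis using xf by (auto simp: fvec_iff)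
      qed
      then have "x = ?h ?z" by (intro ext) (simp only:)
      moreover have "?z \<in> fvec p I" using p by (auto simp: fvec_iff)
      ultimately show "x \<in> ?h ` fvec p I" by (rule image_eqI)
    qed
  qed
  finally show ?thesis .
qed

text \<open>A surjection \<open>f\<close> from \<open>\<int>\<^bsup>I\<^esup>\<close> onto \<open>A\<close> whose kernel is the column lattice of \<open>M\<close>
  identifies \<open>A/pA\<close> with the cokernel of \<open>M\<close> modulo \<open>p\<close>.\<close>

lemma card_mod_p_presentation:
  fixes A (structure)
  assumes I: "finite I" and p: "0 < p" and A: "comm_group A"
    and f_in: "\<And>x::'i \<Rightarrow> int. f x \<in> carrier A"
    and f_surj: "\<And>a. a \<in> carrier A \<Longrightarrow> \<exists>x. f x = a"
    and f_add: "\<And>x y. f (\<lambda>i. x i + y i) = f x \<otimes> f y"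
    and f_eq: "\<And>x y. f x = f y \<longleftrightarrow> (\<exists>z. \<forall>i\<in>I. x i - y i = (\<Sum>j\<in>I. M i j * z j))"
  shows "finite (carrier (A Mod ((\<lambda>x. x [^] p) ` carrier A)))"
    and "card (carrier (A Mod ((\<lambda>x. x [^] p) ` carrier A))) = card (fkernel p I M)"
proof -
  interpret A: comm_group A by (rule A)
  define P where "P = (\<lambda>x. x [^] p) ` carrier A"
  have sub: "subgroup P A" unfolding P_def by (rule A.subgroup_powers)
  have f0: "f (\<lambda>_. 0) = \<one>"
  proof -
    have "f (\<lambda>_. 0) \<otimes> f (\<lambda>_. 0) = f (\<lambda>_. 0)" using f_add[of "\<lambda>_. 0" "\<lambda>_. 0"] by simp
    then show ?thesis using f_in A.r_cancel_one' by metis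
  qed
  have f_pow: "f w [^] n = f (\<lambda>i. int n * w i)" for w and n :: nat
  proof (induction n)
    case (Suc n)
    then show ?case using f_add[of "\<lambda>i. int n * w i" w] by (simp add: algebra_simps)
  qed (simp add: f0)
  have coset: "P #> f x = P #> f y \<longleftrightarrow> (\<exists>z. \<forall>i\<in>I. int p dvd (x i - y i) - (\<Sum>j\<in>I. M i j * z j))" for x y
  proof -
    have "P #> f x = P #> f y \<longleftrightarrow> f x \<otimes> inv (f y) \<in> P"
      by (rule A.r_coset_eq_iff[OF sub f_in f_in])
    also have "\<dots> \<longleftrightarrow> (\<exists>a\<in>carrier A. f x \<otimes> inv (f y) = a [^] p)" unfolding P_def by auto
    also have "\<dots> \<longleftrightarrow> (\<exists>w. f x \<otimes> inv (f y) = f w [^] p)" using f_in f_surj by metis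
    also have "\<dots> \<longleftrightarrow> (\<exists>w. f x = f (\<lambda>i. int p * w i + y i))"
      unfolding f_pow f_add using f_in by (metis A.inv_solve_right)
    also have "\<dots> \<longleftrightarrow> (\<exists>w z. \<forall>i\<in>I. x i - (int p * w i + y i) = (\<Sum>j\<in>I. M i j * z j))"
      unfolding f_eq ..
    also have "\<dots> \<longleftrightarrow> (\<exists>z. \<forall>i\<in>I. int p dvd (x i - y i) - (\<Sum>j\<in>I. M i j * z j))"
    proof
      assume "\<exists>w z. \<forall>i\<in>I. x i - (int p * w i + y i) = (\<Sum>j\<in>I. M i j * z j)"
      then obtain w z where wz: "\<And>i. i \<in> I \<Longrightarrow> x i - (int p * w i + y i) = (\<Sum>j\<in>I. M i j * z j)" by blast
      have "int p dvd (x i - y i) - (\<Sum>j\<in>I. M i j * z j)" if "i \<in> I" for i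
        unfolding wz[OF that, symmetric] by simp
      then show "\<exists>z. \<forall>i\<in>I. int p dvd (x i - y i) - (\<Sum>j\<in>I. M i j * z j)" by blast
    next
      assume "\<exists>z. \<forall>i\<in>I. int p dvd (x i - y i) - (\<Sum>j\<in>I. M i j * z j)"
      then obtain z where z: "\<And>i. i \<in> I \<Longrightarrow> int p dvd (x i - y i) - (\<Sum>j\<in>I. M i j * z j)" by blast
      then have "\<exists>w. \<forall>i\<in>I. (x i - y i) - (\<Sum>j\<in>I. M i j * z j) = int p * w i"
        unfolding dvd_def by metis
      then obtain w where w: "\<And>i. i \<in> I \<Longrightarrow> (x i - y i) - (\<Sum>j\<in>I. M i j * z j) = int p * w i" by blast
      have "x i - (int p * w i + y i) = (\<Sum>j\<in>I. M i j * z j)" if "i \<in> I" for i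
        unfolding w[OF that, symmetric] by simp
      then show "\<exists>w z. \<forall>i\<in>I. x i - (int p * w i + y i) = (\<Sum>j\<in>I. M i j * z j)" by blast
    qed
    finally show ?thesis .
  qed
  have img: "carrier (A Mod P) = (\<lambda>x. P #> f x) ` fvec p I"
  proof
    show "(\<lambda>x. P #> f x) ` fvec p I \<subseteq> carrier (A Mod P)"
      using f_in by (auto simp: carrier_FactGroup)
    show "carrier (A Mod P) \<subseteq> (\<lambda>x. P #> f x) ` fvec p I"
    proof
      fix c assume "c \<in> carrier (A Mod P)"
      then obtain x where x: "c = P #> f x" using f_surj by (auto simp: carrier_FactGroup)
      let ?x = "\<lambda>i. if i \<in> I then x i mod int p else 0"
      have "P #> f x = P #> f ?x"
        unfolding coset by (rule exI[of _ "\<lambda>_. 0"]) (auto simp: minus_mod_eq_mult_div)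
      moreover have "?x \<in> fvec p I" using p by (auto simp: fvec_iff)
      ultimately show "c \<in> (\<lambda>x. P #> f x) ` fvec p I" using x by blast
    qed
  qed
  show "finite (carrier (A Mod ((\<lambda>x. x [^] p) ` carrier A)))"
    unfolding P_def[symmetric] img using I by simp
  have "p ^ card I = card ((\<lambda>x. P #> f x) ` fvec p I) * card (fimage p I M)"
  proof (rule card_fvec_eq_image_times_subspace[OF I p fsubspace_fimage[OF p]])
    fix x y :: "'i \<Rightarrow> int" assume x: "x \<in> fvec p I" and y: "y \<in> fvec p I"
    have d: "(\<lambda>i. (x i - y i) mod int p) \<in> fvec p I" using fvec_lincomb[OF p x y, of "-1"] by simp
    have "int p dvd (x i - y i) mod int p - c \<longleftrightarrow> int p dvd (x i - y i) - c" for i c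
      by (simp add: dvd_eq_mod_eq_0 mod_diff_left_eq)
    then show "P #> f x = P #> f y \<longleftrightarrow> (\<lambda>i. (x i - y i) mod int p) \<in> fimage p I M"
      unfolding coset fimage_def using d by simp
  qed
  \<comment> \<open>Two factorisations of p^|I| are compared: cokernel times image and image times
    kernel. Cancelling the image replaces the cokernel by the kernel.\<close>
  also have "p ^ card I = card (fimage p I M) * card (fkernel p I M)"
    by (rule card_fimage_fkernel[OF I p])
  finally show "card (carrier (A Mod ((\<lambda>x. x [^] p) ` carrier A))) = card (fkernel p I M)"
    unfolding P_def[symmetric] img
    using fsubspace_card_pos[OF I fsubspace_fimage[OF p], of M] by simp
qed

section \<open>The sandpile group modulo \<open>p\<close>\<close>

lemma comm_group_product_integer: "comm_group (product_group W (\<lambda>_. integer_group))"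
proof (rule group.group_comm_groupI)
  show "Group.group (product_group W (\<lambda>_. integer_group))" by simp
  show "x \<otimes>\<^bsub>product_group W (\<lambda>_. integer_group)\<^esub> y = y \<otimes>\<^bsub>product_group W (\<lambda>_. integer_group)\<^esub> x" for x y
    by (auto simp: fun_eq_iff restrict_def)
qed

lemma lattice_image_iff:
  "f \<in> lattice_image W M \<longleftrightarrow> f \<in> extensional W \<and> (\<exists>x. \<forall>u\<in>W. f u = (\<Sum>v\<in>W. M u v * x v))"
proof
  assume "f \<in> lattice_image W M"
  then show "f \<in> extensional W \<and> (\<exists>x. \<forall>u\<in>W. f u = (\<Sum>v\<in>W. M u v * x v))"
    unfolding lattice_image_def by auto
next
  assume f: "f \<in> extensional W \<and> (\<exists>x. \<forall>u\<in>W. f u = (\<Sum>v\<in>W. M u v * x v))"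
  then obtain x where x: "\<And>u. u \<in> W \<Longrightarrow> f u = (\<Sum>v\<in>W. M u v * x v)" by blast
  have "f = (\<lambda>u\<in>W. \<Sum>v\<in>W. M u v * restrict x W v)"
    by (rule extensionalityI[of _ W]) (use f x in auto)
  moreover have "restrict x W \<in> carrier (product_group W (\<lambda>_. integer_group))" by simp
  ultimately show "f \<in> lattice_image W M" unfolding lattice_image_def by (rule image_eqI)
qed

lemma subgroup_lattice_image: "subgroup (lattice_image W M) (product_group W (\<lambda>_. integer_group))"
proof -
  interpret Z: comm_group "product_group W (\<lambda>_. integer_group)" by (rule comm_group_product_integer)
  show ?thesis
  proof (rule Z.subgroupI)
    show "lattice_image W M \<subseteq> carrier (product_group W (\<lambda>_. integer_group))"
      by (auto simp: lattice_image_iff PiE_def)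
    have "(\<lambda>u\<in>W. 0) \<in> lattice_image W M"
      unfolding lattice_image_iff by (auto intro!: exI[of _ "\<lambda>_. 0"])
    then show "lattice_image W M \<noteq> {}" by blast
  next
    fix a assume a: "a \<in> lattice_image W M"
    then obtain x where x: "\<And>u. u \<in> W \<Longrightarrow> a u = (\<Sum>v\<in>W. M u v * x v)" "a \<in> extensional W"
      by (auto simp: lattice_image_iff)
    have "a \<in> (\<Pi>\<^sub>E i\<in>W. carrier integer_group)" using x(2) by (auto simp: PiE_def)
    then have inv: "inv\<^bsub>product_group W (\<lambda>_. integer_group)\<^esub> a = (\<lambda>i\<in>W. - a i)"
      by (subst inv_product_group) auto
    show "inv\<^bsub>product_group W (\<lambda>_. integer_group)\<^esub> a \<in> lattice_image W M"
      unfolding inv lattice_image_iff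
      by (auto intro!: exI[of _ "\<lambda>v. - x v"] simp: x sum_negf)
  next
    fix a b assume a: "a \<in> lattice_image W M" and b: "b \<in> lattice_image W M"
    then obtain x y where x: "\<And>u. u \<in> W \<Longrightarrow> a u = (\<Sum>v\<in>W. M u v * x v)"
      and y: "\<And>u. u \<in> W \<Longrightarrow> b u = (\<Sum>v\<in>W. M u v * y v)"
      by (metis lattice_image_iff)
    show "a \<otimes>\<^bsub>product_group W (\<lambda>_. integer_group)\<^esub> b \<in> lattice_image W M"
      unfolding lattice_image_iff
      by (auto intro!: exI[of _ "\<lambda>v. x v + y v"] simp: x y distrib_left sum.distrib)
  qed
qed

lemma comm_group_sum_group:
  assumes "\<And>i. i \<in> I \<Longrightarrow> comm_group (G i)"
  shows "comm_group (sum_group I G)"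
proof (rule group.group_comm_groupI)
  have g: "Group.group (G i)" if "i \<in> I" for i using assms[OF that] by (rule comm_group.axioms(2))
  then show "Group.group (sum_group I G)" by simp
  fix x y assume "x \<in> carrier (sum_group I G)" "y \<in> carrier (sum_group I G)"
  then have xy: "x i \<in> carrier (G i)" "y i \<in> carrier (G i)" if "i \<in> I" for i
    using that g by (auto simp: carrier_sum_group)
  have "x i \<otimes>\<^bsub>G i\<^esub> y i = y i \<otimes>\<^bsub>G i\<^esub> x i" if i: "i \<in> I" for i
    by (rule comm_monoid.m_comm[OF comm_group.axioms(1)[OF assms[OF i]] xy(1)[OF i] xy(2)[OF i]])
  then show "x \<otimes>\<^bsub>sum_group I G\<^esub> y = y \<otimes>\<^bsub>sum_group I G\<^esub> x"
    by (auto intro!: restrict_ext)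
qed

text \<open>A direct sum of cokernels is the cokernel of the block-diagonal matrix; the presenting
  map f sends an integer vector to the tuple of cosets of its restrictions.\<close>

lemma power_p_rank_sum_cokernels:
  fixes Ic :: "'c \<Rightarrow> 'i set" and M :: "'i \<Rightarrow> 'i \<Rightarrow> int" and Mc :: "'c \<Rightarrow> 'i \<Rightarrow> 'i \<Rightarrow> int"
  assumes p: "prime p" and CC: "finite CC" and fin: "\<And>c. c \<in> CC \<Longrightarrow> finite (Ic c)"
    and disj: "\<And>c d i. c \<in> CC \<Longrightarrow> d \<in> CC \<Longrightarrow> i \<in> Ic c \<Longrightarrow> i \<in> Ic d \<Longrightarrow> c = d"
    and M: "\<And>c i j. c \<in> CC \<Longrightarrow> i \<in> Ic c \<Longrightarrow> j \<in> Ic c \<Longrightarrow> M i j = Mc c i j"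
    and M0: "\<And>c d i j. c \<in> CC \<Longrightarrow> d \<in> CC \<Longrightarrow> c \<noteq> d \<Longrightarrow> i \<in> Ic c \<Longrightarrow> j \<in> Ic d \<Longrightarrow> M i j = 0"
  shows "p ^ p_rank p (sum_group CC (\<lambda>c. product_group (Ic c) (\<lambda>_. integer_group) Mod lattice_image (Ic c) (Mc c)))
    = card (fkernel p (\<Union>c\<in>CC. Ic c) M)"
proof -
  define Z where "Z = (\<lambda>c. product_group (Ic c) (\<lambda>_::'i. integer_group))"
  define L where "L = (\<lambda>c. lattice_image (Ic c) (Mc c))"
  define A where "A = sum_group CC (\<lambda>c. Z c Mod L c)"
  define I where "I = (\<Union>c\<in>CC. Ic c)"
  have finI: "finite I" unfolding I_def using CC fin by blast
  have Zc: "comm_group (Z c)" for c unfolding Z_def by (rule comm_group_product_integer)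
  have Zg: "Group.group (Z c)" for c using Zc by (rule comm_group.axioms(2))
  have Ls: "subgroup (L c) (Z c)" for c unfolding L_def Z_def by (rule subgroup_lattice_image)
  have Ln: "L c \<lhd> Z c" for c by (rule comm_group.subgroup_imp_normal[OF Zc Ls])
  have Qc: "comm_group (Z c Mod L c)" for c by (rule comm_group.abelian_FactGroup[OF Zc Ls])
  have Qg: "Group.group (Z c Mod L c)" for c using Qc by (rule comm_group.axioms(2))
  have Ac: "comm_group A" unfolding A_def by (rule comm_group_sum_group[OF Qc])
  have carrA: "carrier A = (\<Pi>\<^sub>E c\<in>CC. carrier (Z c Mod L c))"
    unfolding A_def using CC by (subst carrier_sum_group[OF Qg]) auto
  have rZ: "restrict x (Ic c) \<in> carrier (Z c)" for x :: "'i \<Rightarrow> int" and c by (simp add: Z_def)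
  define f where "f = (\<lambda>x. \<lambda>c\<in>CC. L c #>\<^bsub>Z c\<^esub> restrict x (Ic c))"
  have f_in: "f x \<in> carrier A" for x
    unfolding carrA f_def using rZ by (auto simp: carrier_FactGroup)
  have f_surj: "\<exists>x. f x = a" if a: "a \<in> carrier A" for a
  proof -
    have "\<exists>g. g \<in> carrier (Z c) \<and> a c = L c #>\<^bsub>Z c\<^esub> g" if "c \<in> CC" for c
      using a that unfolding carrA by (auto simp: carrier_FactGroup PiE_iff)
    then obtain g where g: "\<And>c. c \<in> CC \<Longrightarrow> g c \<in> carrier (Z c)" "\<And>c. c \<in> CC \<Longrightarrow> a c = L c #>\<^bsub>Z c\<^esub> g c"
      by metis
    \<comment> \<open>Representatives chosen block by block are glued together; the blocks are
      disjoint, so the choice operator recovers the block of each index.\<close>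
    define x where "x = (\<lambda>i. g (SOME c. c \<in> CC \<and> i \<in> Ic c) i)"
    have xg: "restrict x (Ic c) = g c" if c: "c \<in> CC" for c
    proof (rule extensionalityI[of _ "Ic c"])
      show "g c \<in> extensional (Ic c)" using g(1)[OF c] by (auto simp: Z_def PiE_def)
      fix i assume i: "i \<in> Ic c"
      have "(SOME c. c \<in> CC \<and> i \<in> Ic c) = c"
        using c i disj by (intro some_equality) blast+
      then show "restrict x (Ic c) i = g c i" using i by (simp add: x_def)
    qed simp
    have "f x = a"
    proof (rule extensionalityI[of _ CC])
      show "a \<in> extensional CC" using a unfolding carrA by (auto simp: PiE_def)
    qed (auto simp: f_def xg g(2))
    then show ?thesis by blast
  qed
  have f_add: "f (\<lambda>i. x i + y i) = f x \<otimes>\<^bsub>A\<^esub> f y" for x y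
  proof -
    have "L c #>\<^bsub>Z c\<^esub> restrict (\<lambda>i. x i + y i) (Ic c)
       = (L c #>\<^bsub>Z c\<^esub> restrict x (Ic c)) \<otimes>\<^bsub>Z c Mod L c\<^esub> (L c #>\<^bsub>Z c\<^esub> restrict y (Ic c))" for c
    proof -
      have "restrict x (Ic c) \<otimes>\<^bsub>Z c\<^esub> restrict y (Ic c) = restrict (\<lambda>i. x i + y i) (Ic c)"
        by (auto simp: Z_def restrict_def)
      then show ?thesis using normal.rcos_sum[OF Ln rZ rZ] by simp
    qed
    then show ?thesis unfolding A_def f_def by (auto intro!: restrict_ext)
  qed
  have block: "(\<Sum>j\<in>I. M i j * z j) = (\<Sum>j\<in>Ic c. Mc c i j * z j)" if c: "c \<in> CC" and i: "i \<in> Ic c" for c i z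
  proof (rule sum.mono_neutral_cong_right)
    show "Ic c \<subseteq> I" using c by (auto simp: I_def)
    show "\<forall>j\<in>I - Ic c. M i j * z j = 0"
      using c i M0 unfolding I_def by fastforce
  qed (use finI c i M in auto)
  have f_eq: "f x = f y \<longleftrightarrow> (\<exists>z. \<forall>i\<in>I. x i - y i = (\<Sum>j\<in>I. M i j * z j))" for x y
  proof -
    have one: "L c #>\<^bsub>Z c\<^esub> restrict x (Ic c) = L c #>\<^bsub>Z c\<^esub> restrict y (Ic c)
       \<longleftrightarrow> (\<exists>z. \<forall>i\<in>Ic c. x i - y i = (\<Sum>j\<in>Ic c. Mc c i j * z j))" for c
    proof -
      have "restrict x (Ic c) \<otimes>\<^bsub>Z c\<^esub> inv\<^bsub>Z c\<^esub> restrict y (Ic c) = restrict (\<lambda>i. x i - y i) (Ic c)"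
        unfolding Z_def by (subst inv_product_group) (auto simp: restrict_def)
      then show ?thesis
        using group.r_coset_eq_iff[OF Zg Ls rZ rZ] by (simp add: L_def lattice_image_iff)
    qed
    have "f x = f y \<longleftrightarrow> (\<forall>c\<in>CC. L c #>\<^bsub>Z c\<^esub> restrict x (Ic c) = L c #>\<^bsub>Z c\<^esub> restrict y (Ic c))"
    proof
      assume eq: "f x = f y"
      show "\<forall>c\<in>CC. L c #>\<^bsub>Z c\<^esub> restrict x (Ic c) = L c #>\<^bsub>Z c\<^esub> restrict y (Ic c)"
      proof
        fix c assume "c \<in> CC"
        then show "L c #>\<^bsub>Z c\<^esub> restrict x (Ic c) = L c #>\<^bsub>Z c\<^esub> restrict y (Ic c)"
          using fun_cong[OF eq, of c] by (simp add: f_def)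
      qed
    qed (auto simp: f_def intro!: restrict_ext)
    also have "\<dots> \<longleftrightarrow> (\<forall>c\<in>CC. \<exists>z. \<forall>i\<in>Ic c. x i - y i = (\<Sum>j\<in>Ic c. Mc c i j * z j))"
      by (simp add: one)
    also have "\<dots> \<longleftrightarrow> (\<exists>z. \<forall>c\<in>CC. \<forall>i\<in>Ic c. x i - y i = (\<Sum>j\<in>Ic c. Mc c i j * z j))"
    proof
      assume "\<forall>c\<in>CC. \<exists>z. \<forall>i\<in>Ic c. x i - y i = (\<Sum>j\<in>Ic c. Mc c i j * z j)"
      then obtain z where z: "\<And>c i. c \<in> CC \<Longrightarrow> i \<in> Ic c \<Longrightarrow> x i - y i = (\<Sum>j\<in>Ic c. Mc c i j * z c j)"
        by metis
      define w where "w = (\<lambda>i. z (SOME c. c \<in> CC \<and> i \<in> Ic c) i)"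
      have w: "w j = z c j" if "c \<in> CC" "j \<in> Ic c" for c j
      proof -
        have "(SOME c. c \<in> CC \<and> j \<in> Ic c) = c"
          using that disj by (intro some_equality) blast+
        then show ?thesis by (simp add: w_def)
      qed
      have "x i - y i = (\<Sum>j\<in>Ic c. Mc c i j * w j)" if "c \<in> CC" "i \<in> Ic c" for c i
        unfolding z[OF that] by (rule sum.cong[OF refl]) (simp add: w[OF that(1)])
      then show "\<exists>z. \<forall>c\<in>CC. \<forall>i\<in>Ic c. x i - y i = (\<Sum>j\<in>Ic c. Mc c i j * z j)" by blast
    qed blast
    also have "\<dots> \<longleftrightarrow> (\<exists>z. \<forall>i\<in>I. x i - y i = (\<Sum>j\<in>I. M i j * z j))"
      unfolding I_def[symmetric] by (intro ex_cong1) (auto simp: I_def block[unfolded I_def])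
    finally show ?thesis .
  qed
  have p0: "0 < p" using p prime_gt_0_nat by blast
  note pres = card_mod_p_presentation[OF finI p0 Ac f_in f_surj f_add f_eq]
  show ?thesis
    using card_mod_p_eq_power_p_rank[OF p Ac pres(1)] pres(2)
    unfolding A_def Z_def L_def I_def by simp
qed

section \<open>Components and the reduced Laplacian of a finite graph\<close>

locale finite_simple_graph =
  fixes V :: "'a set" and E :: "'a set set"
  assumes finite_V: "finite V" and edges: "\<And>e. e \<in> E \<Longrightarrow> \<exists>u v. e = {u, v} \<and> u \<noteq> v \<and> u \<in> V \<and> v \<in> V"
begin

definition conn :: "'a rel" where
  "conn = (adjacency_rel (V, E))\<^sup>* \<inter> V \<times> V"

lemma equiv_conn: "equiv V conn"
proof (rule equivI)
  show "conn \<subseteq> V \<times> V" by (auto simp: conn_def)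
  show "refl_on V conn" by (auto simp: refl_on_def conn_def)
  have "sym (adjacency_rel (V, E))" by (auto simp: sym_def adjacency_rel_def insert_commute)
  then have "sym ((adjacency_rel (V, E))\<^sup>*)" by (rule sym_rtrancl)
  then show "sym conn" unfolding conn_def sym_def by blast
  show "trans conn" unfolding conn_def by (auto simp: trans_def)
qed

abbreviation comps :: "'a set set" where
  "comps \<equiv> component_sets (V, E)"

lemma comps_eq: "comps = V // conn"
  by (simp add: component_sets_def conn_def)

lemma comps_cover: "\<Union>comps = V"
  unfolding comps_eq by (rule Union_quotient[OF equiv_conn])

lemma comps_disjoint: "C \<in> comps \<Longrightarrow> D \<in> comps \<Longrightarrow> i \<in> C \<Longrightarrow> i \<in> D \<Longrightarrow> C = D"
  using quotient_disj[OF equiv_conn] unfolding comps_eq by blast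

lemma comps_finite: "finite comps" "C \<in> comps \<Longrightarrow> finite C" "C \<in> comps \<Longrightarrow> C \<noteq> {}"
proof -
  show "finite comps" unfolding comps_eq
    using finite_V by (simp add: quotient_def)
  show "C \<in> comps \<Longrightarrow> finite C" using comps_cover finite_V by (metis Union_upper finite_subset)
  show "C \<in> comps \<Longrightarrow> C \<noteq> {}" unfolding comps_eq using in_quotient_imp_non_empty[OF equiv_conn] by blast
qed

lemma comps_edge:
  assumes "C \<in> comps" "u \<in> C" "{u, v} \<in> E"
  shows "v \<in> C"
proof -
  obtain a b where ab: "{u, v} = {a, b}" "a \<in> V" "b \<in> V" using edges[OF assms(3)] by blast
  then have V: "u \<in> V" "v \<in> V" by (auto simp: doubleton_eq_iff)
  then have "(u, v) \<in> conn" using assms(3) by (auto simp: conn_def adjacency_rel_def)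
  then show ?thesis using assms(1,2) unfolding comps_eq by (metis equiv_conn in_quotient_imp_closed)
qed

text \<open>The same choice as in \<open>sandpile_group\<close>, so that unfolding produces exactly
  these roots.\<close>

definition comp_root :: "'a set \<Rightarrow> 'a" where
  "comp_root C = (SOME r. r \<in> C)"

lemma comp_root_in: "C \<in> comps \<Longrightarrow> comp_root C \<in> C"
  unfolding comp_root_def using comps_finite(3) by (simp add: some_in_eq)

definition nonroots :: "'a set" where
  "nonroots = (\<Union>C\<in>comps. C - {comp_root C})"

text \<open>No edge leaves a component, so degrees in the induced subgraph are the global ones and
  the Laplacians of the components are the diagonal blocks of the global Laplacian.\<close>

lemma power_p_rank_sandpile_group:
  assumes p: "prime p"
  shows "p ^ p_rank p (sandpile_group (V, E)) = card (fkernel p nonroots (laplacian (V, E)))"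
proof -
  have "sandpile_group (V, E) = sum_group comps (\<lambda>C. product_group (C - {comp_root C}) (\<lambda>_. integer_group)
      Mod lattice_image (C - {comp_root C}) (laplacian (induced_subgraph (V, E) C)))"
    by (simp add: sandpile_group_def rooted_sandpile_group_def comp_root_def induced_subgraph_def)
  moreover have "p ^ p_rank p (sum_group comps (\<lambda>C. product_group (C - {comp_root C}) (\<lambda>_. integer_group)
      Mod lattice_image (C - {comp_root C}) (laplacian (induced_subgraph (V, E) C))))
     = card (fkernel p (\<Union>C\<in>comps. C - {comp_root C}) (laplacian (V, E)))"
  proof (rule power_p_rank_sum_cokernels[OF p comps_finite(1)])
    show "finite (C - {comp_root C})" if "C \<in> comps" for C using comps_finite(2)[OF that] by simp
    show "C = D" if "C \<in> comps" "D \<in> comps" "i \<in> C - {comp_root C}" "i \<in> D - {comp_root D}" for C D i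
      using comps_disjoint that by blast
  next
    fix C i j assume C: "C \<in> comps" and i: "i \<in> C - {comp_root C}" and j: "j \<in> C - {comp_root C}"
    have "e \<subseteq> C" if e: "e \<in> E" "i \<in> e" for e
    proof -
      obtain u v where uv: "e = {u, v}" using edges[OF e(1)] by blast
      then have "e = {i, if u = i then v else u}" using e(2) by auto
      then show ?thesis using comps_edge[OF C, of i] i e(1) by auto
    qed
    then have "{e \<in> E. i \<in> e} = {e \<in> E. e \<subseteq> C \<and> i \<in> e}" by blast
    then have "card {e \<in> E. i \<in> e} = card {e \<in> E. e \<subseteq> C \<and> i \<in> e}" by (rule arg_cong)
    then show "laplacian (V, E) i j = laplacian (induced_subgraph (V, E) C) i j"
      using i j by (auto simp: laplacian_def degree_mat_def adjacency_mat_def induced_subgraph_def)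
  next
    fix C D i j assume "C \<in> comps" "D \<in> comps" "C \<noteq> D" "i \<in> C - {comp_root C}" "j \<in> D - {comp_root D}"
    then have "i \<noteq> j" "{i, j} \<notin> E" using comps_disjoint comps_edge by blast+
    then show "laplacian (V, E) i j = 0"
      by (simp add: laplacian_def degree_mat_def adjacency_mat_def)
  qed
  ultimately show ?thesis by (simp add: nonroots_def)
qed

lemma card_incident_edges: "u \<in> V \<Longrightarrow> card {e \<in> E. u \<in> e} = card {v \<in> V. {u, v} \<in> E}"
proof -
  assume u: "u \<in> V"
  have "bij_betw (\<lambda>v. {u, v}) {v \<in> V. {u, v} \<in> E} {e \<in> E. u \<in> e}"
  proof (rule bij_betw_imageI)
    show "inj_on (\<lambda>v. {u, v}) {v \<in> V. {u, v} \<in> E}"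
      by (rule inj_onI) (auto simp: doubleton_eq_iff)
    show "(\<lambda>v. {u, v}) ` {v \<in> V. {u, v} \<in> E} = {e \<in> E. u \<in> e}"
    proof
      show "{e \<in> E. u \<in> e} \<subseteq> (\<lambda>v. {u, v}) ` {v \<in> V. {u, v} \<in> E}"
      proof
        fix e assume e: "e \<in> {e \<in> E. u \<in> e}"
        then obtain a b where ab: "e = {a, b}" "a \<in> V" "b \<in> V" using edges by blast
        then show "e \<in> (\<lambda>v. {u, v}) ` {v \<in> V. {u, v} \<in> E}"
          using e by (auto simp: insert_commute)
      qed
    qed auto
  qed
  then show ?thesis by (simp add: bij_betw_same_card)
qed

lemma laplacian_apply:
  assumes "u \<in> V"
  shows "(\<Sum>v\<in>V. laplacian (V, E) u v * x v) = (\<Sum>v\<in>{v \<in> V. {u, v} \<in> E}. x u - x v)"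
proof -
  have "(\<Sum>v\<in>V. laplacian (V, E) u v * x v)
     = (\<Sum>v\<in>V. degree_mat (V, E) u v * x v) - (\<Sum>v\<in>V. adjacency_mat (V, E) u v * x v)"
    by (simp add: laplacian_def left_diff_distrib sum_subtractf)
  also have "(\<Sum>v\<in>V. degree_mat (V, E) u v * x v) = (\<Sum>v\<in>V. if v = u then int (card {e \<in> E. u \<in> e}) * x u else 0)"
    by (rule sum.cong) (auto simp: degree_mat_def)
  also have "\<dots> = int (card {v \<in> V. {u, v} \<in> E}) * x u"
    using assms finite_V by (simp add: card_incident_edges)
  also have "(\<Sum>v\<in>V. adjacency_mat (V, E) u v * x v) = (\<Sum>v\<in>{v \<in> V. {u, v} \<in> E}. x v)"
    using finite_V by (auto simp: adjacency_mat_def sum.inter_filter intro!: sum.cong)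
  finally show ?thesis by (simp add: sum_subtractf)
qed

lemma laplacian_apply_component_constant:
  assumes "u \<in> V" "\<And>C v w. C \<in> comps \<Longrightarrow> v \<in> C \<Longrightarrow> w \<in> C \<Longrightarrow> c v = c w"
  shows "(\<Sum>v\<in>V. laplacian (V, E) u v * c v) = 0"
proof -
  obtain C where C: "C \<in> comps" "u \<in> C" using assms(1) comps_cover by blast
  have "c u = c v" if "{u, v} \<in> E" for v using assms(2)[OF C(1) C(2) comps_edge[OF C that]] .
  then show ?thesis unfolding laplacian_apply[OF assms(1)] by (intro sum.neutral) auto
qed

lemma laplacian_sym: "laplacian (V, E) u v = laplacian (V, E) v u"
  by (auto simp: laplacian_def degree_mat_def adjacency_mat_def insert_commute)

lemma nonroots_subset: "nonroots \<subseteq> V"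
  using comps_cover by (auto simp: nonroots_def)

lemma nonroots_sum:
  assumes "\<And>i. i \<notin> nonroots \<Longrightarrow> x i = 0"
  shows "(\<Sum>j\<in>nonroots. laplacian (V, E) i j * x j) = (\<Sum>j\<in>V. laplacian (V, E) i j * x j)"
  using finite_V nonroots_subset assms by (intro sum.mono_neutral_left) auto

text \<open>The rows of the Laplacian indexed by a component sum to zero, so a vector killed by all rows
  except the roots is also killed by the root rows.\<close>

lemma fkernel_nonroots_subset:
  assumes p: "0 < p"
  shows "fkernel p nonroots (laplacian (V, E)) \<subseteq> fkernel p V (laplacian (V, E))"
proof
  fix x assume x: "x \<in> fkernel p nonroots (laplacian (V, E))"
  let ?L = "\<lambda>u. \<Sum>v\<in>V. laplacian (V, E) u v * x v"
  have x0: "x i = 0" if "i \<notin> nonroots" for i using x that by (auto simp: fkernel_def fvec_iff)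
  have nr: "int p dvd ?L u" if "u \<in> nonroots" for u
    using x that nonroots_sum[OF x0] by (simp add: fkernel_def)
  have rt: "int p dvd ?L (comp_root C)" if C: "C \<in> comps" for C
  proof -
    have CV: "C \<subseteq> V" using C comps_cover by blast
    \<comment> \<open>By symmetry this is the Laplacian applied to the indicator of C, which is
      constant on every component.\<close>
    have col: "(\<Sum>u\<in>C. laplacian (V, E) u v) = 0" if v: "v \<in> V" for v
    proof -
      have "(\<Sum>u\<in>V. laplacian (V, E) v u * (if u \<in> C then 1 else 0)) = 0"
      proof (rule laplacian_apply_component_constant[OF v])
        fix D a b assume "D \<in> comps" "a \<in> D" "b \<in> D"
        then have "a \<in> C \<longleftrightarrow> b \<in> C" using C comps_disjoint by blast
        then show "(if a \<in> C then 1 else 0 :: int) = (if b \<in> C then 1 else 0)" by simp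
      qed
      moreover have "(\<Sum>u\<in>V. laplacian (V, E) v u * (if u \<in> C then 1 else 0)) = (\<Sum>u\<in>C. laplacian (V, E) u v)"
        using finite_V CV by (intro sum.mono_neutral_cong_right) (auto simp: laplacian_sym)
      ultimately show ?thesis by simp
    qed
    have "(sum ?L C) = (\<Sum>v\<in>V. (\<Sum>u\<in>C. laplacian (V, E) u v) * x v)"
      unfolding sum_distrib_right by (rule sum.swap)
    also have "\<dots> = 0" using col by simp
    finally have "?L (comp_root C) + (sum ?L (C - {comp_root C})) = 0"
      using sum.remove[OF comps_finite(2)[OF C] comp_root_in[OF C], of ?L] by simp
    moreover have "int p dvd (sum ?L (C - {comp_root C}))"
      using C by (intro dvd_sum nr) (auto simp: nonroots_def)
    ultimately show ?thesis by (simp add: eq_neg_iff_add_eq_0[symmetric])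
  qed
  have "int p dvd ?L u" if u: "u \<in> V" for u
  proof -
    obtain C where C: "C \<in> comps" "u \<in> C" using u comps_cover by blast
    show ?thesis
    proof (cases "u = comp_root C")
      case False
      then have "u \<in> nonroots" using C by (auto simp: nonroots_def)
      then show ?thesis by (rule nr)
    qed (use rt C in auto)
  qed
  moreover have "x \<in> fvec p V"
  proof -
    have "0 \<le> x i \<and> x i < int p" for i
      using x p x0[of i] by (cases "i \<in> nonroots") (auto simp: fkernel_def fvec_iff)
    then show ?thesis using x0 nonroots_subset by (auto simp: fvec_iff)
  qed
  ultimately show "x \<in> fkernel p V (laplacian (V, E))" by (simp add: fkernel_def)
qed

text \<open>Subtracting the root value on each component maps the kernel into the reduced kernel, and
  this is injective on vectors that can be recovered from a vertex where they vanish.\<close>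

lemma card_le_fkernel_nonroots:
  assumes p: "0 < p" and W: "W \<subseteq> fkernel p V (laplacian (V, E))"
    and S: "\<And>C. C \<in> comps \<Longrightarrow> \<exists>s\<in>C. \<forall>x\<in>W. x s = 0"
  shows "card W \<le> card (fkernel p nonroots (laplacian (V, E)))"
proof -
  define cp where "cp = (\<lambda>u. THE C. C \<in> comps \<and> u \<in> C)"
  have cp: "cp u = C" if "C \<in> comps" "u \<in> C" for u C
    unfolding cp_def by (rule the_equality) (use that comps_disjoint in blast)+
  define g where "g = (\<lambda>x u. if u \<in> V then (x u - x (comp_root (cp u))) mod int p else 0)"
  have inj: "inj_on g W"
  proof (rule inj_onI)
    fix x y assume x: "x \<in> W" and y: "y \<in> W" and eq: "g x = g y"
    show "x = y"
    proof (rule fvec_eqI[of _ p V])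
      show "x \<in> fvec p V" "y \<in> fvec p V" using x y W by (auto simp: fkernel_def)
      fix u assume u: "u \<in> V"
      obtain C where C: "C \<in> comps" "u \<in> C" using u comps_cover by blast
      \<comment> \<open>At s both vectors vanish, so g reveals their root values there; subtracting
        the two congruences removes the unknown shift at u.\<close>
      obtain s where s: "s \<in> C" "x s = 0" "y s = 0" using S[OF C(1)] x y by blast
      have sV: "s \<in> V" using s C comps_cover by blast
      have "(x s - x (comp_root C)) mod int p = (y s - y (comp_root C)) mod int p"
        using fun_cong[OF eq, of s] sV cp[OF C(1) s(1)] by (simp add: g_def)
      then have 1: "int p dvd (x s - x (comp_root C)) - (y s - y (comp_root C))" by (simp only: mod_eq_dvd_iff)
      have "(x u - x (comp_root C)) mod int p = (y u - y (comp_root C)) mod int p"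
        using fun_cong[OF eq, of u] u cp[OF C] by (simp add: g_def)
      then have 2: "int p dvd (x u - x (comp_root C)) - (y u - y (comp_root C))" by (simp only: mod_eq_dvd_iff)
      from dvd_diff[OF 2 1] show "int p dvd x u - y u" using s by simp
    qed
  qed
  have "g ` W \<subseteq> fkernel p nonroots (laplacian (V, E))"
  proof (rule image_subsetI)
    fix x assume "x \<in> W"
    then have x: "x \<in> fkernel p V (laplacian (V, E))" using W by blast
    have g0: "g x u = 0" if "u \<notin> nonroots" for u
    proof (cases "u \<in> V")
      case True
      then obtain C where C: "C \<in> comps" "u \<in> C" using comps_cover by blast
      then have "u = comp_root C" using that by (auto simp: nonroots_def)
      then show ?thesis using cp[OF C] by (simp add: g_def)
    qed (simp add: g_def)
    show "g x \<in> fkernel p nonroots (laplacian (V, E))"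
      unfolding fkernel_def
    proof (intro CollectI conjI ballI)
      show "g x \<in> fvec p nonroots" using g0 p nonroots_subset by (auto simp: fvec_iff g_def)
      fix u assume "u \<in> nonroots"
      then have u: "u \<in> V" using nonroots_subset by blast
      have "(\<Sum>v\<in>V. laplacian (V, E) u v * g x v) = (\<Sum>v\<in>V. laplacian (V, E) u v * ((x v + (-1) * x (comp_root (cp v))) mod int p))"
        by (rule sum.cong) (auto simp: g_def)
      then have "(\<Sum>v\<in>V. laplacian (V, E) u v * g x v) mod int p
         = ((\<Sum>v\<in>V. laplacian (V, E) u v * x v) + (-1) * (\<Sum>v\<in>V. laplacian (V, E) u v * x (comp_root (cp v)))) mod int p"
        by (simp only: sum_mult_lincomb_mod)
      also have "(\<Sum>v\<in>V. laplacian (V, E) u v * x (comp_root (cp v))) = 0"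
        by (rule laplacian_apply_component_constant[OF u]) (metis cp)
      finally have "int p dvd (\<Sum>v\<in>V. laplacian (V, E) u v * g x v)"
        using x u by (simp add: fkernel_def dvd_eq_mod_eq_0)
      then show "int p dvd (\<Sum>v\<in>nonroots. laplacian (V, E) u v * g x v)"
        using nonroots_sum[of "g x", OF g0] by simp
    qed
  qed
  moreover have "finite (fkernel p nonroots (laplacian (V, E)))"
    using fsubspace_finite[OF _ fsubspace_fkernel[OF p]] finite_subset[OF nonroots_subset finite_V] by blast
  ultimately show ?thesis by (intro card_inj_on_le[OF inj])
qed

end

section \<open>The random bipartite graph\<close>

definition bip_vertices :: "nat \<Rightarrow> nat \<Rightarrow> (nat + nat) set" where
  "bip_vertices n m = Inl ` {..<n} \<union> Inr ` {..<m}"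

definition bip_edges :: "nat \<Rightarrow> nat \<Rightarrow> (nat \<Rightarrow> nat set) \<Rightarrow> (nat + nat) set set" where
  "bip_edges n m r = {{Inl v, Inr u} | v u. v < n \<and> u < m \<and> u \<in> r v}"

lemma bip_edge_iff:
  "{Inl v, Inr u} \<in> bip_edges n m r \<longleftrightarrow> v < n \<and> u < m \<and> u \<in> r v"
  "{Inr u, Inl v} \<in> bip_edges n m r \<longleftrightarrow> v < n \<and> u < m \<and> u \<in> r v"
  "{Inl v, Inl v'} \<notin> bip_edges n m r" "{Inr u, Inr u'} \<notin> bip_edges n m r"
  unfolding bip_edges_def by (auto simp: doubleton_eq_iff)

lemma finite_simple_graph_bip: "finite_simple_graph (bip_vertices n m) (bip_edges n m r)"
proof
  show "finite (bip_vertices n m)" by (simp add: bip_vertices_def)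
  show "\<exists>u v. e = {u, v} \<and> u \<noteq> v \<and> u \<in> bip_vertices n m \<and> v \<in> bip_vertices n m"
    if "e \<in> bip_edges n m r" for e
    using that unfolding bip_edges_def bip_vertices_def by blast
qed

text \<open>\<open>left_sum n r (\<lambda>_. 1)\<close> is the vector of right degrees, so the
  prescribed diagonal of \<open>kernel_pair\<close> is here the true one.\<close>

lemma fkernel_bip_iff:
  assumes r: "\<And>v. r v \<subseteq> {..<m}"
  shows "x \<in> fkernel p (bip_vertices n m) (laplacian (bip_vertices n m, bip_edges n m r)) \<longleftrightarrow>
    x \<in> fvec p (bip_vertices n m) \<and>
    kernel_pair p m n r (left_sum n r (\<lambda>_. 1)) (\<lambda>u. x (Inr u)) (\<lambda>v. x (Inl v))"
proof -
  interpret finite_simple_graph "bip_vertices n m" "bip_edges n m r" by (rule finite_simple_graph_bip)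
  let ?V = "bip_vertices n m" and ?E = "bip_edges n m r"
  let ?L = "\<lambda>s. \<Sum>w\<in>?V. laplacian (?V, ?E) s w * x w"
  have left: "?L (Inl v) = int (card (r v)) * x (Inl v) - (\<Sum>u\<in>r v. x (Inr u))" if "v < n" for v
  proof -
    have "{w \<in> ?V. {Inl v, w} \<in> ?E} = Inr ` r v"
      using that r[of v] unfolding bip_vertices_def by (auto simp: bip_edge_iff)
    then have "?L (Inl v) = (\<Sum>w\<in>Inr ` r v. x (Inl v) - x w)"
      using laplacian_apply[of "Inl v" x] that by (simp add: bip_vertices_def)
    also have "\<dots> = (\<Sum>u\<in>r v. x (Inl v) - x (Inr u))" by (subst sum.reindex) auto
    finally show ?thesis by (simp add: sum_subtractf)
  qed
  have right: "?L (Inr u) = left_sum n r (\<lambda>_. 1) u * x (Inr u) - left_sum n r (\<lambda>v. x (Inl v)) u" if "u < m" for u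
  proof -
    have ls: "left_sum n r y u = (\<Sum>v\<in>{v \<in> {..<n}. u \<in> r v}. y v)" for y
      unfolding left_sum_def by (rule sum.inter_filter[symmetric]) simp
    have "{w \<in> ?V. {Inr u, w} \<in> ?E} = Inl ` {v \<in> {..<n}. u \<in> r v}"
      using that unfolding bip_vertices_def by (auto simp: bip_edge_iff)
    then have "?L (Inr u) = (\<Sum>w\<in>Inl ` {v \<in> {..<n}. u \<in> r v}. x (Inr u) - x w)"
      using laplacian_apply[of "Inr u" x] that by (simp add: bip_vertices_def)
    also have "\<dots> = (\<Sum>v\<in>{v \<in> {..<n}. u \<in> r v}. x (Inr u) - x (Inl v))" by (subst sum.reindex) auto
    finally show ?thesis unfolding ls by (simp add: sum_subtractf)
  qed
  have "(\<forall>s\<in>?V. int p dvd ?L s) \<longleftrightarrow> (\<forall>v<n. int p dvd ?L (Inl v)) \<and> (\<forall>u<m. int p dvd ?L (Inr u))"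
    unfolding bip_vertices_def by auto
  also have "\<dots> \<longleftrightarrow> kernel_pair p m n r (left_sum n r (\<lambda>_. 1)) (\<lambda>u. x (Inr u)) (\<lambda>v. x (Inl v))"
    unfolding kernel_pair_def by (simp add: left right)
  finally show ?thesis by (simp add: fkernel_def)
qed

text \<open>Project to the right side: the image lies in \<open>right_part\<close>, and vectors with
  zero projection embed into \<open>left_kernel\<close>.\<close>

lemma card_fkernel_bip_le:
  assumes p: "0 < p" and r: "\<And>v. r v \<subseteq> {..<m}"
  shows "card (fkernel p (bip_vertices n m) (laplacian (bip_vertices n m, bip_edges n m r)))
    \<le> card (right_part p m n r (left_sum n r (\<lambda>_. 1))) * card (left_kernel p m n r)"
proof -
  let ?V = "bip_vertices n m"
  let ?K = "fkernel p ?V (laplacian (?V, bip_edges n m r))"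
  let ?J = "right_part p m n r (left_sum n r (\<lambda>_. 1))"
  let ?W = "{x \<in> ?K. \<forall>u. x (Inr u) = 0}"
  have finV: "finite ?V" by (simp add: bip_vertices_def)
  have finK: "finite ?K" by (rule fsubspace_finite[OF finV fsubspace_fkernel[OF p]])
  have "card ?K \<le> card ?J * card ?W"
  proof (rule card_le_card_mult_differences[OF finV, of _ p "\<lambda>x u. x (Inr u)"])
    show "?K \<subseteq> fvec p ?V" by (auto simp: fkernel_def)
    show "(\<lambda>x u. x (Inr u)) ` ?K \<subseteq> ?J"
    proof (rule image_subsetI)
      fix x assume "x \<in> ?K"
      then have "x \<in> fvec p ?V" and rk: "kernel_pair p m n r (left_sum n r (\<lambda>_. 1)) (\<lambda>u. x (Inr u)) (\<lambda>v. x (Inl v))"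
        using fkernel_bip_iff[of r m x p n, OF r] by auto
      then have "(\<lambda>u. x (Inr u)) \<in> fvec p {..<m}" by (auto simp: fvec_iff bip_vertices_def)
      with rk show "(\<lambda>u. x (Inr u)) \<in> ?J" unfolding right_part_def by blast
    qed
    show "finite ?J" using fsubspace_finite[OF _ fsubspace_right_part[OF p]] by auto
    show "finite ?W" using finK by simp
    fix x y assume x: "x \<in> ?K" "y \<in> ?K" and eq: "(\<lambda>u. x (Inr u)) = (\<lambda>u. y (Inr u))"
    have "(\<lambda>i. (x i - y i) mod int p) \<in> ?K" using fsubspace_diff[OF fsubspace_fkernel[OF p] x] .
    then show "(\<lambda>i. (x i - y i) mod int p) \<in> ?W" using fun_cong[OF eq] by simp
  qed
  also have "card ?W \<le> card (left_kernel p m n r)"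
  proof (rule card_inj_on_le[of "\<lambda>x v. x (Inl v)"])
    show "inj_on (\<lambda>x v. x (Inl v)) ?W"
    proof (rule inj_onI)
      fix x y assume x: "x \<in> ?W" and y: "y \<in> ?W" and eq: "(\<lambda>v. x (Inl v)) = (\<lambda>v. y (Inl v))"
      show "x = y"
      proof
        fix s show "x s = y s" using x y fun_cong[OF eq] by (cases s) auto
      qed
    qed
    show "(\<lambda>x v. x (Inl v)) ` ?W \<subseteq> left_kernel p m n r"
    proof (rule image_subsetI)
      fix x assume x: "x \<in> ?W"
      then have "x \<in> fvec p ?V" "kernel_pair p m n r (left_sum n r (\<lambda>_. 1)) (\<lambda>u. 0) (\<lambda>v. x (Inl v))"
        using fkernel_bip_iff[of r m x p n, OF r] by auto
      then show "(\<lambda>v. x (Inl v)) \<in> left_kernel p m n r"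
        by (auto simp: left_kernel_def kernel_pair_def fvec_iff bip_vertices_def)
    qed
  qed simp
  finally show ?thesis by simp
qed

text \<open>The reduced kernel is enlarged to the full one, which the bipartite structure splits
  into a right and a left factor.\<close>

lemma p_rank_bip_upper:
  assumes p: "prime p" and r: "\<And>v. r v \<subseteq> {..<m}"
  shows "real (p_rank p (sandpile_group (bip_vertices n m, bip_edges n m r)))
    \<le> log p (card (right_part p m n r (left_sum n r (\<lambda>_. 1)))) + log p (card (left_kernel p m n r))"
proof -
  interpret finite_simple_graph "bip_vertices n m" "bip_edges n m r" by (rule finite_simple_graph_bip)
  let ?G = "(bip_vertices n m, bip_edges n m r)"
  let ?k = "p_rank p (sandpile_group ?G)"
  let ?J = "right_part p m n r (left_sum n r (\<lambda>_. 1))"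
  have p1: "1 < p" and p0: "0 < p" using prime_gt_1_nat[OF p] by auto
  have fin: "finite (fkernel p (bip_vertices n m) (laplacian ?G))"
    by (rule fsubspace_finite[OF finite_V fsubspace_fkernel[OF p0]])
  have "p ^ ?k \<le> card (fkernel p (bip_vertices n m) (laplacian ?G))"
    unfolding power_p_rank_sandpile_group[OF p] by (rule card_mono[OF fin fkernel_nonroots_subset[OF p0]])
  also have "\<dots> \<le> card ?J * card (left_kernel p m n r)" by (rule card_fkernel_bip_le[OF p0 r])
  finally have le: "real p ^ ?k \<le> real (card ?J) * real (card (left_kernel p m n r))"
    by (simp flip: of_nat_power of_nat_mult)
  have J: "0 < real (card ?J)" using fsubspace_card_pos[OF _ fsubspace_right_part[OF p0]] by simp
  have "0 < real p ^ ?k" using p0 by simp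
  with le have "0 < real (card ?J) * real (card (left_kernel p m n r))" by linarith
  then have E: "0 < real (card (left_kernel p m n r))" using J by (simp add: zero_less_mult_iff)
  have "log p (real p ^ ?k) \<le> log p (real (card ?J) * real (card (left_kernel p m n r)))"
    using p1 le J E by (subst log_le_cancel_iff) (auto intro!: mult_pos_pos)
  also have "\<dots> = log p (card ?J) + log p (card (left_kernel p m n r))"
    using p1 J E by (intro log_mult_pos) auto
  finally show ?thesis using p1 by (simp add: log_nat_power)
qed

text \<open>Left kernel vectors that vanish at isolated vertices are extended by zero to the right
  side. Every component then has a vertex where all of them vanish: a right vertex, or its single
  isolated left vertex. The subtracted term counts the zero rows given up in this way.\<close>

lemma p_rank_bip_lower:
  assumes p: "prime p" and r: "\<And>v. r v \<subseteq> {..<m}"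
  shows "max 0 (real (zero_rows p n r) - real m) - real (card {v. v < n \<and> r v = {}})
    \<le> real (p_rank p (sandpile_group (bip_vertices n m, bip_edges n m r)))"
proof -
  interpret finite_simple_graph "bip_vertices n m" "bip_edges n m r" by (rule finite_simple_graph_bip)
  let ?V = "bip_vertices n m"
  let ?G = "(?V, bip_edges n m r)"
  let ?k = "p_rank p (sandpile_group ?G)"
  let ?E0 = "{x \<in> left_kernel p m n r. \<forall>v<n. r v = {} \<longrightarrow> x v = 0}"
  let ?z = "card {v. v < n \<and> p dvd card (r v) \<and> r v \<noteq> {}}"
  have p1: "1 < p" and p0: "0 < p" using prime_gt_1_nat[OF p] by auto
  define lft where "lft = (\<lambda>x::nat \<Rightarrow> int. \<lambda>s::nat + nat. case s of Inl v \<Rightarrow> x v | Inr u \<Rightarrow> 0)"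
  have lft [simp]: "lft x (Inl v) = x v" "lft x (Inr u) = 0" for x u v by (simp_all add: lft_def)
  have inj: "inj_on lft ?E0"
  proof (rule inj_onI, rule ext)
    fix x y v assume "lft x = lft y"
    from fun_cong[OF this, of "Inl v"] show "x v = y v" by simp
  qed
  have "card (lft ` ?E0) \<le> card (fkernel p nonroots (laplacian ?G))"
  proof (rule card_le_fkernel_nonroots[OF p0])
    show "lft ` ?E0 \<subseteq> fkernel p ?V (laplacian ?G)"
    proof (rule image_subsetI)
      fix x assume x: "x \<in> ?E0"
      have "lft x \<in> fvec p ?V"
        using x p0 by (auto simp: left_kernel_def fvec_iff bip_vertices_def lft_def split: sum.split)
      moreover have "kernel_pair p m n r (left_sum n r (\<lambda>_. 1)) (\<lambda>u. lft x (Inr u)) (\<lambda>v. lft x (Inl v))"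
        using x by (simp add: kernel_pair_def left_kernel_def)
      ultimately show "lft x \<in> fkernel p ?V (laplacian ?G)"
        using fkernel_bip_iff[of r m "lft x" p n, OF r] by blast
    qed
    fix C assume C: "C \<in> comps"
    show "\<exists>s\<in>C. \<forall>x\<in>lft ` ?E0. x s = 0"
    proof (cases "\<exists>u. Inr u \<in> C")
      case True
      then obtain u where "Inr u \<in> C" by blast
      then show ?thesis by (intro bexI[of _ "Inr u"]) auto
    next
      case False
      obtain s where s: "s \<in> C" using comps_finite(3)[OF C] by blast
      then obtain v where v: "s = Inl v" using False by (cases s) auto
      have vn: "v < n" using s C comps_cover unfolding v by (auto simp: bip_vertices_def)
      have "r v = {}"
      proof (rule ccontr)
        assume "r v \<noteq> {}"
        then obtain u where u: "u \<in> r v" by blast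
        then have "{Inl v, Inr u} \<in> bip_edges n m r" using vn r[of v] by (auto simp: bip_edge_iff)
        then show False using comps_edge[OF C, of "Inl v" "Inr u"] s v False by blast
      qed
      then show ?thesis using s vn unfolding v by (intro bexI[of _ "Inl v"]) auto
    qed
  qed
  then have "card ?E0 \<le> p ^ ?k"
    unfolding power_p_rank_sandpile_group[OF p] by (simp add: card_image[OF inj])
  then have "p ^ m * card ?E0 \<le> p ^ m * p ^ ?k" by simp
  from order_trans[OF pow_zero_rows_le_card_left_kernel[OF p0] this]
  have "p ^ ?z \<le> p ^ (m + ?k)" by (simp add: power_add)
  then have "?z \<le> m + ?k" using p1 by (simp add: power_increasing_iff)
  moreover have "zero_rows p n r = ?z + card {v. v < n \<and> r v = {}}"
  proof -
    have "{v. v < n \<and> p dvd card (r v)} = {v. v < n \<and> p dvd card (r v) \<and> r v \<noteq> {}} \<union> {v. v < n \<and> r v = {}}"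
      by auto
    then show ?thesis unfolding zero_rows_def by (simp only:) (subst card_Un_disjoint; auto)
  qed
  ultimately show ?thesis by simp
qed

lemma rows_exp_isolated:
  "rows_exp q m n (\<lambda>r. real (card {v. v < n \<and> r v = {}})) = real n * (1 - q) ^ m"
proof (induction n)
  case (Suc n)
  have *: "(\<Sum>B\<in>Pow {..<m}. row_weight q m B * real (card {v. v < Suc n \<and> (r(n := B)) v = {}}))
     = real (card {v. v < n \<and> r v = {}}) + (1 - q) ^ m" for r :: "nat \<Rightarrow> nat set"
  proof -
    have "real (card {v. v < Suc n \<and> (r(n := B)) v = {}}) = real (card {v. v < n \<and> r v = {}}) + (if B = {} then 1 else 0)" for B
    proof -
      have "{v. v < Suc n \<and> (r(n := B)) v = {}} = {v. v < n \<and> r v = {}} \<union> (if B = {} then {n} else {})"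
        by (auto simp: less_Suc_eq)
      then show ?thesis by (simp add: card_insert_if)
    qed
    then have "(\<Sum>B\<in>Pow {..<m}. row_weight q m B * real (card {v. v < Suc n \<and> (r(n := B)) v = {}}))
      = (\<Sum>B\<in>Pow {..<m}. row_weight q m B * real (card {v. v < n \<and> r v = {}}) + (if B = {} then row_weight q m {} else 0))"
      by (intro sum.cong) (auto simp: distrib_left)
    also have "\<dots> = real (card {v. v < n \<and> r v = {}}) + row_weight q m {}"
      by (simp add: sum.distrib sum_row_weight flip: sum_distrib_right)
    finally show ?thesis by (simp add: row_weight_def)
  qed
  show ?case unfolding rows_exp.simps * rows_exp_add Suc by (simp add: algebra_simps)
qed simp

section \<open>From the product measure on edges to iterated sums over rows\<close>

lemma expectation_pair_pmf_finite:
  fixes f :: "'a \<times> 'b \<Rightarrow> real"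
  assumes "finite (set_pmf A)" "finite (set_pmf B)"
  shows "measure_pmf.expectation (pair_pmf A B) f
    = measure_pmf.expectation A (\<lambda>a. measure_pmf.expectation B (\<lambda>b. f (a, b)))"
proof -
  have "measure_pmf.expectation (pair_pmf A B) f = (\<Sum>x\<in>set_pmf A \<times> set_pmf B. f x * pmf (pair_pmf A B) x)"
    using assms by (intro integral_measure_pmf_real) auto
  also have "\<dots> = (\<Sum>a\<in>set_pmf A. (\<Sum>b\<in>set_pmf B. f (a, b) * pmf B b) * pmf A a)"
    by (simp add: sum.cartesian_product' sum_distrib_left sum_distrib_right pmf_pair mult_ac)
  also have "\<dots> = (\<Sum>a\<in>set_pmf A. measure_pmf.expectation B (\<lambda>b. f (a, b)) * pmf A a)"
    using assms by (intro sum.cong refl arg_cong2[of _ _ _ _ "(*)"] integral_measure_pmf_real[symmetric]) auto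
  also have "\<dots> = measure_pmf.expectation A (\<lambda>a. measure_pmf.expectation B (\<lambda>b. f (a, b)))"
    using assms by (intro integral_measure_pmf_real[symmetric]) auto
  finally show ?thesis .
qed

lemma finite_set_Pi_pmf_bool: "finite A \<Longrightarrow> finite (set_pmf (Pi_pmf A d (\<lambda>_. P :: bool pmf)))"
  by (rule finite_subset[OF set_Pi_pmf_subset']) auto

lemma set_Pi_pmf_default: "finite A \<Longrightarrow> f \<in> set_pmf (Pi_pmf A d P) \<Longrightarrow> x \<notin> A \<Longrightarrow> f x = d"
  using set_Pi_pmf_subset[of A d P] by blast

lemma expectation_row:
  fixes G :: "nat set \<Rightarrow> real"
  assumes q: "0 \<le> q" "q \<le> 1"
  shows "measure_pmf.expectation (Pi_pmf ({Inl t} \<times> Inr ` {..<m}) False (\<lambda>_. bernoulli_pmf q))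
     (\<lambda>h. G {u. u < m \<and> h (Inl t :: nat + nat, Inr u :: nat + nat)})
    = (\<Sum>B\<in>Pow {..<m}. row_weight q m B * G B)"
proof -
  let ?S = "{Inl t :: nat + nat} \<times> (Inr :: nat \<Rightarrow> nat + nat) ` {..<m}"
  let ?P = "Pi_pmf ?S False (\<lambda>_. bernoulli_pmf q)"
  let ?e = "\<lambda>B x. x \<in> {Inl t :: nat + nat} \<times> (Inr :: nat \<Rightarrow> nat + nat) ` B"
  have inj: "inj_on ?e (Pow {..<m})"
  proof (rule inj_onI)
    fix B C assume "?e B = ?e C"
    then have "(u \<in> B) = (u \<in> C)" for u using fun_cong[of "?e B" "?e C" "(Inl t, Inr u)"] by auto
    then show "B = C" by blast
  qed
  have supp: "h \<in> ?e ` Pow {..<m}" if "h \<in> set_pmf ?P" for h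
  proof -
    have out: "h x = False" if "x \<notin> ?S" for x
      by (rule set_Pi_pmf_default[OF _ \<open>h \<in> set_pmf ?P\<close> that]) simp
    have "h = ?e {u. u < m \<and> h (Inl t, Inr u)}"
    proof
      fix x show "h x = ?e {u. u < m \<and> h (Inl t, Inr u)} x" using out[of x] by (cases "x \<in> ?S") auto
    qed
    then show ?thesis by (rule image_eqI) auto
  qed
  have pm: "pmf ?P (?e B) = row_weight q m B" if "B \<in> Pow {..<m}" for B
  proof -
    have "pmf ?P (?e B) = (\<Prod>x\<in>?S. pmf (bernoulli_pmf q) (?e B x))"
      using that by (intro pmf_Pi') auto
    also have "\<dots> = (\<Prod>u<m. pmf (bernoulli_pmf q) (?e B (Inl t, Inr u)))"
      by (rule prod.reindex_bij_witness[of _ "\<lambda>u. (Inl t, Inr u)" "\<lambda>x. projr (snd x)"]) auto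
    also have "\<dots> = row_weight q m B"
      unfolding row_weight_def using q by (intro prod.cong) (auto simp: inj_image_mem_iff)
    finally show ?thesis .
  qed
  have "measure_pmf.expectation ?P (\<lambda>h. G {u. u < m \<and> h (Inl t, Inr u)})
     = (\<Sum>h\<in>?e ` Pow {..<m}. G {u. u < m \<and> h (Inl t, Inr u)} * pmf ?P h)"
    using supp by (intro integral_measure_pmf_real) auto
  also have "\<dots> = (\<Sum>B\<in>Pow {..<m}. G {u. u < m \<and> ?e B (Inl t, Inr u)} * pmf ?P (?e B))"
    by (subst sum.reindex[OF inj]) simp
  also have "\<dots> = (\<Sum>B\<in>Pow {..<m}. row_weight q m B * G B)"
  proof (rule sum.cong[OF refl])
    fix B assume B: "B \<in> Pow {..<m}"
    then have "{u. u < m \<and> ?e B (Inl t, Inr u)} = B" by auto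
    then show "G {u. u < m \<and> ?e B (Inl t, Inr u)} * pmf ?P (?e B) = row_weight q m B * G B"
      using pm[OF B] by simp
  qed
  finally show ?thesis .
qed

text \<open>The edge set splits into the first t rows and row t, which are independent; this peeling
  matches the recursion of \<open>rows_exp\<close>.\<close>

lemma expectation_rows:
  fixes g :: "(nat \<Rightarrow> nat set) \<Rightarrow> real"
  assumes q: "0 \<le> q" "q \<le> 1"
  shows "measure_pmf.expectation (Pi_pmf (Inl ` {..<t} \<times> Inr ` {..<m}) False (\<lambda>_. bernoulli_pmf q))
     (\<lambda>b. g (\<lambda>v. {u. u < m \<and> b (Inl v :: nat + nat, Inr u :: nat + nat)}))
    = rows_exp q m t g"
proof (induction t arbitrary: g)
  case (Suc t)
  let ?R = "(Inr :: nat \<Rightarrow> nat + nat) ` {..<m}"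
  let ?A = "(Inl :: nat \<Rightarrow> nat + nat) ` {..<t} \<times> ?R"
  let ?B = "{Inl t :: nat + nat} \<times> ?R"
  let ?P = "\<lambda>S. Pi_pmf S False (\<lambda>_. bernoulli_pmf q)"
  let ?r = "\<lambda>b v. {u. u < m \<and> b (Inl v :: nat + nat, Inr u :: nat + nat)}"
  have un: "(Inl :: nat \<Rightarrow> nat + nat) ` {..<Suc t} \<times> ?R = ?A \<union> ?B" by (auto simp: less_Suc_eq)
  have "measure_pmf.expectation (?P (Inl ` {..<Suc t} \<times> ?R)) (\<lambda>b. g (?r b))
    = measure_pmf.expectation (pair_pmf (?P ?A) (?P ?B)) (\<lambda>(f, h). g (?r (\<lambda>x. if x \<in> ?A then f x else h x)))"
    unfolding un by (subst Pi_pmf_union) (auto simp: case_prod_unfold)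
  also have "\<dots> = measure_pmf.expectation (pair_pmf (?P ?A) (?P ?B)) (\<lambda>(f, h). g ((?r f)(t := {u. u < m \<and> h (Inl t, Inr u)})))"
  proof (rule integral_cong_AE, simp, simp, subst AE_measure_pmf_iff, intro ballI)
    fix x assume x: "x \<in> set_pmf (pair_pmf (?P ?A) (?P ?B))"
    obtain f h where fh: "x = (f, h)" by (cases x)
    have f: "f \<in> set_pmf (?P ?A)" and h: "h \<in> set_pmf (?P ?B)" using x unfolding fh by auto
    \<comment> \<open>The default value \<open>False\<close> makes all rows beyond the index set
      empty, in agreement with the convention of \<open>rows_exp\<close>.\<close>
    have out: "\<not> f y" if "y \<notin> ?A" for y using set_Pi_pmf_default[OF _ f that] by simp
    have outh: "\<not> h y" if "y \<notin> ?B" for y using set_Pi_pmf_default[OF _ h that] by simp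
    have "?r (\<lambda>x. if x \<in> ?A then f x else h x) = (?r f)(t := {u. u < m \<and> h (Inl t, Inr u)})"
    proof
      fix v show "?r (\<lambda>x. if x \<in> ?A then f x else h x) v = ((?r f)(t := {u. u < m \<and> h (Inl t, Inr u)})) v"
      proof (cases "v < t")
        case False
        then have "\<not> f (Inl v, Inr u)" for u by (intro out) auto
        moreover have "\<not> h (Inl v, Inr u)" if "v \<noteq> t" for u using that by (intro outh) auto
        ultimately show ?thesis using False by auto
      qed auto
    qed
    then show "(case x of (f, h) \<Rightarrow> g (?r (\<lambda>x. if x \<in> ?A then f x else h x)))
       = (case x of (f, h) \<Rightarrow> g ((?r f)(t := {u. u < m \<and> h (Inl t, Inr u)})))"
      by (simp only: fh prod.case)
  qed
  also have "\<dots> = measure_pmf.expectation (?P ?A) (\<lambda>f. measure_pmf.expectation (?P ?B) (\<lambda>h. g ((?r f)(t := {u. u < m \<and> h (Inl t, Inr u)}))))"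
    by (subst expectation_pair_pmf_finite) (auto intro!: finite_set_Pi_pmf_bool)
  also have "\<dots> = measure_pmf.expectation (?P ?A) (\<lambda>f. \<Sum>B\<in>Pow {..<m}. row_weight q m B * g ((?r f)(t := B)))"
    by (rule Bochner_Integration.integral_cong[OF refl]) (rule expectation_row[OF q])
  also have "\<dots> = rows_exp q m t (\<lambda>r. \<Sum>B\<in>Pow {..<m}. row_weight q m B * g (r(t := B)))"
    by (rule Suc.IH)
  finally show ?case by simp
qed simp

lemma expected_p_rank_eq_rows_exp:
  assumes q: "0 \<le> q" "q \<le> 1"
  shows "expected_p_rank p \<alpha> q n = rows_exp q (nat \<lfloor>\<alpha> * real n\<rfloor>) n
    (\<lambda>r. real (p_rank p (sandpile_group
       (bip_vertices n (nat \<lfloor>\<alpha> * real n\<rfloor>), bip_edges n (nat \<lfloor>\<alpha> * real n\<rfloor>) r))))"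
proof -
  define m where "m = nat \<lfloor>\<alpha> * real n\<rfloor>"
  let ?r = "\<lambda>b v. {u. u < m \<and> b (Inl v :: nat + nat, Inr u :: nat + nat)}"
  have G: "(left_vertices n \<union> right_vertices n \<alpha>, {{v, u} | v u. v \<in> left_vertices n \<and> u \<in> right_vertices n \<alpha> \<and> b (v, u)})
     = (bip_vertices n m, bip_edges n m (?r b))" for b
    unfolding left_vertices_def right_vertices_def bip_vertices_def bip_edges_def m_def[symmetric]
    by blast
  show ?thesis
    unfolding expected_p_rank_def random_bipartite_graph_def Let_def G integral_map_pmf m_def[symmetric]
    unfolding left_vertices_def right_vertices_def m_def[symmetric]
    by (rule expectation_rows[OF q])
qed

text \<open>Serves both exponentially small errors that get multiplied by n: the expected number of
  isolated left vertices and the deviation of the success probability from 1/p.\<close>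

lemma bounded_linear_times_geometric:
  fixes g \<alpha> :: real
  assumes "0 \<le> g" "g < 1" "0 < \<alpha>"
  shows "\<exists>C. \<forall>n. real n * g ^ nat \<lfloor>\<alpha> * real n\<rfloor> \<le> C"
proof -
  have "(\<lambda>n. real n * g ^ n) \<longlonglongrightarrow> 0" using assms by (intro powser_times_n_limit_0) auto
  then have "Bseq (\<lambda>n. real n * g ^ n)" by (intro convergent_imp_Bseq) (auto simp: convergent_def)
  then obtain K where K: "\<And>n. norm (real n * g ^ n) \<le> K" unfolding Bseq_def by blast
  have "real n * g ^ nat \<lfloor>\<alpha> * real n\<rfloor> \<le> (K + 1) / \<alpha>" for n
  proof -
    define m where "m = nat \<lfloor>\<alpha> * real n\<rfloor>"
    have "\<alpha> * real n \<le> real m + 1" unfolding m_def by linarith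
    then have "real n \<le> (real m + 1) / \<alpha>" using assms by (simp add: field_simps)
    then have "real n * g ^ m \<le> (real m + 1) / \<alpha> * g ^ m" using assms by (intro mult_right_mono) auto
    also have "\<dots> = (real m * g ^ m + g ^ m) / \<alpha>" by (simp add: field_simps)
    also have "\<dots> \<le> (K + 1) / \<alpha>"
      using K[of m] assms by (intro divide_right_mono add_mono) (auto simp: power_le_one abs_le_iff)
    finally show ?thesis by (simp add: m_def)
  qed
  then show ?thesis by blast
qed

section \<open>Choice of constants and assembly of the asymptotics\<close>

lemma row_walk_exists:
  assumes p: "prime p" and q: "0 < q" "q < 1"
  shows "\<exists>k0 b th. row_walk p k0 q b th \<and> (\<forall>k s. k0 \<le> k \<longrightarrow> 1 / (2 * real p) \<le> binmod p q k s)"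
proof -
  have p1: "1 < p" using prime_gt_1_nat[OF p] .
  obtain g where g: "0 < g" "g < 1" "\<And>k s. \<bar>binmod p q k s - 1 / real p\<bar> \<le> g ^ k"
    using binmod_equidistributed[of p q] p1 q by auto
  obtain k0 where k0: "g ^ k0 < 1 / (2 * real p)"
    using real_arch_pow_inv[of "1 / (2 * real p)" g] g p1 by auto
  have low: "1 / (2 * real p) \<le> binmod p q k s" if "k0 \<le> k" for k s
  proof -
    have "g ^ k \<le> g ^ k0" using that g by (intro power_decreasing) auto
    with g(3)[of k s] k0 have "1 / real p - 1 / (2 * real p) \<le> binmod p q k s" by linarith
    then show ?thesis by (simp add: field_simps)
  qed
  \<comment> \<open>With \<open>binmod\<close> at least 1 / (2 p) from \<open>k0\<close> on, c / (2
    p) is a lower bound for both shares of an entry, which dictates the choice of b below.\<close>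
  define c where "c = min q (1 - q)"
  have c: "0 < c" "c \<le> q" "c \<le> 1 - q" using q by (auto simp: c_def)
  define b where "b = 1 - c / (2 * real p)"
  have cp: "0 < c / (2 * real p)" "c / (2 * real p) \<le> c / 2" using c p1 by (auto simp: field_simps)
  have b: "0 < b" "b < 1" using cp c q unfolding b_def by linarith+
  have "row_walk p k0 q b (log p (1 / b))"
  proof
    show "real p powr log p (1 / b) * b = 1" using p1 b by (simp add: powr_log_cancel)
    show "q \<le> b" "1 - q \<le> b" unfolding b_def using cp c by linarith+
    fix k s assume k: "k0 \<le> k"
    have "c * (1 / (2 * real p)) \<le> q * binmod p q k s"
      using low[OF k] c q p1 by (intro mult_mono) auto
    then show "1 - b \<le> q * binmod p q k s" by (simp add: b_def)
    have "c * (1 / (2 * real p)) \<le> (1 - q) * binmod p q k s"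
      using low[OF k] c q p1 by (intro mult_mono) auto
    then show "1 - b \<le> (1 - q) * binmod p q k s" by (simp add: b_def)
  qed (use p q b in auto)
  with low show ?thesis by blast
qed

lemma expected_p_rank_approx:
  assumes \<alpha>: "0 < \<alpha>" "\<alpha> < 1" and q: "0 < q" "q < 1" and p: "prime p"
  shows "\<exists>C. \<forall>\<^sub>F n in at_top. \<bar>expected_p_rank p \<alpha> q n -
     binomial_exp (binmod p q (nat \<lfloor>\<alpha> * real n\<rfloor>) 0) n (\<lambda>k. max 0 (real k - real (nat \<lfloor>\<alpha> * real n\<rfloor>)))\<bar> \<le> C"
proof -
  obtain k0 b th where walk: "row_walk p k0 q b th"
    and low: "\<And>k s. k0 \<le> k \<Longrightarrow> 1 / (2 * real p) \<le> binmod p q k s"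
    using row_walk_exists[OF p q] by blast
  interpret row_walk p k0 q b th by (rule walk)
  have p1: "1 < p" using prime_gt_1_nat[OF p] .
  obtain C0 where C0: "\<And>n. real n * (1 - q) ^ nat \<lfloor>\<alpha> * real n\<rfloor> \<le> C0"
    using bounded_linear_times_geometric[of "1 - q" \<alpha>] q \<alpha> by auto
  define CJ where "CJ = lam ^ k0 * (1 + lam / (1 - b)) / th / ln p"
  define CE where "CE = b / (1 - b) / (1 / (2 * real p))"
  define C where "C = max C0 (CJ + CE)"
  have "\<forall>\<^sub>F n in at_top. real k0 \<le> (1 - \<alpha>) * real n" using \<alpha> by real_asymp
  moreover have "\<forall>\<^sub>F n in at_top. real k0 + 1 \<le> \<alpha> * real n" using \<alpha> by real_asymp
  ultimately have "\<forall>\<^sub>F n in at_top. \<bar>expected_p_rank p \<alpha> q n -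
     binomial_exp (binmod p q (nat \<lfloor>\<alpha> * real n\<rfloor>) 0) n (\<lambda>k. max 0 (real k - real (nat \<lfloor>\<alpha> * real n\<rfloor>)))\<bar> \<le> C"
  proof eventually_elim
    case (elim n)
    define m where "m = nat \<lfloor>\<alpha> * real n\<rfloor>"
    define rho where "rho = binmod p q m 0"
    let ?rank = "\<lambda>r. real (p_rank p (sandpile_group (bip_vertices n m, bip_edges n m r)))"
    let ?B = "binomial_exp rho n (\<lambda>k. max 0 (real k - real m))"
    have an: "0 \<le> \<alpha> * real n" using \<alpha> by simp
    have "real m \<le> \<alpha> * real n" using an unfolding m_def by linarith
    then have "real m + real k0 \<le> real n" using elim(1) by (simp add: left_diff_distrib)
    \<comment> \<open>The room required by the walk; \<alpha> < 1 provides it for large n.\<close>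
    then have mk: "m + k0 \<le> n" by linarith
    \<comment> \<open>Rows are long enough for their degrees to be nearly equidistributed, which
      keeps \<open>rho\<close> away from 0. The extra 1 in the eventual bound absorbs the rounding
      of m.\<close>
    have km: "k0 \<le> m" using elim(2) unfolding m_def by linarith
    have rho: "1 / (2 * real p) \<le> rho" unfolding rho_def by (rule low[OF km])
    have "0 < 1 / (2 * real p)" using p1 by simp
    then have rho0: "0 < rho" using rho by linarith
    have E: "expected_p_rank p \<alpha> q n = rows_exp q m n ?rank"
      unfolding m_def using q by (intro expected_p_rank_eq_rows_exp) auto
    have Beq: "rows_exp q m n (\<lambda>r. max 0 (real (zero_rows p n r) - real m)) = ?B"
      unfolding rho_def using q by (intro rows_exp_zero_rows) auto
    have "?B - real n * (1 - q) ^ m \<le> rows_exp q m n ?rank"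
    proof -
      have "rows_exp q m n (\<lambda>r. max 0 (real (zero_rows p n r) - real m) - real (card {v. v < n \<and> r v = {}})) \<le> rows_exp q m n ?rank"
        using q by (intro rows_exp_mono p_rank_bip_lower[OF p]) auto
      then show ?thesis unfolding rows_exp_diff Beq rows_exp_isolated .
    qed
    then have lower: "?B - C0 \<le> expected_p_rank p \<alpha> q n" using C0[of n] unfolding E m_def by linarith
    have "rows_exp q m n ?rank \<le> rows_exp q m n (\<lambda>r. log p (card (right_part p m n r (left_sum n r (\<lambda>_. 1)))) + log p (card (left_kernel p m n r)))"
      using q by (intro rows_exp_mono p_rank_bip_upper[OF p]) auto
    also have "\<dots> = rows_exp q m n (\<lambda>r. 1 / ln p * ln (card (right_part p m n r (left_sum n r (\<lambda>_. 1)))))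
        + rows_exp q m n (\<lambda>r. log p (card (left_kernel p m n r)))"
      unfolding rows_exp_add by (simp add: log_def)
    also have "rows_exp q m n (\<lambda>r. 1 / ln p * ln (card (right_part p m n r (left_sum n r (\<lambda>_. 1))))) \<le> CJ"
      unfolding rows_exp_cmult CJ_def
      using mult_left_mono[OF expected_ln_card_right_part_le[OF mk], of "1 / ln p"] p1 by (simp add: mult.commute)
    also have "rows_exp q m n (\<lambda>r. log p (card (left_kernel p m n r))) \<le> ?B + CE"
    proof -
      have "b / (1 - b) / rho \<le> CE"
        unfolding CE_def using rho rho0 b p1 by (intro divide_left_mono) auto
      then show ?thesis using expected_log_card_left_kernel_le[of m n] rho0 unfolding Beq rho_def by simp
    qed
    finally have upper: "expected_p_rank p \<alpha> q n \<le> CJ + (?B + CE)" unfolding E by simp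
    from lower upper have "\<bar>expected_p_rank p \<alpha> q n - ?B\<bar> \<le> C"
      unfolding C_def by (auto simp: abs_le_iff max_def)
    then show ?case unfolding rho_def m_def .
  qed
  then show ?thesis by blast
qed

theorem theorem1p1:
  fixes \<alpha> q :: real and p :: nat
  assumes "0 < \<alpha>" and "\<alpha> < 1" and "0 < q" and "q < 1" and "prime p"
  shows "(\<alpha> < 1 / real p \<longrightarrow>
            (\<lambda>n. expected_p_rank p \<alpha> q n - (1 / real p - \<alpha>) * real n) \<in> O(\<lambda>_. 1)) \<and>
         (\<alpha> > 1 / real p \<longrightarrow>
            (\<lambda>n. expected_p_rank p \<alpha> q n) \<in> O(\<lambda>_. 1)) \<and>
         (\<alpha> = 1 / real p \<longrightarrow>
            (\<lambda>n. expected_p_rank p \<alpha> q n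
                   - sqrt ((1 / real p * (1 - 1 / real p) * real n) / (2 * pi))) \<in> O(\<lambda>_. 1))"
proof -
  have p1: "1 < p" using prime_gt_1_nat[OF assms(5)] .
  define M where "M = (\<lambda>n. nat \<lfloor>\<alpha> * real n\<rfloor>)"
  define rho where "rho = (\<lambda>n. binmod p q (M n) 0)"
  define B where "B = (\<lambda>n. binomial_exp (rho n) n (\<lambda>k. max 0 (real k - real (M n))))"
  have rho01: "0 \<le> rho n" "rho n \<le> 1" for n unfolding rho_def using assms by (auto intro: binmod_bounds)
  have M: "\<alpha> * real n - 1 \<le> real (M n)" "real (M n) \<le> \<alpha> * real n" for n
  proof -
    have "0 \<le> \<alpha> * real n" using assms by simp
    then show "\<alpha> * real n - 1 \<le> real (M n)" "real (M n) \<le> \<alpha> * real n" unfolding M_def by linarith+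
  qed
  obtain C1 where C1: "\<forall>\<^sub>F n in at_top. \<bar>expected_p_rank p \<alpha> q n - B n\<bar> \<le> C1"
    using expected_p_rank_approx[OF assms] unfolding B_def rho_def M_def by blast
  obtain g where g: "0 < g" "g < 1" "\<And>k s. \<bar>binmod p q k s - 1 / real p\<bar> \<le> g ^ k"
    using binmod_equidistributed[of p q] p1 assms by auto
  obtain C2 where C2: "\<And>n. real n * g ^ M n \<le> C2"
    using bounded_linear_times_geometric[of g \<alpha>] g assms unfolding M_def by auto
  have rho: "real n * \<bar>rho n - 1 / real p\<bar> \<le> C2" for n
    using mult_left_mono[OF g(3)[of "M n" 0], of "real n"] C2[of n] unfolding rho_def by linarith
  have rho': "\<bar>real n * rho n - real n / real p\<bar> \<le> C2" for n
  proof -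
    have "real n * rho n - real n / real p = real n * (rho n - 1 / real p)" by (simp add: algebra_simps)
    then show ?thesis using rho[of n] by (simp add: abs_mult)
  qed
  have O1: "f \<in> O(\<lambda>_. 1)" if "\<forall>\<^sub>F n in at_top. \<bar>f n - h n\<bar> \<le> c" "\<forall>\<^sub>F n in at_top. \<bar>h n\<bar> \<le> d"
    for f h :: "nat \<Rightarrow> real" and c d
  proof (rule bigoI[of _ "c + d"])
    show "\<forall>\<^sub>F n in at_top. norm (f n) \<le> (c + d) * norm (1::real)"
      using that by eventually_elim auto
  qed
  \<comment> \<open>Once the gap t between the mean and the threshold is at least d n / 2, the
    variance bound n / (4 t) is a constant.\<close>
  have quot: "real n / (4 * t) \<le> 1 / (2 * d)" if "0 < d" "d * real n \<le> 2 * t" "0 < t" for n t d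
    using that by (simp add: field_simps)
  show ?thesis
  proof (intro conjI impI)
    assume lt: "\<alpha> < 1 / real p"
    define d where "d = 1 / real p - \<alpha>"
    have d: "0 < d" using lt by (simp add: d_def)
    have "\<forall>\<^sub>F n in at_top. d * real n \<le> 2 * (d * real n - C2)" using d by real_asymp
    moreover have "\<forall>\<^sub>F n in at_top. 0 < d * real n - C2" using d by real_asymp
    ultimately have "\<forall>\<^sub>F n in at_top. \<bar>B n - d * real n\<bar> \<le> C2 + 1 + 1 / (2 * d)"
    proof eventually_elim
      case (elim n)
      define t where "t = real n * rho n - real (M n)"
      have t: "d * real n - C2 \<le> t" "\<bar>t - d * real n\<bar> \<le> C2 + 1"
        using rho'[of n] M[of n] unfolding t_def d_def left_diff_distrib by (auto simp: abs_le_iff)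
      have t0: "0 < t" using t elim by linarith
      \<comment> \<open>Write max 0 x = x + max 0 (-x): the mean supplies the linear term, and the
        opposite tail is the bounded correction.\<close>
      have "B n = binomial_exp (rho n) n (\<lambda>k. (real k - real (M n)) + max 0 (real n * rho n - real k - t))"
        unfolding B_def t_def by (intro arg_cong[of _ _ "binomial_exp (rho n) n"] ext) (simp add: max_def)
      also have "\<dots> = t + binomial_exp (rho n) n (\<lambda>k. max 0 (real n * rho n - real k - t))"
        unfolding binomial_exp_add binomial_exp_mean t_def ..
      finally have Bn: "B n = t + binomial_exp (rho n) n (\<lambda>k. max 0 (real n * rho n - real k - t))" .
      have "binomial_exp (rho n) n (\<lambda>_. 0) \<le> binomial_exp (rho n) n (\<lambda>k. max 0 (real n * rho n - real k - t))"
        by (rule binomial_exp_mono[OF rho01]) simp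
      moreover have "binomial_exp (rho n) n (\<lambda>k. max 0 (real n * rho n - real k - t)) \<le> real n / (4 * t)"
        by (rule binomial_exp_tail_le(2)[OF rho01 t0])
      moreover have "real n / (4 * t) \<le> 1 / (2 * d)"
        using quot[OF d _ t0] elim t by simp
      ultimately show ?case using t(2) unfolding Bn binomial_exp_const abs_le_iff by linarith
    qed
    then show "(\<lambda>n. expected_p_rank p \<alpha> q n - (1 / real p - \<alpha>) * real n) \<in> O(\<lambda>_. 1)"
      unfolding d_def[symmetric]
    proof (rule O1[rotated])
      show "\<forall>\<^sub>F n in at_top. \<bar>(expected_p_rank p \<alpha> q n - d * real n) - (B n - d * real n)\<bar> \<le> C1"
        using C1 by simp
    qed
  next
    assume gt: "\<alpha> > 1 / real p"
    define d where "d = \<alpha> - 1 / real p"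
    have d: "0 < d" using gt by (simp add: d_def)
    have "\<forall>\<^sub>F n in at_top. d * real n \<le> 2 * (d * real n - C2 - 1)" using d by real_asymp
    moreover have "\<forall>\<^sub>F n in at_top. 0 < d * real n - C2 - 1" using d by real_asymp
    ultimately have "\<forall>\<^sub>F n in at_top. \<bar>B n\<bar> \<le> 1 / (2 * d)"
    proof eventually_elim
      case (elim n)
      define t where "t = real (M n) - real n * rho n"
      have t: "d * real n - C2 - 1 \<le> t"
        using rho'[of n] M[of n] unfolding t_def d_def left_diff_distrib by (auto simp: abs_le_iff)
      have t0: "0 < t" using t elim by linarith
      have Bn: "B n = binomial_exp (rho n) n (\<lambda>k. max 0 (real k - real n * rho n - t))"
        unfolding B_def t_def by simp
      have "binomial_exp (rho n) n (\<lambda>_. 0) \<le> B n"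
        unfolding Bn by (rule binomial_exp_mono[OF rho01]) simp
      moreover have "B n \<le> real n / (4 * t)"
        unfolding Bn by (rule binomial_exp_tail_le(1)[OF rho01 t0])
      moreover have "real n / (4 * t) \<le> 1 / (2 * d)"
        using quot[OF d _ t0] elim t by simp
      ultimately show ?case unfolding binomial_exp_const by simp
    qed
    then show "(\<lambda>n. expected_p_rank p \<alpha> q n) \<in> O(\<lambda>_. 1)" by (rule O1[OF C1])
  next
    assume eq: "\<alpha> = 1 / real p"
    define S where "S = (\<lambda>n. sqrt ((1 / real p * (1 - 1 / real p) * real n) / (2 * pi)))"
    have "\<forall>\<^sub>F n in at_top. \<bar>B n - S n\<bar> \<le> C2 + real p + 12 + 1"
      using eventually_ge_at_top[of "6 * p"]
    proof eventually_elim
      case (elim n)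
      \<comment> \<open>Four bounded corrections lead from \<open>B n\<close> to \<open>S n\<close>:
        success probability replaced by 1/p (\<open>C2\<close>), j < p trials dropped (p),
        Stirling's approximation (12), and N in place of n/p under the root (1). The bound n \<ge> 6
        p ensures N \<ge> 6.\<close>
      define N where "N = n div p"
      define j where "j = n mod p"
      have n: "n = p * N + j" and j: "j < p" using p1 by (auto simp: N_def j_def)
      have N6: "6 \<le> N" unfolding N_def using div_le_mono[OF elim, of p] p1 by simp
      have MN: "M n = N" unfolding M_def eq N_def by (simp add: floor_divide_of_nat_eq)
      let ?F = "\<lambda>k. max 0 (real k - real N)"
      have lip: "\<bar>?F (Suc k) - ?F k\<bar> \<le> 1" for k by (simp add: max_def)
      have s: "0 \<le> 1 / real p" "1 / real p \<le> 1" using p1 by auto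
      have "\<bar>B n - binomial_exp (1 / real p) n ?F\<bar> \<le> real n * \<bar>rho n - 1 / real p\<bar>"
        unfolding B_def MN by (rule binomial_exp_Lipschitz_parameter[OF rho01 s]) (rule lip)
      then have 1: "\<bar>B n - binomial_exp (1 / real p) n ?F\<bar> \<le> C2" using rho[of n] by linarith
      have "\<bar>binomial_exp (1 / real p) (p * N + j) ?F - binomial_exp (1 / real p) (p * N) ?F\<bar> \<le> real j"
        by (rule binomial_exp_Lipschitz_trials[OF s]) (rule lip)
      then have 2: "\<bar>binomial_exp (1 / real p) n ?F - binomial_exp (1 / real p) (p * N) ?F\<bar> \<le> real p"
        using j unfolding n[symmetric] by linarith
      have 3: "\<bar>binomial_exp (1 / real p) (p * N) ?F - sqrt (real N * (1 - 1 / real p) / (2 * pi))\<bar> \<le> 12"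
        using p1 N6 by (intro mean_deviation_asymptotics) auto
      have 4: "\<bar>sqrt (real N * (1 - 1 / real p) / (2 * pi)) - S n\<bar> \<le> 1"
      proof -
        let ?a = "real N * (1 - 1 / real p) / (2 * pi)" and ?c = "real j / real p * (1 - 1 / real p) / (2 * pi)"
        \<comment> \<open>Since n/p = N + j/p with j < p, the radicands differ by at most 1, and
          subadditivity of the square root transfers this to the roots.\<close>
        have sum: "1 / real p * (1 - 1 / real p) * real n / (2 * pi) = ?a + ?c"
        proof -
          have "real n / real p = real N + real j / real p" unfolding n using p1 by (simp add: field_simps)
          moreover have "1 / real p * (1 - 1 / real p) * real n = real n / real p * (1 - 1 / real p)" by simp
          ultimately show ?thesis by (simp only: distrib_right add_divide_distrib)
        qed
        have p1': "0 \<le> 1 - 1 / real p" "1 - 1 / real p \<le> 1" using p1 by auto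
        have a: "0 \<le> ?a" and c: "0 \<le> ?c" using p1' by auto
        have "real j / real p * (1 - 1 / real p) \<le> 1 * 1"
          using j p1' p1 by (intro mult_mono) auto
        then have "?c \<le> 1 * 1 / (2 * pi)" by (intro divide_right_mono) auto
        also have "\<dots> \<le> 1" using pi_gt3 by simp
        finally have c1: "?c \<le> 1" .
        have "sqrt ?a \<le> S n" unfolding S_def sum using c by simp
        moreover have "S n \<le> sqrt ?a + sqrt ?c"
          unfolding S_def sum using a c by (rule sqrt_add_le_add_sqrt)
        moreover have "sqrt ?c \<le> 1" using c1 by simp
        ultimately show ?thesis by linarith
      qed
      from 1 2 3 4 show ?case by linarith
    qed
    then have "(\<lambda>n. expected_p_rank p \<alpha> q n - S n) \<in> O(\<lambda>_. 1)"
    proof (rule O1[rotated])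
      show "\<forall>\<^sub>F n in at_top. \<bar>(expected_p_rank p \<alpha> q n - S n) - (B n - S n)\<bar> \<le> C1"
        using C1 by simp
    qed
    then show "(\<lambda>n. expected_p_rank p \<alpha> q n
        - sqrt ((1 / real p * (1 - 1 / real p) * real n) / (2 * pi))) \<in> O(\<lambda>_. 1)"
      by (simp only: S_def)
  qed
qed

end
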